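(* For every integer $\ell\ge 4$ there exist constants $c_\ell,C_\ell>0$ such that for all sufficiently large $n$, $$c_\ell\, n^{3/2}\le \mathrm{ex}(n,C_{2\ell}^{\square})\le C_\ell\, n^{3/2}.$$
   Context: $\mathrm{ex}(n,F)$ denotes the maximum number of edges in an $n$-vertex graph containing no subgraph isomorphic to $F$. The prism $C_{2\ell}^{\square}=C_{2\ell}\square K_2$ is the Cartesian product of the cycle $C_{2\ell}$ with an edge: it consists of two vertex-disjoint $2\ell$-cycles $a_1a_2\cdots a_{2\ell}a_1$ and $b_1b_2\cdots b_{2\ell}b_1$ together with the matching edges $a_ib_i$, $1\le i\le 2\ell$. *)

theory Defs
  imports Complex_Main
begin

text \<open>Simple graphs are represented by their edge sets: sets of 2-element vertex sets.
  An n-vertex graph is a set of 2-subsets of the vertex set {..<n}.\<close>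

definition graphs_on :: "nat \<Rightarrow> nat set set set" where
  "graphs_on n = {G. \<forall>e\<in>G. e \<subseteq> {..<n} \<and> card e = 2}"

text \<open>G contains a subgraph isomorphic to F (F given by its edge set, without isolated
  vertices): an injective map of the vertices of F into those of G sending edges to edges.\<close>

definition contains_subgraph :: "'a set set \<Rightarrow> 'b set set \<Rightarrow> bool" where
  "contains_subgraph G F \<longleftrightarrow> (\<exists>f. inj_on f (\<Union>F) \<and> (\<forall>e\<in>F. f ` e \<in> G))"

definition ex :: "nat \<Rightarrow> 'b set set \<Rightarrow> nat" where
  "ex n F = Max {card G | G. G \<in> graphs_on n \<and> \<not> contains_subgraph G F}"

text \<open>The prism C_{2l} \<box> K_2 on vertices (i,b), i < 2l, b :: bool;
  a_i = (i,False), b_i = (i,True) (indices shifted to 0..2l-1).\<close>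

definition prism :: "nat \<Rightarrow> (nat \<times> bool) set set" where
  "prism l = {{(i, b), ((i + 1) mod (2 * l), b)} | i b. i < 2 * l}
           \<union> {{(i, False), (i, True)} | i. i < 2 * l}"

end

(* Upper bound, with k = l. After passing to an almost regular subgraph of minimum degree d,
   consider ladders: lists of oriented edges (a_0,b_0), ..., (a_k,b_k) with a_i a_{i+1} and
   b_i b_{i+1} edges. Give a ladder the weight prod 1/cd(b_i,a_{i+1}), cd being the codegree:
   extend by a random neighbour a_{i+1} of a_i, then by a random common neighbour b_{i+1} of b_i
   and a_{i+1}. This weight is symmetric under reversing the ladder and exchanging its sides.
   A positive proportion of the total weight, of order e(G) d^k, is carried by good ladders,
   those whose codegrees near both ends satisfy suitable inequalities; they are built from the
   middle by choosing vertices of high codegree rank. For fixed end edges, the good ladders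
   through a given inner vertex have weight at most D^(k-3), where D is the maximum degree. As
   d^2 is at least a large multiple of the number of vertices, some pair of end edges carries so
   much weight that two good ladders between these edges are internally disjoint; together they
   form a prism.

   Lower bound: the prism contains a 4-cycle, and the incidence graph of the points and the lines
   y = a x + b over the field with 2^m elements has none. *)
theory Submission
  imports Defs "HOL-Library.Z2" "HOL-Algebra.Algebraic_Closure_Type"
begin

text \<open>Orders of magnitude: with n vertices and about d n edges there are about (d n)^2 pairs
  of end edges, so some pair carries good weight of order d^(k-1) / n. This is a large multiple of
  D^(k-3) once d^2 is a large multiple of n; hence the exponent 3/2. The obstacle is the bound
  D^(k-3): prescribing the last edge and one inner vertex must save three of the k choices, although
  the weight may concentrate on steps into the last edge where codegrees are small. Going forward
  from e_0, \<open>G1\<close> at the far end lets the last two steps cost 1 instead of D^2. If the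
  prescribed vertex is a_(k-1) it lies within these two steps, so the last four are treated
  together, and \<open>G4\<close> lets them cost D. Such inequalities relate codegrees at distant
  places. Quantiles carry the comparison across: e_1 is chosen by comparing quantiles, before the
  codegree of a_1 and b_0 is determined. At either end two edges are added to a nonempty core, hence
  k \<ge> 4.\<close>

section \<open>Weighted ladders in a finite graph\<close>

locale fgraph =
  fixes V :: "'a set" and N :: "'a \<Rightarrow> 'a set"
  assumes finite_V: "finite V"
    and N_sub: "N v \<subseteq> V"
    and N_sym: "u \<in> N v \<Longrightarrow> v \<in> N u"
    and N_irrefl: "v \<notin> N v"
begin

definition cd :: "'a \<Rightarrow> 'a \<Rightarrow> nat" where
  "cd u v = card (N u \<inter> N v)"

definition EE :: "('a \<times> 'a) set" where
  "EE = {e. snd e \<in> N (fst e)}"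

definition sc :: "'a \<times> 'a \<Rightarrow> ('a \<times> 'a) set" where
  "sc e = (SIGMA a:N (fst e). N (snd e) \<inter> N a)"

text \<open>As a set this is \<open>sc e\<close> again. The detour through \<open>prod.swap\<close>
  fits the weight of a step backwards, where the second component is chosen as a neighbour and then
  the first as a common neighbour.\<close>

definition pr :: "'a \<times> 'a \<Rightarrow> ('a \<times> 'a) set" where
  "pr e = prod.swap ` sc (prod.swap e)"

definition wt :: "'a \<times> 'a \<Rightarrow> 'a \<times> 'a \<Rightarrow> real" where
  "wt e e' = 1 / real (cd (snd e) (fst e'))"

fun W :: "('a \<times> 'a) list \<Rightarrow> real" where
  "W (x # y # zs) = wt x y * W (y # zs)"
| "W _ = 1"

definition Lad :: "nat \<Rightarrow> ('a \<times> 'a) list set" where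
  "Lad j = {xs. length xs = Suc j \<and> set xs \<subseteq> EE \<and> successively (\<lambda>e e'. e' \<in> sc e) xs}"

definition rv :: "('a \<times> 'a) list \<Rightarrow> ('a \<times> 'a) list" where
  "rv xs = map prod.swap (rev xs)"

definition T :: "nat \<Rightarrow> (('a \<times> 'a) list \<Rightarrow> real) \<Rightarrow> real" where
  "T j F = (\<Sum>xs\<in>Lad j. W xs * F xs)"

lemma finite_N [simp]: "finite (N v)"
  using finite_V N_sub finite_subset by blast

lemma N_comm: "u \<in> N v \<longleftrightarrow> v \<in> N u"
  using N_sym by blast

lemma cd_commute: "cd u v = cd v u"
  by (simp add: cd_def Int_commute)

lemma EE_V: "e \<in> EE \<Longrightarrow> fst e \<in> V \<and> snd e \<in> V"
  unfolding EE_def using N_sub N_sym by blast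

lemma finite_EE [simp]: "finite EE"
proof (rule finite_subset)
  show "EE \<subseteq> V \<times> V"
    using EE_V by (auto simp: mem_Times_iff)
  show "finite (V \<times> V)" using finite_V by simp
qed

lemma finite_sc [simp]: "finite (sc e)"
  by (simp add: sc_def)

lemma swap_EE: "prod.swap e \<in> EE \<longleftrightarrow> e \<in> EE"
  by (simp add: EE_def N_comm)

lemma sc_EE: "e' \<in> sc e \<Longrightarrow> e' \<in> EE"
  by (auto simp: sc_def EE_def)

lemma sc_swap: "e \<in> EE \<Longrightarrow> e' \<in> sc e \<Longrightarrow> prod.swap e \<in> sc (prod.swap e')"
  by (cases e; cases e') (auto simp: sc_def EE_def N_comm)

lemma wt_swap: "wt (prod.swap e') (prod.swap e) = wt e e'"
  by (simp add: wt_def cd_commute)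

lemma wt_nonneg [simp]: "wt e e' \<ge> 0"
  by (simp add: wt_def)

lemma W_nonneg [simp]: "W xs \<ge> 0"
  by (induction xs rule: W.induct) auto

lemma W_snoc: "xs \<noteq> [] \<Longrightarrow> W (xs @ [e]) = W xs * wt (last xs) e"
  by (induction xs rule: W.induct) auto

lemma W_Cons: "xs \<noteq> [] \<Longrightarrow> W (e # xs) = wt e (hd xs) * W xs"
  by (cases xs) auto

lemma rv_rv [simp]: "rv (rv xs) = xs"
  by (simp add: rv_def rev_map)

lemma length_rv [simp]: "length (rv xs) = length xs"
  by (simp add: rv_def)

lemma rv_snoc [simp]: "rv (xs @ [e]) = prod.swap e # rv xs"
  by (simp add: rv_def)

lemma rv_Cons [simp]: "rv (e # xs) = rv xs @ [prod.swap e]"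
  by (simp add: rv_def)

lemma rv_eq_Nil [simp]: "rv xs = [] \<longleftrightarrow> xs = []"
  by (simp add: rv_def)

lemma hd_rv: "xs \<noteq> [] \<Longrightarrow> hd (rv xs) = prod.swap (last xs)"
  by (simp add: rv_def hd_map hd_rev)

lemma last_rv: "xs \<noteq> [] \<Longrightarrow> last (rv xs) = prod.swap (hd xs)"
  by (simp add: rv_def last_map last_rev)

lemma rv_nth: "i < length xs \<Longrightarrow> rv xs ! i = prod.swap (xs ! (length xs - Suc i))"
  by (simp add: rv_def rev_nth)

lemma W_rv [simp]: "W (rv xs) = W xs"
proof (induction xs)
  case (Cons x xs)
  show ?case
  proof (cases "xs = []")
    case False
    then show ?thesis
      using Cons by (simp add: W_snoc W_Cons last_rv wt_swap)
  qed (simp add: rv_def)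
qed (simp add: rv_def)

lemma Lad_length: "xs \<in> Lad j \<Longrightarrow> length xs = Suc j"
  by (simp add: Lad_def)

lemma Lad_ne: "xs \<in> Lad j \<Longrightarrow> xs \<noteq> []"
  by (auto simp: Lad_def)

lemma Lad_last: "xs \<in> Lad j \<Longrightarrow> last xs \<in> EE"
  using last_in_set[of xs] Lad_ne[of xs j] by (auto simp: Lad_def)

lemma Lad_hd: "xs \<in> Lad j \<Longrightarrow> hd xs \<in> EE"
  using hd_in_set[of xs] Lad_ne[of xs j] by (auto simp: Lad_def)

lemma finite_Lad [simp]: "finite (Lad j)"
proof (rule finite_subset)
  show "Lad j \<subseteq> {xs. set xs \<subseteq> EE \<and> length xs = Suc j}"
    by (auto simp: Lad_def)
  show "finite {xs. set xs \<subseteq> EE \<and> length xs = Suc j}"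
    using finite_lists_length_eq[OF finite_EE, of "Suc j"] by simp
qed

lemma rv_Lad: "rv xs \<in> Lad j \<longleftrightarrow> xs \<in> Lad j"
proof -
  have *: "rv ys \<in> Lad j" if "ys \<in> Lad j" for ys
  proof -
    have E: "set ys \<subseteq> EE" and s: "successively (\<lambda>e e'. e' \<in> sc e) ys" and l: "length ys = Suc j"
      using that by (auto simp: Lad_def)
    have "successively (\<lambda>e e'. prod.swap e \<in> sc (prod.swap e')) ys"
      by (rule successively_mono[OF s]) (use E sc_swap in auto)
    then have "successively (\<lambda>e e'. e' \<in> sc e) (rv ys)"
      by (simp add: rv_def successively_map)
    moreover have "set (rv ys) \<subseteq> EE"
      using E swap_EE by (fastforce simp: rv_def)
    ultimately show ?thesis
      using l by (simp add: Lad_def)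
  qed
  show ?thesis
    using *[of xs] *[of "rv xs"] by auto
qed

text \<open>\<open>rv\<close> is a weight-preserving involution of the ladders. It carries every
  estimate at one end over to the other end.\<close>

lemma T_rv: "T j F = T j (\<lambda>xs. F (rv xs))"
  unfolding T_def
  by (rule sum.reindex_bij_witness[where i = rv and j = rv]) (auto simp: rv_Lad)

lemma Lad_snoc: "xs @ [e] \<in> Lad (Suc j) \<longleftrightarrow> xs \<in> Lad j \<and> e \<in> sc (last xs)"
  using sc_EE[of e "last xs"] by (auto simp: Lad_def successively_append_iff)

lemma Lad_0: "Lad 0 = (\<lambda>e. [e]) ` EE"
  by (auto simp: Lad_def length_Suc_conv)

lemma T_0: "T 0 F = (\<Sum>e\<in>EE. F [e])"
  unfolding T_def Lad_0 by (subst sum.reindex) (auto simp: inj_on_def)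

lemma T_Suc: "T (Suc j) F = (\<Sum>xs\<in>Lad j. W xs * (\<Sum>e\<in>sc (last xs). wt (last xs) e * F (xs @ [e])))"
proof -
  have "T (Suc j) F = (\<Sum>(xs, e)\<in>(SIGMA xs:Lad j. sc (last xs)). W xs * wt (last xs) e * F (xs @ [e]))"
    unfolding T_def
  proof (rule sum.reindex_bij_witness[where j = "\<lambda>ys. (butlast ys, last ys)" and i = "\<lambda>(xs, e). xs @ [e]"])
    fix ys assume ys: "ys \<in> Lad (Suc j)"
    then show "(case (butlast ys, last ys) of (xs, e) \<Rightarrow> xs @ [e]) = ys"
      using Lad_ne by auto
    have eq: "ys = butlast ys @ [last ys]"
      using ys Lad_ne by auto
    have ne: "butlast ys \<noteq> []"
      using ys Lad_length[OF ys] by (cases ys) auto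
    have mem: "butlast ys \<in> Lad j \<and> last ys \<in> sc (last (butlast ys))"
      using ys eq Lad_snoc by metis
    then show "(butlast ys, last ys) \<in> (SIGMA xs:Lad j. sc (last xs))"
      by auto
    have "W ys = W (butlast ys) * wt (last (butlast ys)) (last ys)"
      using W_snoc[OF ne, of "last ys"] eq by simp
    then show "(case (butlast ys, last ys) of (xs, e) \<Rightarrow> W xs * wt (last xs) e * F (xs @ [e])) = W ys * F ys"
      using eq by simp
  qed (auto simp: Lad_snoc)
  also have "\<dots> = (\<Sum>xs\<in>Lad j. \<Sum>e\<in>sc (last xs). W xs * wt (last xs) e * F (xs @ [e]))"
    by (subst sum.Sigma) auto
  finally show ?thesis
    by (simp add: sum_distrib_left mult.assoc)
qed

lemma T_Suc_hd: "T (Suc j) F = (\<Sum>xs\<in>Lad j. W xs * (\<Sum>e\<in>pr (hd xs). wt e (hd xs) * F (e # xs)))"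
proof -
  have "T (Suc j) F = (\<Sum>xs\<in>Lad j. W xs * (\<Sum>e\<in>sc (last xs). wt (last xs) e * F (rv (xs @ [e]))))"
    by (subst T_rv) (rule T_Suc)
  also have "\<dots> = (\<Sum>xs\<in>Lad j. W xs * (\<Sum>e\<in>pr (hd xs). wt e (hd xs) * F (e # xs)))"
  proof (rule sum.reindex_bij_witness[where i = rv and j = rv])
    fix xs assume xs: "xs \<in> Lad j"
    then have ne: "xs \<noteq> []" by (rule Lad_ne)
    have "(\<Sum>e\<in>pr (hd (rv xs)). wt e (hd (rv xs)) * F (e # rv xs))
        = (\<Sum>e\<in>sc (last xs). wt (prod.swap e) (prod.swap (last xs)) * F (prod.swap e # rv xs))"
      unfolding hd_rv[OF ne] pr_def swap_swap
      by (subst sum.reindex) (auto simp: inj_on_def)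
    then show "W (rv xs) * (\<Sum>e\<in>pr (hd (rv xs)). wt e (hd (rv xs)) * F (e # rv xs))
        = W xs * (\<Sum>e\<in>sc (last xs). wt (last xs) e * F (rv (xs @ [e])))"
      by (simp add: wt_swap)
  qed (auto simp: rv_Lad)
  finally show ?thesis .
qed

lemma T_mono: "(\<And>xs. xs \<in> Lad j \<Longrightarrow> F xs \<le> G xs) \<Longrightarrow> T j F \<le> T j G"
  unfolding T_def by (intro sum_mono mult_left_mono) auto

lemma T_cong: "(\<And>xs. xs \<in> Lad j \<Longrightarrow> F xs = G xs) \<Longrightarrow> T j F = T j G"
  unfolding T_def by (intro sum.cong) auto

lemma T_add: "T j (\<lambda>xs. F xs + G xs) = T j F + T j G"
  unfolding T_def by (simp add: sum.distrib distrib_left)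

lemma T_cmult: "T j (\<lambda>xs. c * F xs) = c * T j F"
  unfolding T_def by (simp add: sum_distrib_left algebra_simps)

lemma T_sum: "T j (\<lambda>xs. \<Sum>i\<in>I. F i xs) = (\<Sum>i\<in>I. T j (F i))"
  unfolding T_def by (simp add: sum_distrib_left sum.swap[of _ _ I])

lemma T_Suc_le:
  assumes "\<And>xs. xs \<in> Lad j \<Longrightarrow> (\<Sum>e\<in>sc (last xs). wt (last xs) e * F (xs @ [e])) \<le> G xs"
  shows "T (Suc j) F \<le> T j G"
  unfolding T_Suc unfolding T_def using assms by (intro sum_mono mult_left_mono) auto

lemma T_Suc_ge:
  assumes "\<And>xs. xs \<in> Lad j \<Longrightarrow> G xs \<le> (\<Sum>e\<in>sc (last xs). wt (last xs) e * F (xs @ [e]))"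
  shows "T j G \<le> T (Suc j) F"
  unfolding T_Suc unfolding T_def using assms by (intro sum_mono mult_left_mono) auto

lemma T_Suc_hd_le:
  assumes "\<And>xs. xs \<in> Lad j \<Longrightarrow> (\<Sum>e\<in>pr (hd xs). wt e (hd xs) * F (e # xs)) \<le> G xs"
  shows "T (Suc j) F \<le> T j G"
  unfolding T_Suc_hd unfolding T_def using assms by (intro sum_mono mult_left_mono) auto

lemma sum_sc: "(\<Sum>e'\<in>sc e. wt e e' * g e')
    = (\<Sum>a\<in>N (fst e). \<Sum>b\<in>N (snd e) \<inter> N a. g (a, b) / real (cd (snd e) a))"
  unfolding sc_def by (subst sum.Sigma) (auto simp: wt_def intro!: sum.cong)

lemma sum_pr: "(\<Sum>e'\<in>pr e. wt e' e * g e')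
    = (\<Sum>b\<in>N (snd e). \<Sum>a\<in>N (fst e) \<inter> N b. g (a, b) / real (cd b (fst e)))"
proof -
  have w: "wt (prod.swap e') e = wt (prod.swap e) e'" for e'
    using wt_swap[of e' "prod.swap e"] by simp
  have "(\<Sum>e'\<in>pr e. wt e' e * g e') = (\<Sum>e'\<in>sc (prod.swap e). wt (prod.swap e) e' * g (prod.swap e'))"
    unfolding pr_def by (subst sum.reindex) (simp_all add: w)
  also have "\<dots> = (\<Sum>b\<in>N (snd e). \<Sum>a\<in>N (fst e) \<inter> N b. g (a, b) / real (cd b (fst e)))"
    by (subst sum_sc) (simp add: cd_commute)
  finally show ?thesis .
qed

lemma sum_cd: "(\<Sum>b\<in>N x \<inter> N a. c / real (cd x a)) = (if cd x a = 0 then 0 else c)"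
  by (simp add: cd_def)

lemma sum_cd_le1: "(\<Sum>b\<in>N x \<inter> N a. 1 / real (cd x a)) \<le> 1"
  using sum_cd[of 1 x a] by (simp split: if_splits)

lemma cd_pos: "e \<in> EE \<Longrightarrow> a \<in> N (fst e) \<Longrightarrow> cd (snd e) a > 0"
proof -
  assume "e \<in> EE" "a \<in> N (fst e)"
  then have "fst e \<in> N (snd e) \<inter> N a"
    unfolding EE_def using N_sym by blast
  then show ?thesis
    unfolding cd_def by (auto simp: card_gt_0_iff)
qed

lemma cd_pos2: "x \<in> N u \<Longrightarrow> x \<in> N v \<Longrightarrow> cd u v > 0"
  unfolding cd_def by (auto simp: card_gt_0_iff)

text \<open>For given a the weights 1 / cd of the possible b add up to 1. The codegree is positive
  because \<open>fst e\<close> itself is a common neighbour of \<open>snd e\<close> and a.\<close>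

lemma sum_sc_fst: 
  assumes "e \<in> EE"
  shows "(\<Sum>e'\<in>sc e. wt e e' * g (fst e')) = (\<Sum>a\<in>N (fst e). g a)"
  unfolding sum_sc using cd_pos[OF assms] by (intro sum.cong refl) (force simp: cd_def)

lemma sum_pr_snd: 
  assumes "e \<in> EE"
  shows "(\<Sum>e'\<in>pr e. wt e' e * g (snd e')) = (\<Sum>b\<in>N (snd e). g b)"
proof -
  have "cd b (fst e) > 0" if "b \<in> N (snd e)" for b
    using cd_pos2[of "snd e" b "fst e"] that assms by (auto simp: EE_def N_comm)
  then show ?thesis
    unfolding sum_pr by (intro sum.cong refl) (force simp: cd_def Int_commute[of "N (fst e)"])
qed

end

section \<open>Weight estimates when all degrees lie between d and D\<close>

locale dgraph = fgraph +
  fixes d D :: real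
  assumes d_pos: "d > 0"
    and deg_ge: "v \<in> V \<Longrightarrow> d \<le> real (card (N v))"
    and deg_le: "v \<in> V \<Longrightarrow> real (card (N v)) \<le> D"
    and d_le_D: "d \<le> D"
begin

lemma D_pos: "D > 0"
  using d_pos d_le_D by simp

lemma N_le_D: "real (card (N v)) \<le> D"
proof (cases "v \<in> V")
  case False
  then have "N v = {}" using N_sym N_sub by blast
  then show ?thesis using D_pos by simp
qed (rule deg_le)

lemma sum_sc_le: "e \<in> EE \<Longrightarrow> (\<And>e'. e' \<in> sc e \<Longrightarrow> g e' \<le> c) \<Longrightarrow> 0 \<le> c \<Longrightarrow> (\<Sum>e'\<in>sc e. wt e e' * g e') \<le> D * c"
proof -
  assume e: "e \<in> EE" and g: "\<And>e'. e' \<in> sc e \<Longrightarrow> g e' \<le> c" and c: "0 \<le> c"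
  have "(\<Sum>e'\<in>sc e. wt e e' * g e') \<le> (\<Sum>e'\<in>sc e. wt e e' * c)"
    by (intro sum_mono mult_left_mono g) auto
  also have "\<dots> = real (card (N (fst e))) * c"
    using sum_sc_fst[OF e, of "\<lambda>_. c"] by simp
  also have "\<dots> \<le> D * c"
    by (intro mult_right_mono N_le_D c)
  finally show ?thesis .
qed

lemma sum_sc_ge: "e \<in> EE \<Longrightarrow> (\<And>e'. e' \<in> sc e \<Longrightarrow> g e' \<ge> c) \<Longrightarrow> 0 \<le> c \<Longrightarrow> (\<Sum>e'\<in>sc e. wt e e' * g e') \<ge> d * c"
proof -
  assume e: "e \<in> EE" and g: "\<And>e'. e' \<in> sc e \<Longrightarrow> g e' \<ge> c" and c: "0 \<le> c"
  have "d * c \<le> real (card (N (fst e))) * c"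
    using EE_V[OF e] by (intro mult_right_mono deg_ge c) auto
  also have "\<dots> = (\<Sum>e'\<in>sc e. wt e e' * c)"
    using sum_sc_fst[OF e, of "\<lambda>_. c"] by simp
  also have "\<dots> \<le> (\<Sum>e'\<in>sc e. wt e e' * g e')"
    by (intro sum_mono mult_left_mono g) auto
  finally show ?thesis .
qed

lemma sum_pr_le: "e \<in> EE \<Longrightarrow> (\<And>e'. e' \<in> pr e \<Longrightarrow> g e' \<le> c) \<Longrightarrow> 0 \<le> c \<Longrightarrow> (\<Sum>e'\<in>pr e. wt e' e * g e') \<le> D * c"
proof -
  assume e: "e \<in> EE" and g: "\<And>e'. e' \<in> pr e \<Longrightarrow> g e' \<le> c" and c: "0 \<le> c"
  have "(\<Sum>e'\<in>pr e. wt e' e * g e') \<le> (\<Sum>e'\<in>pr e. wt e' e * c)"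
    by (intro sum_mono mult_left_mono g) auto
  also have "\<dots> = real (card (N (snd e))) * c"
    using sum_pr_snd[OF e, of "\<lambda>_. c"] by simp
  also have "\<dots> \<le> D * c"
    by (intro mult_right_mono N_le_D c)
  finally show ?thesis .
qed

lemma T_butlast_le:
  assumes "\<And>xs. xs \<in> Lad j \<Longrightarrow> 0 \<le> G xs"
    and "\<And>xs e. xs \<in> Lad j \<Longrightarrow> e \<in> sc (last xs) \<Longrightarrow> F (xs @ [e]) \<le> G xs"
  shows "T (Suc j) F \<le> D * T j G"
proof -
  have "T (Suc j) F \<le> T j (\<lambda>xs. D * G xs)"
    by (rule T_Suc_le) (use assms Lad_last in \<open>auto intro!: sum_sc_le\<close>)
  then show ?thesis by (simp add: T_cmult)
qed

lemma T_tl_le: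
  assumes "\<And>xs. xs \<in> Lad j \<Longrightarrow> 0 \<le> G xs"
    and "\<And>xs e. xs \<in> Lad j \<Longrightarrow> e \<in> pr (hd xs) \<Longrightarrow> F (e # xs) \<le> G xs"
  shows "T (Suc j) F \<le> D * T j G"
proof -
  have "T (Suc j) F \<le> T j (\<lambda>xs. D * G xs)"
    by (rule T_Suc_hd_le) (use assms Lad_hd in \<open>auto intro!: sum_pr_le\<close>)
  then show ?thesis by (simp add: T_cmult)
qed

text \<open>An edge on which the summand does not depend can be summed out from the front at the
  cost of a factor D; \<open>T_take_le\<close> does the same from the back.\<close>

lemma T_drop_le:
  assumes "\<And>xs. xs \<in> Lad r \<Longrightarrow> 0 \<le> g xs"
  shows "T (i + r) (\<lambda>xs. g (drop i xs)) \<le> D ^ i * T r g"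
proof (induction i)
  case (Suc i)
  have "T (Suc (i + r)) (\<lambda>xs. g (drop (Suc i) xs)) \<le> D * T (i + r) (\<lambda>xs. g (drop i xs))"
  proof (rule T_tl_le)
    fix xs assume xs: "xs \<in> Lad (i + r)"
    have "drop i xs \<in> Lad r"
      using xs successively_append_iff[of _ "take i xs" "drop i xs"] set_drop_subset[of i xs]
      by (auto simp: Lad_def)
    then show "0 \<le> g (drop i xs)" by (rule assms)
  qed simp
  also have "\<dots> \<le> D * (D ^ i * T r g)"
    by (intro mult_left_mono Suc) (use D_pos in auto)
  finally show ?case by (simp add: algebra_simps)
qed simp

lemma T_take_le:
  assumes "\<And>xs. xs \<in> Lad r \<Longrightarrow> 0 \<le> g xs"
  shows "T (r + i) (\<lambda>xs. g (take (Suc r) xs)) \<le> D ^ i * T r g"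
proof (induction i)
  case (Suc i)
  have "T (Suc (r + i)) (\<lambda>xs. g (take (Suc r) xs)) \<le> D * T (r + i) (\<lambda>xs. g (take (Suc r) xs))"
  proof (rule T_butlast_le)
    fix xs assume xs: "xs \<in> Lad (r + i)"
    have "take (Suc r) xs \<in> Lad r"
      using xs successively_append_iff[of _ "take (Suc r) xs" "drop (Suc r) xs"] set_take_subset[of "Suc r" xs]
      by (auto simp: Lad_def)
    then show "0 \<le> g (take (Suc r) xs)" by (rule assms)
  qed (auto dest: Lad_length)
  also have "\<dots> \<le> D * (D ^ i * T r g)"
    by (intro mult_left_mono Suc) (use D_pos in auto)
  finally show ?case by (simp add: algebra_simps)
next
  case 0
  have "T r (\<lambda>xs. g (take (Suc r) xs)) = T r g"
    by (rule T_cong) (auto dest: Lad_length)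
  then show ?case by simp
qed

lemma T_last_le:
  assumes "\<And>e. e \<in> EE \<Longrightarrow> 0 \<le> g e"
  shows "T j (\<lambda>xs. g (last xs)) \<le> D ^ j * (\<Sum>e\<in>EE. g e)"
proof -
  have "T (j + 0) (\<lambda>xs. g (last (drop j xs))) \<le> D ^ j * T 0 (\<lambda>xs. g (last xs))"
    by (rule T_drop_le) (use assms Lad_last in auto)
  moreover have "T j (\<lambda>xs. g (last (drop j xs))) = T j (\<lambda>xs. g (last xs))"
    by (rule T_cong) (auto dest: Lad_length simp: last_drop)
  ultimately show ?thesis by (simp add: T_0)
qed

lemma T_one_ge: "d ^ j * real (card EE) \<le> T j (\<lambda>_. 1)"
proof (induction j)
  case (Suc j)
  have "T j (\<lambda>_. d * 1) \<le> T (Suc j) (\<lambda>_. 1)"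
    by (rule T_Suc_ge, rule sum_sc_ge) (auto intro: Lad_last)
  then have "d * T j (\<lambda>_. 1) \<le> T (Suc j) (\<lambda>_. 1)"
    using T_cmult[of j d "\<lambda>_. 1"] by simp
  moreover have "d * (d ^ j * real (card EE)) \<le> d * T j (\<lambda>_. 1)"
    by (intro mult_left_mono Suc) (use d_pos in auto)
  ultimately show ?case by (simp add: algebra_simps)
qed (simp add: T_0)

lemma card_EE_sum: "real (card EE) = (\<Sum>v\<in>V. real (card (N v)))"
proof -
  have "EE = (SIGMA v:V. N v)"
    using EE_V by (auto simp: EE_def)
  then show ?thesis
    by (simp add: card_SigmaI finite_V)
qed

lemma card_EE_ge: "d * real (card V) \<le> real (card EE)"
  unfolding card_EE_sum using sum_mono[of V "\<lambda>_. d" "\<lambda>v. real (card (N v))"] deg_ge by (simp add: algebra_simps)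

lemma card_EE_le: "real (card EE) \<le> D * real (card V)"
  unfolding card_EE_sum using sum_mono[of V "\<lambda>v. real (card (N v))" "\<lambda>_. D"] deg_le by (simp add: algebra_simps)

end

section \<open>Ranks, codegree quantiles and exceptional edges\<close>

text \<open>Take s of minimal value in the exceptional set. The whole exceptional set then lies at
  or above s, and by definition few elements do.\<close>

lemma card_low_rank_le:
  fixes f :: "'b \<Rightarrow> 'c::linorder"
  assumes S: "finite S" and eta: "\<eta> \<ge> 0"
  shows "real (card {s\<in>S. real (card {t\<in>S. f s \<le> f t}) < \<eta> * real (card S)}) \<le> \<eta> * real (card S)"
proof -
  let ?B = "{s\<in>S. real (card {t\<in>S. f s \<le> f t}) < \<eta> * real (card S)}"
  show ?thesis
  proof (cases "?B = {}")
    case False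
    have fin: "finite ?B" using S by simp
    obtain s where s: "s \<in> ?B" "\<And>t. t \<in> ?B \<Longrightarrow> f s \<le> f t"
      using False fin by (metis (no_types, lifting) arg_min_if_finite(1) arg_min_least)
    have "?B \<subseteq> {t\<in>S. f s \<le> f t}"
      using s by auto
    then have "card ?B \<le> card {t\<in>S. f s \<le> f t}"
      using S by (intro card_mono) auto
    then show ?thesis using s(1) by simp
  next
    case True
    show ?thesis unfolding True using eta by simp
  qed
qed

lemma card_high_rank_le:
  fixes f :: "'b \<Rightarrow> nat"
  assumes S: "finite S" and eta: "\<eta> \<ge> 0"
  shows "real (card {s\<in>S. real (card {t\<in>S. f t \<le> f s}) < \<eta> * real (card S)}) \<le> \<eta> * real (card S)"
  using card_low_rank_le[OF S eta, of "\<lambda>s. - int (f s)"] by simp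

lemma card_filter_sum: "finite S \<Longrightarrow> real (card {s\<in>S. P s}) = (\<Sum>s\<in>S. of_bool (P s))"
  by (simp add: sum.If_cases of_bool_def Int_def)

context fgraph
begin

text \<open>The upper \<open>\<eta>\<close>-quantile of \<open>cd x\<close> on \<open>N y\<close>.\<close>

definition Tq :: "real \<Rightarrow> 'a \<Rightarrow> 'a \<Rightarrow> nat" where
  "Tq \<eta> x y = (LEAST t. real (card {x'\<in>N y. t < cd x x'}) < \<eta> * real (card (N y)))"

lemma sum_EE: "(\<Sum>e\<in>EE. g e) = (\<Sum>v\<in>V. \<Sum>u\<in>N v. g (v, u))"
proof -
  have "EE = (SIGMA v:V. N v)"
    using EE_V by (auto simp: EE_def)
  then show ?thesis
    by (simp add: sum.Sigma finite_V)
qed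

lemma sum_EE_swap: "(\<Sum>e\<in>EE. g (prod.swap e)) = (\<Sum>e\<in>EE. g e)"
  by (rule sum.reindex_bij_witness[where i = prod.swap and j = prod.swap]) (auto simp: EE_def N_comm)

lemma sum_N_comm: "(\<Sum>v\<in>V. \<Sum>u\<in>N v. g v u) = (\<Sum>v\<in>V. \<Sum>u\<in>N v. g u v)"
  using sum_EE_swap[of "\<lambda>(v, u). g u v"] unfolding sum_EE by simp

lemma T_Suc2: "T (Suc (Suc j)) F = T j (\<lambda>ys. \<Sum>e0\<in>pr (hd ys). wt e0 (hd ys) *
    (\<Sum>e\<in>sc (last ys). wt (last ys) e * F (e0 # ys @ [e])))"
proof -
  have "T (Suc (Suc j)) F = T (Suc j) (\<lambda>xs. \<Sum>e\<in>sc (last xs). wt (last xs) e * F (xs @ [e]))"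
    by (subst T_Suc) (simp add: T_def)
  also have "\<dots> = T j (\<lambda>ys. \<Sum>e0\<in>pr (hd ys). wt e0 (hd ys) *
    (\<Sum>e\<in>sc (last ys). wt (last ys) e * F (e0 # ys @ [e])))"
    by (subst T_Suc_hd) (auto simp: T_def Lad_ne intro!: sum.cong)
  finally show ?thesis .
qed

text \<open>Given the middle of the ladder, the steps added at its two ends are independent, so the
  sum factorises. This is how a ladder is extended at both ends at once.\<close>

lemma T_Suc2_prod:
  "T (Suc (Suc j)) (\<lambda>xs. P (hd xs) (butlast (tl xs)) * Q (butlast (tl xs)) (last xs))
    = T j (\<lambda>ys. (\<Sum>e\<in>pr (hd ys). wt e (hd ys) * P e ys) * (\<Sum>e\<in>sc (last ys). wt (last ys) e * Q ys e))"
  unfolding T_Suc2 sum_product by (rule T_cong) (simp add: sum_distrib_left algebra_simps)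

lemma sum_pr_swap: "(\<Sum>e'\<in>sc e. wt e e' * g (prod.swap e')) = (\<Sum>e'\<in>pr (prod.swap e). wt e' (prod.swap e) * g e')"
  unfolding pr_def by (subst sum.reindex) (simp_all add: wt_swap)

end

context dgraph
begin

lemma N_ne: "v \<in> V \<Longrightarrow> N v \<noteq> {}"
  using deg_ge[of v] d_pos by auto

text \<open>Codegrees may tie, so strict and weak inequality are treated apart: fewer than a
  proportion \<eta> lie strictly above the quantile, which bounds the failures, and by
  \<open>Tq_ge\<close> at least \<eta> lie at or above it, which provides choices.\<close>

lemma Tq_gt:
  assumes "y \<in> V" "\<eta> > 0"
  shows "real (card {x'\<in>N y. Tq \<eta> x y < cd x x'}) < \<eta> * real (card (N y))"
  unfolding Tq_def
proof (rule LeastI_ex)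
  have "{x'\<in>N y. Max (cd x ` N y) < cd x x'} = {}"
    by (auto simp: not_less)
  moreover have "0 < \<eta> * real (card (N y))"
    using N_ne[OF assms(1)] assms(2) by (simp add: card_gt_0_iff)
  ultimately show "\<exists>t. real (card {x'\<in>N y. t < cd x x'}) < \<eta> * real (card (N y))"
    by (metis card.empty of_nat_0)
qed

lemma Tq_ge:
  assumes "\<eta> \<le> 1"
  shows "\<eta> * real (card (N y)) \<le> real (card {x'\<in>N y. Tq \<eta> x y \<le> cd x x'})"
proof (cases "Tq \<eta> x y")
  case 0
  then show ?thesis using mult_right_mono[OF assms, of "real (card (N y))"] by simp
next
  case (Suc t)
  have "\<not> (real (card {x'\<in>N y. t < cd x x'}) < \<eta> * real (card (N y)))"
    by (rule not_less_Least) (use Suc in \<open>simp add: Tq_def\<close>)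
  then show ?thesis using Suc by (simp add: Suc_le_eq)
qed

text \<open>Outside this set, z can be exchanged for a proportion \<eta>1 of the neighbours of x
  without lowering the quantile.\<close>

definition Bad1 :: "real \<Rightarrow> real \<Rightarrow> ('a \<times> 'a) set" where
  "Bad1 \<eta> \<eta>1 = {(x, z) \<in> EE. real (card {x'\<in>N x. Tq \<eta> x z \<le> Tq \<eta> x x'}) < \<eta>1 * real (card (N x))}"

text \<open>For these x' the vertex x is too near the top among the common neighbours of y and x',
  so that exchanging x for a random one of them would mostly lower the quantile.\<close>

definition bad2 :: "real \<Rightarrow> real \<Rightarrow> 'a \<Rightarrow> 'a \<Rightarrow> 'a set" where
  "bad2 \<eta> \<eta>2 x y = {x'\<in>N x. real (card {y'\<in>N y \<inter> N x'. Tq \<eta> x x' \<le> Tq \<eta> y' x'}) < \<eta>2 * real (cd y x')}"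

definition Bad2 :: "real \<Rightarrow> real \<Rightarrow> real \<Rightarrow> ('a \<times> 'a) set" where
  "Bad2 \<eta> \<eta>1 \<eta>2 = {(x, y) \<in> EE. \<eta>1 / 2 * real (card (N x)) < real (card (bad2 \<eta> \<eta>2 x y))}"

lemma card_Bad1_le:
  assumes "\<eta>1 \<ge> 0"
  shows "real (card (Bad1 \<eta> \<eta>1)) \<le> \<eta>1 * real (card EE)"
proof -
  have "Bad1 \<eta> \<eta>1 = (SIGMA x:V. {z\<in>N x. real (card {x'\<in>N x. Tq \<eta> x z \<le> Tq \<eta> x x'}) < \<eta>1 * real (card (N x))})"
    using EE_V by (auto simp: Bad1_def EE_def)
  then have "real (card (Bad1 \<eta> \<eta>1)) = (\<Sum>x\<in>V. real (card {z\<in>N x. real (card {x'\<in>N x. Tq \<eta> x z \<le> Tq \<eta> x x'}) < \<eta>1 * real (card (N x))}))"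
    by (simp add: card_SigmaI finite_V)
  also have "\<dots> \<le> (\<Sum>x\<in>V. \<eta>1 * real (card (N x)))"
    by (intro sum_mono card_low_rank_le) (use assms in auto)
  finally show ?thesis by (simp add: card_EE_sum sum_distrib_left)
qed

lemma sum_V_cd_le: "(\<Sum>y\<in>V. real (cd y x)) \<le> D * real (card (N x))"
proof -
  have "(\<Sum>y\<in>V. real (cd y x)) = (\<Sum>y\<in>V. \<Sum>u\<in>N x. of_bool (y \<in> N u))"
  proof (rule sum.cong[OF refl])
    fix y
    have "N y \<inter> N x = {u\<in>N x. y \<in> N u}" by (auto simp: N_comm)
    then show "real (cd y x) = (\<Sum>u\<in>N x. of_bool (y \<in> N u))"
      unfolding cd_def by (simp only: card_filter_sum[OF finite_N])
  qed
  also have "\<dots> = (\<Sum>u\<in>N x. \<Sum>y\<in>V. of_bool (y \<in> N u))"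
    by (rule sum.swap)
  also have "\<dots> = (\<Sum>u\<in>N x. real (card (N u)))"
  proof (rule sum.cong[OF refl])
    fix u
    have "N u = {y\<in>V. y \<in> N u}" using N_sub by auto
    then show "(\<Sum>y\<in>V. of_bool (y \<in> N u)) = real (card (N u))"
      using card_filter_sum[OF finite_V, of "\<lambda>y. y \<in> N u"] by simp
  qed
  also have "\<dots> \<le> (\<Sum>u\<in>N x. D)" by (intro sum_mono N_le_D)
  finally show ?thesis by (simp add: mult.commute)
qed

lemma sum_card_triples: "(\<Sum>x\<in>N y. real (card {x'\<in>N x. R x' x})) = (\<Sum>x'\<in>V. real (card {x\<in>N y \<inter> N x'. R x' x}))"
proof -
  have "(\<Sum>x\<in>N y. real (card {x'\<in>N x. R x' x})) = (\<Sum>x\<in>N y. \<Sum>x'\<in>V. of_bool (x' \<in> N x \<and> R x' x))"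
  proof (rule sum.cong[OF refl])
    fix x
    have "{x'\<in>N x. R x' x} = {x'\<in>V. x' \<in> N x \<and> R x' x}" using N_sub by auto
    then show "real (card {x'\<in>N x. R x' x}) = (\<Sum>x'\<in>V. of_bool (x' \<in> N x \<and> R x' x))"
      using card_filter_sum[OF finite_V, of "\<lambda>x'. x' \<in> N x \<and> R x' x"] by simp
  qed
  also have "\<dots> = (\<Sum>x'\<in>V. \<Sum>x\<in>N y. of_bool (x' \<in> N x \<and> R x' x))"
    by (rule sum.swap)
  also have "\<dots> = (\<Sum>x'\<in>V. real (card {x\<in>N y \<inter> N x'. R x' x}))"
  proof (rule sum.cong[OF refl])
    fix x'
    have "{x\<in>N y \<inter> N x'. R x' x} = {x\<in>N y. x' \<in> N x \<and> R x' x}" by (auto simp: N_comm)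
    then show "(\<Sum>x\<in>N y. of_bool (x' \<in> N x \<and> R x' x)) = real (card {x\<in>N y \<inter> N x'. R x' x})"
      by (simp only: card_filter_sum[OF finite_N])
  qed
  finally show ?thesis .
qed

text \<open>Count paths y, x, x' by their end points: the hypothesis bounds the bad middle vertices
  by c times the codegree, and the codegrees add up to the number of paths of length two.\<close>

lemma sum_triples_le:
  assumes "\<And>x' y. real (card {x\<in>N y \<inter> N x'. R x' y x}) \<le> c * real (cd y x')" and c: "c \<ge> 0"
  shows "(\<Sum>(x, y)\<in>EE. real (card {x'\<in>N x. R x' y x})) \<le> c * D * real (card EE)"
proof -
  have "(\<Sum>(x, y)\<in>EE. real (card {x'\<in>N x. R x' y x})) = (\<Sum>y\<in>V. \<Sum>x\<in>N y. real (card {x'\<in>N x. R x' y x}))"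
    by (subst sum_EE) (simp add: sum_N_comm[of "\<lambda>x y. real (card {x'\<in>N x. R x' y x})"])
  also have "\<dots> = (\<Sum>y\<in>V. \<Sum>x'\<in>V. real (card {x\<in>N y \<inter> N x'. R x' y x}))"
    by (rule sum.cong[OF refl]) (rule sum_card_triples)
  also have "\<dots> \<le> (\<Sum>y\<in>V. \<Sum>x'\<in>V. c * real (cd y x'))"
    by (intro sum_mono assms)
  also have "\<dots> = (\<Sum>y\<in>V. c * (\<Sum>x'\<in>V. real (cd x' y)))"
    by (simp add: sum_distrib_left cd_commute)
  also have "\<dots> \<le> (\<Sum>y\<in>V. c * (D * real (card (N y))))"
    by (intro sum_mono mult_left_mono sum_V_cd_le c)
  finally show ?thesis
    by (simp add: card_EE_sum sum_distrib_left mult.assoc)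
qed

text \<open>Markov's inequality: each edge of \<open>Bad2\<close> contributes at least \<eta>1 d / 2
  to a sum of at most \<eta>2 D |EE|. The latter holds because for fixed y and x' at most \<eta>2
  \<open>cd y x'\<close> vertices x have low rank.\<close>

lemma card_Bad2_le:
  assumes "\<eta>1 > 0" "\<eta>2 \<ge> 0"
  shows "real (card (Bad2 \<eta> \<eta>1 \<eta>2)) \<le> 2 * \<eta>2 * D / (\<eta>1 * d) * real (card EE)"
proof -
  have "\<eta>1 / 2 * d * real (card (Bad2 \<eta> \<eta>1 \<eta>2)) = (\<Sum>e\<in>Bad2 \<eta> \<eta>1 \<eta>2. \<eta>1 / 2 * d)"
    by simp
  also have "\<dots> \<le> (\<Sum>(x, y)\<in>Bad2 \<eta> \<eta>1 \<eta>2. real (card (bad2 \<eta> \<eta>2 x y)))"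
  proof (rule sum_mono, clarify)
    fix x y assume xy: "(x, y) \<in> Bad2 \<eta> \<eta>1 \<eta>2"
    then have "x \<in> V" using EE_V[of "(x, y)"] by (simp add: Bad2_def)
    then have "\<eta>1 / 2 * d \<le> \<eta>1 / 2 * real (card (N x))"
      using assms by (intro mult_left_mono deg_ge) auto
    then show "\<eta>1 / 2 * d \<le> real (card (bad2 \<eta> \<eta>2 x y))"
      using xy by (simp add: Bad2_def)
  qed
  also have "\<dots> \<le> (\<Sum>(x, y)\<in>EE. real (card (bad2 \<eta> \<eta>2 x y)))"
    by (intro sum_mono2) (auto simp: Bad2_def)
  also have "\<dots> \<le> \<eta>2 * D * real (card EE)"
    unfolding bad2_def
  proof (rule sum_triples_le)
    fix x' y
    show "real (card {x \<in> N y \<inter> N x'. real (card {y' \<in> N y \<inter> N x'. Tq \<eta> x x' \<le> Tq \<eta> y' x'}) < \<eta>2 * real (cd y x')}) \<le> \<eta>2 * real (cd y x')"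
      unfolding cd_def by (rule card_low_rank_le) (use assms in auto)
  qed (use assms in auto)
  finally show ?thesis
    using assms d_pos by (simp add: field_simps)
qed

text \<open>The weights over the common neighbours of y and x' add up to 1, so each x' in A outside
  B contributes at least c.\<close>

lemma sum_pr_ge:
  assumes e: "(y, x) \<in> EE" and A: "A \<subseteq> N x" "\<alpha> \<le> real (card A)" and B: "finite B" "real (card B) \<le> \<beta>"
    and c: "c \<ge> 0"
    and R: "\<And>x'. x' \<in> A \<Longrightarrow> x' \<notin> B \<Longrightarrow> c * real (cd y x') \<le> real (card {a\<in>N y \<inter> N x'. R a x'})"
  shows "(\<alpha> - \<beta>) * c \<le> (\<Sum>e\<in>pr (y, x). wt e (y, x) * of_bool (R (fst e) (snd e)))"
proof -
  have "real (card A) - real (card B) \<le> real (card (A - B))"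
    using diff_card_le_card_Diff[OF B(1), of A] by linarith
  then have "(\<alpha> - \<beta>) * c \<le> real (card (A - B)) * c"
    using A B c by (intro mult_right_mono) auto
  also have "\<dots> = (\<Sum>x'\<in>A - B. c)" by simp
  also have "\<dots> \<le> (\<Sum>x'\<in>A - B. \<Sum>a\<in>N y \<inter> N x'. of_bool (R a x') / real (cd x' y))"
  proof (rule sum_mono)
    fix x' assume x': "x' \<in> A - B"
    then have cd: "cd y x' > 0"
      using cd_pos2[of x y x'] A(1) e by (auto simp: N_comm EE_def)
    have "c * real (cd y x') \<le> real (card {a\<in>N y \<inter> N x'. R a x'})"
      using x' R by auto
    also have "\<dots> = (\<Sum>a\<in>N y \<inter> N x'. of_bool (R a x'))"
      by (rule card_filter_sum) simp
    finally have "c * real (cd y x') \<le> (\<Sum>a\<in>N y \<inter> N x'. of_bool (R a x'))" .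
    then show "c \<le> (\<Sum>a\<in>N y \<inter> N x'. of_bool (R a x') / real (cd x' y))"
      using cd by (simp add: sum_divide_distrib[symmetric] cd_commute[of x' y] field_simps)
  qed
  also have "\<dots> \<le> (\<Sum>x'\<in>N x. \<Sum>a\<in>N y \<inter> N x'. of_bool (R a x') / real (cd x' y))"
    using A by (intro sum_mono2 sum_nonneg) auto
  also have "\<dots> = (\<Sum>e\<in>pr (y, x). wt e (y, x) * of_bool (R (fst e) (snd e)))"
    by (subst sum_pr) simp
  finally show ?thesis .
qed

text \<open>The quantile is kept in two exchanges: z becomes x', with x fixed, since (x, z) avoids
  \<open>Bad1\<close>; then x becomes y', with x' fixed, for all x' outside \<open>bad2\<close>,
  which takes away at most half of the candidates.\<close>

lemma extension_ge:
  assumes "(x, z) \<in> EE - Bad1 \<eta> \<eta>1" "(x, y) \<in> EE - Bad2 \<eta> \<eta>1 \<eta>2" "\<eta>1 \<ge> 0" "\<eta>2 \<ge> 0"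
  shows "\<eta>1 * \<eta>2 / 2 * d \<le> (\<Sum>e\<in>pr (y, x). wt e (y, x) * of_bool (Tq \<eta> x z \<le> Tq \<eta> (fst e) (snd e)))"
proof -
  have e: "(y, x) \<in> EE" using assms by (auto simp: EE_def N_comm)
  let ?A = "{x'\<in>N x. Tq \<eta> x z \<le> Tq \<eta> x x'}"
  have "(\<eta>1 * real (card (N x)) - \<eta>1 / 2 * real (card (N x))) * \<eta>2
    \<le> (\<Sum>e\<in>pr (y, x). wt e (y, x) * of_bool (Tq \<eta> x z \<le> Tq \<eta> (fst e) (snd e)))"
  proof (rule sum_pr_ge[OF e, where A = ?A and B = "bad2 \<eta> \<eta>2 x y"])
    fix x' assume x': "x' \<in> ?A" "x' \<notin> bad2 \<eta> \<eta>2 x y"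
    then have "\<eta>2 * real (cd y x') \<le> real (card {y'\<in>N y \<inter> N x'. Tq \<eta> x x' \<le> Tq \<eta> y' x'})"
      by (auto simp: bad2_def)
    also have "\<dots> \<le> real (card {y'\<in>N y \<inter> N x'. Tq \<eta> x z \<le> Tq \<eta> y' x'})"
      using x' by (intro of_nat_mono card_mono) auto
    finally show "\<eta>2 * real (cd y x') \<le> real (card {y'\<in>N y \<inter> N x'. Tq \<eta> x z \<le> Tq \<eta> y' x'})" .
  qed (use assms in \<open>auto simp: Bad1_def Bad2_def bad2_def\<close>)
  moreover have "\<eta>1 / 2 * \<eta>2 * d \<le> \<eta>1 / 2 * \<eta>2 * real (card (N x))"
    using assms EE_V[OF e] by (intro mult_left_mono deg_ge) auto
  ultimately show ?thesis by (simp add: algebra_simps)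
qed

end

section \<open>Building good ladders outwards from a core\<close>

definition mid :: "'b list \<Rightarrow> 'b list" where
  "mid xs = butlast (tl xs)"

lemma mid_Cons_snoc [simp]: "mid (e # ys @ [e']) = ys"
  by (simp add: mid_def)

lemma list_ends:
  assumes "length xs = Suc (Suc m)"
  obtains e ys e' where "xs = e # ys @ [e']" "length ys = m"
proof -
  obtain e zs where "xs = e # zs" "length zs = Suc m"
    using assms by (cases xs) auto
  moreover then obtain ys e' where "zs = ys @ [e']" "length ys = m"
    by (metis length_append_singleton old.nat.inject rev_exhaust length_0_conv nat.distinct(1))
  ultimately show ?thesis using that by blast
qed

context fgraph
begin

lemma mid_rv: "length xs \<ge> 2 \<Longrightarrow> mid (rv xs) = rv (mid xs)"
proof -
  assume "length xs \<ge> 2"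
  then have "length xs = Suc (Suc (length xs - 2))" by simp
  then show ?thesis by (rule list_ends) simp
qed

lemma Lad_step: "xs \<in> Lad j \<Longrightarrow> i < j \<Longrightarrow> xs ! Suc i \<in> sc (xs ! i)"
  by (auto simp: Lad_def intro: successively_nth)

text \<open>A core is a ladder \<open>e\<^sub>2 \<dots> e\<^sub>k\<^sub>-\<^sub>2\<close>; the pivot is \<open>b\<^sub>3\<close>, or \<open>a\<^sub>2\<close> if \<open>k = 4\<close>.\<close>

definition pivot :: "('a \<times> 'a) list \<Rightarrow> 'a" where
  "pivot ys = (if length ys = 1 then fst (hd ys) else snd (ys ! 1))"

text \<open>Here \<open>e\<close> is e_1 and \<open>ys\<close> is the core, starting with e_2. This
  is the middle link of the chain in \<open>G4_I\<close>; it compares quantiles because b_0 is not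
  yet chosen.\<close>

definition sel :: "real \<Rightarrow> 'a \<times> 'a \<Rightarrow> ('a \<times> 'a) list \<Rightarrow> bool" where
  "sel \<eta> e ys \<longleftrightarrow> Tq \<eta> (snd (hd ys)) (pivot ys) \<le> Tq \<eta> (fst e) (snd e)"

text \<open>Here \<open>ps\<close> is the ladder e_1, ..., e_(k-1), so \<open>ps ! 1\<close> is e_2.
  Length 3 means k = 4; then e_4 is not in \<open>ps\<close>, and a_3 stands in for b_4, as a_2 does
  for b_3 in \<open>pivot\<close>.\<close>

definition fail :: "real \<Rightarrow> ('a \<times> 'a) list \<Rightarrow> bool" where
  "fail \<eta> ps \<longleftrightarrow> (if length ps = 3 then Tq \<eta> (snd (ps ! 1)) (fst (ps ! 1)) < cd (snd (ps ! 1)) (fst (ps ! 2))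
      else Tq \<eta> (snd (ps ! 1)) (snd (ps ! 2)) < cd (snd (ps ! 1)) (snd (ps ! 3)))"

text \<open>With \<open>e\<close> = e_1 and \<open>u\<close> = a_2, these are the candidates b for
  b_0 that leave too few a_0 satisfying the second inequality of \<open>extend\<close>: the codegree
  of b_1 with a_2 is too low among the common neighbours of a_1 and b.\<close>

definition bd :: "real \<Rightarrow> 'a \<times> 'a \<Rightarrow> 'a \<Rightarrow> 'a set" where
  "bd \<eta>3 e u = {b\<in>N (snd e). real (card {a\<in>N (fst e) \<inter> N b. cd a u \<le> cd (snd e) u}) < \<eta>3 * real (cd (fst e) b)}"

definition extend :: "real \<Rightarrow> 'a \<times> 'a \<Rightarrow> ('a \<times> 'a) list \<Rightarrow> bool" where
  "extend \<eta> e ps \<longleftrightarrow> Tq \<eta> (fst (hd ps)) (snd (hd ps)) \<le> cd (fst (hd ps)) (snd e)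
     \<and> cd (fst e) (fst (ps ! 1)) \<le> cd (snd (hd ps)) (fst (ps ! 1))"

text \<open>\<open>G1\<close> bounds by 1 the total weight of the two steps from a given \<open>e\<^sub>2\<close> back to a given \<open>e\<^sub>0\<close>; \<open>G4\<close> bounds
  by \<open>D\<close> that of the four steps from \<open>e\<^sub>4\<close> back to \<open>e\<^sub>0\<close> with \<open>b\<^sub>1\<close> also prescribed.\<close>

definition G1 :: "('a \<times> 'a) list \<Rightarrow> bool" where
  "G1 xs \<longleftrightarrow> cd (fst (xs ! 0)) (fst (xs ! 2)) \<le> cd (snd (xs ! 1)) (fst (xs ! 2))"

definition G4 :: "('a \<times> 'a) list \<Rightarrow> bool" where
  "G4 xs \<longleftrightarrow> cd (snd (xs ! 4)) (snd (xs ! 2)) \<le> cd (fst (xs ! 1)) (snd (xs ! 0))"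

definition good :: "('a \<times> 'a) list \<Rightarrow> bool" where
  "good xs \<longleftrightarrow> G1 xs \<and> G4 xs \<and> G1 (rv xs) \<and> G4 (rv xs)"

lemma G1_I: "length ps \<ge> 2 \<Longrightarrow> extend \<eta> e ps \<Longrightarrow> G1 (e # ps @ es)"
  by (auto simp: G1_def extend_def nth_append hd_conv_nth)

text \<open>For k \<ge> 5 the chain is cd(b_2, b_4) \<le> Tq(b_2, b_3) \<le> Tq(a_1, b_1) \<le>
  cd(a_1, b_0), its links being the negation of \<open>fail\<close>, then \<open>sel\<close>, then
  \<open>extend\<close>. For k = 4 it starts from cd(b_2, a_3) \<le> Tq(b_2, a_2), and the reversed
  \<open>G1\<close> gives cd(b_2, b_4) \<le> cd(b_2, a_3).\<close>

lemma G4_I: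
  assumes l: "length ps = j + 3" and e: "extend \<eta> e ps" and s: "sel \<eta> (hd ps) (mid ps)" and f: "\<not> fail \<eta> ps"
    and G1: "G1 (rv (e # ps @ [e']))"
  shows "G4 (e # ps @ [e'])"
proof -
  obtain p ys p' where ps: "ps = p # ys @ [p']" and ly: "length ys = Suc j"
    by (rule list_ends[of ps "Suc j"]) (use l in simp)
  show ?thesis
  proof (cases j)
    case 0
    then obtain y where "ys = [y]" using ly by (cases ys) auto
    then show ?thesis
      using assms unfolding ps
      by (auto simp: G4_def G1_def extend_def sel_def fail_def pivot_def rv_def mid_def cd_commute)
  next
    case (Suc i)
    then obtain y y' zs where ys: "ys = y # y' # zs" using ly by (cases ys; cases "tl ys") auto
    have "ps ! 3 = (e # ps @ [e']) ! 4" 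
      using l Suc by (simp add: nth_append)
    then show ?thesis
      using assms Suc unfolding ps ys
      by (auto simp: G4_def extend_def sel_def fail_def pivot_def mid_def cd_commute)
  qed
qed

end

context dgraph
begin

lemma T_hd_le:
  assumes "\<And>e. e \<in> EE \<Longrightarrow> 0 \<le> g e"
  shows "T j (\<lambda>xs. g (hd xs)) \<le> D ^ j * (\<Sum>e\<in>EE. g e)"
proof -
  have "T j (\<lambda>xs. g (hd xs)) = T j (\<lambda>xs. g (prod.swap (last xs)))"
    by (subst T_rv) (auto intro!: T_cong simp: hd_rv Lad_ne)
  also have "\<dots> \<le> D ^ j * (\<Sum>e\<in>EE. g (prod.swap e))"
    by (rule T_last_le) (use assms swap_EE in auto)
  finally show ?thesis by (simp add: sum_EE_swap)
qed

lemma T_one_le: "T j (\<lambda>_. 1) \<le> D ^ j * real (card EE)"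
  using T_hd_le[of "\<lambda>_. 1" j] by simp

definition badc :: "real \<Rightarrow> real \<Rightarrow> real \<Rightarrow> ('a \<times> 'a) list \<Rightarrow> bool" where
  "badc \<eta> \<eta>1 \<eta>2 ys \<longleftrightarrow> (snd (hd ys), pivot ys) \<in> Bad1 \<eta> \<eta>1 \<or> (snd (hd ys), fst (hd ys)) \<in> Bad2 \<eta> \<eta>1 \<eta>2"

text \<open>The condition concerns at most the first two edges, and summing out all other edges
  costs a factor D each. What remains is a count of exceptional edges.\<close>

lemma T_badc:
  assumes "\<eta>1 > 0" "\<eta>2 \<ge> 0"
  shows "T j (\<lambda>ys. of_bool (badc \<eta> \<eta>1 \<eta>2 ys)) \<le> (\<eta>1 + 2 * \<eta>2 * D / (\<eta>1 * d)) * real (card EE) * D ^ j"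
proof -
  have s: "(\<Sum>e\<in>EE. of_bool (prod.swap e \<in> B)) = real (card B)" if "B \<subseteq> EE" for B
  proof -
    have "(\<Sum>e\<in>EE. of_bool (prod.swap e \<in> B)) = (\<Sum>e\<in>EE. of_bool (e \<in> B) :: real)"
      by (rule sum_EE_swap)
    also have "\<dots> = real (card {e\<in>EE. e \<in> B})"
      by (rule card_filter_sum[symmetric]) simp
    also have "{e\<in>EE. e \<in> B} = B" using that by auto
    finally show ?thesis .
  qed
  have 2: "T j (\<lambda>ys. of_bool ((snd (hd ys), fst (hd ys)) \<in> Bad2 \<eta> \<eta>1 \<eta>2)) \<le> D ^ j * (2 * \<eta>2 * D / (\<eta>1 * d) * real (card EE))"
  proof -
    have "T j (\<lambda>ys. of_bool (prod.swap (hd ys) \<in> Bad2 \<eta> \<eta>1 \<eta>2)) \<le> D ^ j * (\<Sum>e\<in>EE. of_bool (prod.swap e \<in> Bad2 \<eta> \<eta>1 \<eta>2))"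
      by (rule T_hd_le) auto
    also have "(\<Sum>e\<in>EE. of_bool (prod.swap e \<in> Bad2 \<eta> \<eta>1 \<eta>2)) = real (card (Bad2 \<eta> \<eta>1 \<eta>2))"
      by (rule s) (auto simp: Bad2_def)
    also have "D ^ j * \<dots> \<le> D ^ j * (2 * \<eta>2 * D / (\<eta>1 * d) * real (card EE))"
      using D_pos by (intro mult_left_mono card_Bad2_le assms) auto
    finally show ?thesis by (simp add: prod.swap_def)
  qed
  have 1: "T j (\<lambda>ys. of_bool ((snd (hd ys), pivot ys) \<in> Bad1 \<eta> \<eta>1)) \<le> D ^ j * (\<eta>1 * real (card EE))"
  \<comment> \<open>The pivot belongs to the first edge of the core if j = 0 and to the second edge
    otherwise.\<close>
  proof (cases j)
    case 0
    have "T j (\<lambda>ys. of_bool ((snd (hd ys), pivot ys) \<in> Bad1 \<eta> \<eta>1)) = (\<Sum>e\<in>EE. of_bool (prod.swap e \<in> Bad1 \<eta> \<eta>1))"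
      unfolding 0 T_0 by (simp add: pivot_def prod.swap_def)
    also have "\<dots> \<le> \<eta>1 * real (card EE)"
      using card_Bad1_le[of \<eta>1 \<eta>] assms by (subst s) (auto simp: Bad1_def)
    finally show ?thesis using 0 by simp
  next
    case (Suc i)
    \<comment> \<open>Here v is the pivot, the \<open>snd\<close> of the second edge. Only the
      \<open>snd\<close> of the first edge enters, so the sum over first edges becomes a count of
      neighbours of v.\<close>
    define h where "h v = (\<Sum>b\<in>N v. of_bool ((b, v) \<in> Bad1 \<eta> \<eta>1) :: real)" for v
    have "T j (\<lambda>ys. of_bool ((snd (hd ys), pivot ys) \<in> Bad1 \<eta> \<eta>1)) \<le> T i (\<lambda>ys. h (snd (hd ys)))"
      unfolding Suc
    proof (rule T_Suc_hd_le)
      fix xs assume xs: "xs \<in> Lad i"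
      then have ne: "xs \<noteq> []" by (rule Lad_ne)
      have "(\<Sum>e\<in>pr (hd xs). wt e (hd xs) * of_bool ((snd (hd (e # xs)), pivot (e # xs)) \<in> Bad1 \<eta> \<eta>1))
        = (\<Sum>e\<in>pr (hd xs). wt e (hd xs) * of_bool ((snd e, snd (hd xs)) \<in> Bad1 \<eta> \<eta>1))"
        using ne by (simp add: pivot_def hd_conv_nth)
      also have "\<dots> = h (snd (hd xs))"
        unfolding h_def by (rule sum_pr_snd) (use xs Lad_hd in auto)
      finally show "(\<Sum>e\<in>pr (hd xs). wt e (hd xs) * of_bool ((snd (hd (e # xs)), pivot (e # xs)) \<in> Bad1 \<eta> \<eta>1)) \<le> h (snd (hd xs))"
        by simp
    qed
    also have "\<dots> \<le> D ^ i * (\<Sum>e\<in>EE. h (snd e))"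
      by (rule T_hd_le) (auto simp: h_def intro: sum_nonneg)
    also have "(\<Sum>e\<in>EE. h (snd e)) = (\<Sum>v\<in>V. real (card (N v)) * h v)"
      by (subst sum_EE_swap[symmetric]) (simp add: sum_EE)
    also have "\<dots> \<le> (\<Sum>v\<in>V. D * h v)"
      by (intro sum_mono mult_right_mono N_le_D) (auto simp: h_def intro: sum_nonneg)
    also have "\<dots> = D * (\<Sum>e\<in>EE. of_bool (prod.swap e \<in> Bad1 \<eta> \<eta>1))"
      by (simp add: h_def sum_EE sum_distrib_left)
    also have "\<dots> \<le> D * (\<eta>1 * real (card EE))"
      using card_Bad1_le[of \<eta>1 \<eta>] assms D_pos by (subst s) (auto simp: Bad1_def)
    finally show ?thesis using Suc D_pos by (simp add: mult.assoc mult.left_commute)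
  qed
  have "T j (\<lambda>ys. of_bool (badc \<eta> \<eta>1 \<eta>2 ys)) \<le>
    T j (\<lambda>ys. of_bool ((snd (hd ys), pivot ys) \<in> Bad1 \<eta> \<eta>1) + of_bool ((snd (hd ys), fst (hd ys)) \<in> Bad2 \<eta> \<eta>1 \<eta>2))"
    by (rule T_mono) (auto simp: badc_def)
  also have "\<dots> \<le> D ^ j * (\<eta>1 * real (card EE)) + D ^ j * (2 * \<eta>2 * D / (\<eta>1 * d) * real (card EE))"
    unfolding T_add using 1 2 by linarith
  finally show ?thesis by (simp add: algebra_simps)
qed

lemma sel_ge:
  assumes ys: "ys \<in> Lad j" and b: "\<not> badc \<eta> \<eta>1 \<eta>2 ys" and "\<eta>1 \<ge> 0" "\<eta>2 \<ge> 0"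
  shows "\<eta>1 * \<eta>2 / 2 * d \<le> (\<Sum>e\<in>pr (hd ys). wt e (hd ys) * of_bool (sel \<eta> e ys))"
proof -
  obtain y x where yx: "hd ys = (y, x)" by fastforce
  have E: "(x, y) \<in> EE" using Lad_hd[OF ys] yx swap_EE[of "(y, x)"] by simp
  have z: "(x, pivot ys) \<in> EE"
  proof (cases j)
    case 0
    then show ?thesis using E yx Lad_length[OF ys] by (simp add: pivot_def)
  next
    case (Suc i)
    have "ys ! Suc 0 \<in> sc (ys ! 0)" using Lad_step[OF ys, of 0] Suc by simp
    then show ?thesis
      using yx Lad_length[OF ys] Suc by (auto simp: pivot_def hd_conv_nth[OF Lad_ne[OF ys]] sc_def EE_def)
  qed
  show ?thesis
    using extension_ge[of x "pivot ys" \<eta> \<eta>1 y \<eta>2] z E b assms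
    by (simp add: sel_def yx badc_def)
qed

lemma sel_rv_ge:
  assumes ys: "ys \<in> Lad j" and b: "\<not> badc \<eta> \<eta>1 \<eta>2 (rv ys)" and "\<eta>1 \<ge> 0" "\<eta>2 \<ge> 0"
  shows "\<eta>1 * \<eta>2 / 2 * d \<le> (\<Sum>e\<in>sc (last ys). wt (last ys) e * of_bool (sel \<eta> (prod.swap e) (rv ys)))"
  using sel_ge[of "rv ys" j \<eta> \<eta>1 \<eta>2] assms
    sum_pr_swap[of "last ys" "\<lambda>e. of_bool (sel \<eta> e (rv ys))"]
  by (simp only: rv_Lad hd_rv[OF Lad_ne[OF ys]] simp_thms)

text \<open>Cores that are bad at one end or the other carry at most half of the lower bound for the
  total weight. Each remaining core extends at both ends independently, with weight at least \<eta>1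
  \<eta>2 d / 2 per end.\<close>

lemma T_sel:
  assumes "\<eta>1 > 0" "\<eta>2 > 0" and small: "4 * (\<eta>1 + 2 * \<eta>2 * D / (\<eta>1 * d)) * D ^ j \<le> d ^ j"
  shows "\<eta>1\<^sup>2 * \<eta>2\<^sup>2 / 8 * d ^ (j + 2) * real (card EE)
    \<le> T (Suc (Suc j)) (\<lambda>ps. of_bool (sel \<eta> (hd ps) (mid ps) \<and> sel \<eta> (hd (rv ps)) (mid (rv ps))))"
proof -
  let ?s = "\<eta>1 * \<eta>2 / 2 * d"
  let ?g = "\<lambda>ys. \<not> badc \<eta> \<eta>1 \<eta>2 ys \<and> \<not> badc \<eta> \<eta>1 \<eta>2 (rv ys)"
  have b: "T j (\<lambda>ys. of_bool (badc \<eta> \<eta>1 \<eta>2 ys)) \<le> d ^ j * real (card EE) / 4"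
  proof -
    define \<epsilon> where "\<epsilon> = \<eta>1 + 2 * \<eta>2 * D / (\<eta>1 * d)"
    have "\<epsilon> * D ^ j \<le> d ^ j / 4"
      using small unfolding \<epsilon>_def[symmetric] by simp
    then have "\<epsilon> * D ^ j * real (card EE) \<le> d ^ j / 4 * real (card EE)"
      by (rule mult_right_mono) simp
    then show ?thesis using T_badc[of \<eta>1 \<eta>2 j \<eta>] assms unfolding \<epsilon>_def[symmetric] by (simp add: algebra_simps)
  qed
  have b': "T j (\<lambda>ys. of_bool (badc \<eta> \<eta>1 \<eta>2 (rv ys))) \<le> d ^ j * real (card EE) / 4"
    using b by (subst (asm) T_rv)
  have "T j (\<lambda>_. 1) \<le> T j (\<lambda>ys. of_bool (?g ys) + (of_bool (badc \<eta> \<eta>1 \<eta>2 ys) + of_bool (badc \<eta> \<eta>1 \<eta>2 (rv ys))))"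
    by (rule T_mono) auto
  also have "\<dots> = T j (\<lambda>ys. of_bool (?g ys)) + (T j (\<lambda>ys. of_bool (badc \<eta> \<eta>1 \<eta>2 ys)) + T j (\<lambda>ys. of_bool (badc \<eta> \<eta>1 \<eta>2 (rv ys))))"
    by (simp only: T_add)
  finally have g: "d ^ j * real (card EE) / 2 \<le> T j (\<lambda>ys. of_bool (?g ys))"
    using b b' T_one_ge[of j] by linarith
  have "\<eta>1\<^sup>2 * \<eta>2\<^sup>2 / 8 * d ^ (j + 2) * real (card EE) = ?s\<^sup>2 * (d ^ j * real (card EE) / 2)"
    by (simp add: power_mult_distrib power_divide power_add power2_eq_square field_simps)
  also have "\<dots> \<le> ?s\<^sup>2 * T j (\<lambda>ys. of_bool (?g ys))"
    by (intro mult_left_mono g) auto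
  also have "\<dots> = T j (\<lambda>ys. ?s\<^sup>2 * of_bool (?g ys))"
    by (simp add: T_cmult)
  also have "\<dots> \<le> T j (\<lambda>ys. (\<Sum>e\<in>pr (hd ys). wt e (hd ys) * of_bool (sel \<eta> e ys)) *
      (\<Sum>e\<in>sc (last ys). wt (last ys) e * of_bool (sel \<eta> (prod.swap e) (rv ys))))"
  proof (rule T_mono)
    fix ys assume ys: "ys \<in> Lad j"
    show "?s\<^sup>2 * of_bool (?g ys) \<le> (\<Sum>e\<in>pr (hd ys). wt e (hd ys) * of_bool (sel \<eta> e ys)) *
      (\<Sum>e\<in>sc (last ys). wt (last ys) e * of_bool (sel \<eta> (prod.swap e) (rv ys)))"
    proof (cases "?g ys")
      case True
      have "?s * ?s \<le> (\<Sum>e\<in>pr (hd ys). wt e (hd ys) * of_bool (sel \<eta> e ys)) *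
        (\<Sum>e\<in>sc (last ys). wt (last ys) e * of_bool (sel \<eta> (prod.swap e) (rv ys)))"
        using sel_ge[OF ys, of \<eta> \<eta>1 \<eta>2] sel_rv_ge[OF ys, of \<eta> \<eta>1 \<eta>2] True assms d_pos
        by (intro mult_mono) (auto intro!: sum_nonneg)
      then show ?thesis using True by (simp add: power2_eq_square)
    qed (auto intro!: mult_nonneg_nonneg sum_nonneg)
  qed
  also have "\<dots> = T (Suc (Suc j)) (\<lambda>ps. of_bool (sel \<eta> (hd ps) (mid ps)) * of_bool (sel \<eta> (prod.swap (last ps)) (rv (mid ps))))"
    using T_Suc2_prod[of j "\<lambda>e ys. of_bool (sel \<eta> e ys)" "\<lambda>ys e. of_bool (sel \<eta> (prod.swap e) (rv ys))"]
    by (simp add: mid_def)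
  also have "\<dots> = T (Suc (Suc j)) (\<lambda>ps. of_bool (sel \<eta> (hd ps) (mid ps) \<and> sel \<eta> (hd (rv ps)) (mid (rv ps))))"
    by (rule T_cong) (auto simp: hd_rv Lad_ne mid_rv dest: Lad_length)
  finally show ?thesis .
qed

end

context dgraph
begin

text \<open>Failure means that a codegree exceeds a quantile. With e_2 fixed if k = 4, and with b_2
  and b_3 fixed otherwise, this leaves fewer than a proportion \<eta> of the choices for the next
  vertex.\<close>

lemma T_fail:
  assumes eta: "\<eta> > 0"
  shows "T (Suc (Suc j)) (\<lambda>ps. of_bool (fail \<eta> ps)) \<le> \<eta> * D ^ (j + 2) * real (card EE)"
proof (cases j)
  case 0
  have "T (Suc 1) (\<lambda>ps. of_bool (fail \<eta> ps)) \<le> T 1 (\<lambda>_. \<eta> * D * 1)"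
  proof (rule T_Suc_le)
    fix xs assume xs: "xs \<in> Lad 1"
    obtain p q where pq: "xs = [p, q]"
      using Lad_length[OF xs] by (auto simp: length_Suc_conv)
    have q: "q \<in> EE" using Lad_last[OF xs] pq by simp
    then have qV: "fst q \<in> V" using EE_V by blast
    have "(\<Sum>e\<in>sc (last xs). wt (last xs) e * of_bool (fail \<eta> (xs @ [e])))
       = (\<Sum>e\<in>sc q. wt q e * of_bool (Tq \<eta> (snd q) (fst q) < cd (snd q) (fst e)))"
      by (simp add: pq fail_def)
    also have "\<dots> = real (card {a\<in>N (fst q). Tq \<eta> (snd q) (fst q) < cd (snd q) a})"
      using sum_sc_fst[OF q, of "\<lambda>a. of_bool (Tq \<eta> (snd q) (fst q) < cd (snd q) a)"]
      by (simp only: card_filter_sum[OF finite_N])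
    also have "\<dots> \<le> \<eta> * real (card (N (fst q)))"
      using Tq_gt[OF qV eta, of "snd q"] by simp
    also have "\<dots> \<le> \<eta> * D"
      using eta by (intro mult_left_mono N_le_D) auto
    finally show "(\<Sum>e\<in>sc (last xs). wt (last xs) e * of_bool (fail \<eta> (xs @ [e]))) \<le> \<eta> * D * 1" by simp
  qed
  also have "\<dots> \<le> \<eta> * D * (D ^ 1 * real (card EE))"
    unfolding T_cmult using eta D_pos by (intro mult_left_mono T_one_le) auto
  finally show ?thesis using 0 by (simp add: power2_eq_square numeral_2_eq_2 algebra_simps)
next
  case (Suc i)
  define R where "R u v w = (of_bool (Tq \<eta> v u < cd v w) :: real)" for u v w
  define h where "h xs = R (snd (xs ! 1)) (snd (xs ! 0)) (snd (xs ! 2))" for xs :: "('a \<times> 'a) list"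
  define h1 where "h1 xs = (\<Sum>b\<in>N (snd (xs ! 0)). R (snd (xs ! 0)) b (snd (xs ! 1)))" for xs :: "('a \<times> 'a) list"
  define Y where "Y v = (\<Sum>u\<in>N v. \<Sum>b\<in>N u. R u b v)" for v
  have R0: "R u v w \<ge> 0" for u v w by (simp add: R_def)
  \<comment> \<open>Only e_2, e_3 and e_4 matter: e_1 is summed out in front and everything after
    e_4 behind.\<close>
  have "T (Suc (Suc j)) (\<lambda>ps. of_bool (fail \<eta> ps)) = T (1 + (2 + i)) (\<lambda>ps. h (take (Suc 2) (drop 1 ps)))"
    using Suc by (auto intro!: T_cong simp: fail_def h_def R_def numeral_3_eq_3 numeral_2_eq_2 dest!: Lad_length)
  also have "\<dots> \<le> D ^ 1 * T (2 + i) (\<lambda>xs. h (take (Suc 2) xs))"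
    by (rule T_drop_le) (simp add: h_def R0)
  also have "\<dots> \<le> D ^ 1 * (D ^ i * T 2 h)"
    using D_pos by (intro mult_left_mono T_take_le) (auto simp: h_def R0)
  also have "T 2 h \<le> T 1 h1"
    unfolding numeral_2_eq_2 One_nat_def
  proof (rule T_Suc_hd_le)
    fix xs assume xs: "xs \<in> Lad (Suc 0)"
    obtain p q where pq: "xs = [p, q]"
      using Lad_length[OF xs] by (auto simp: length_Suc_conv)
    have p: "p \<in> EE" using Lad_hd[OF xs] pq by simp
    show "(\<Sum>e\<in>pr (hd xs). wt e (hd xs) * h (e # xs)) \<le> h1 xs"
      using sum_pr_snd[OF p, of "\<lambda>b. R (snd p) b (snd q)"] by (simp add: pq h_def h1_def)
  qed
  also have "T 1 h1 \<le> T 0 (\<lambda>xs. Y (snd (hd xs)))"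
    unfolding One_nat_def
  proof (rule T_Suc_hd_le)
    fix xs assume xs: "xs \<in> Lad 0"
    obtain p where p: "xs = [p]" "p \<in> EE"
      using xs by (auto simp: Lad_0)
    show "(\<Sum>e\<in>pr (hd xs). wt e (hd xs) * h1 (e # xs)) \<le> Y (snd (hd xs))"
      using sum_pr_snd[OF p(2), of "\<lambda>u. \<Sum>b\<in>N u. R u b (snd p)"] by (simp add: p(1) h1_def Y_def)
  qed
  also have "T 0 (\<lambda>xs. Y (snd (hd xs))) = (\<Sum>e\<in>EE. Y (fst e))"
    unfolding T_0 using sum_EE_swap[of "\<lambda>e. Y (fst e)"] by simp
  also have "\<dots> = (\<Sum>v\<in>V. real (card (N v)) * Y v)"
    by (simp add: sum_EE)
  also have "\<dots> \<le> (\<Sum>v\<in>V. D * Y v)"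
    by (intro sum_mono mult_right_mono N_le_D) (auto simp: Y_def R0 intro!: sum_nonneg)
  also have "\<dots> = D * (\<Sum>u\<in>V. \<Sum>v\<in>N u. \<Sum>b\<in>N u. R u b v)"
    unfolding Y_def by (subst sum_N_comm) (simp add: sum_distrib_left)
  \<comment> \<open>The sum over v = b_4 is moved inside, where u = b_3 and b = b_2 are fixed and
    the quantile bound applies.\<close>
  also have "\<dots> = D * (\<Sum>u\<in>V. \<Sum>b\<in>N u. \<Sum>v\<in>N u. R u b v)"
    by (rule arg_cong[where f = "\<lambda>x. D * x"], rule sum.cong[OF refl], rule sum.swap)
  also have "\<dots> \<le> D * (\<Sum>u\<in>V. \<Sum>b\<in>N u. \<eta> * D)"
  proof (intro mult_left_mono sum_mono)
    fix u b assume u: "u \<in> V"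
    have "(\<Sum>v\<in>N u. R u b v) = real (card {v\<in>N u. Tq \<eta> b u < cd b v})"
      unfolding R_def by (simp only: card_filter_sum[OF finite_N])
    also have "\<dots> \<le> \<eta> * real (card (N u))"
      using Tq_gt[OF u eta, of b] by simp
    also have "\<dots> \<le> \<eta> * D"
      using eta by (intro mult_left_mono N_le_D) auto
    finally show "(\<Sum>v\<in>N u. R u b v) \<le> \<eta> * D" .
  qed (use D_pos in auto)
  also have "D ^ 1 * (D ^ i * (D * (\<Sum>u\<in>V. \<Sum>b\<in>N u. \<eta> * D))) = \<eta> * D ^ (j + 2) * real (card EE)"
    using Suc by (simp add: card_EE_sum sum_distrib_left sum_distrib_right algebra_simps)
  finally show ?thesis using D_pos by simp
qed

text \<open>Markov's inequality again. For fixed a_1, a_2 and b, the vertices b_1 for which b lies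
  in \<open>bd\<close> are those of exceptional rank among the common neighbours of a_1 and b, at
  most \<eta>3 \<open>cd\<close> of them. Summing over b gives at most \<eta>3 D^2.\<close>

lemma T_bd:
  assumes eta: "\<eta> > 0" "\<eta>3 \<ge> 0"
  shows "T (Suc (Suc j)) (\<lambda>ps. of_bool (\<eta> / 2 * d < real (card (bd \<eta>3 (hd ps) (fst (ps ! 1))))))
     \<le> 2 * \<eta>3 / (\<eta> * d) * D ^ (j + 3) * real (card EE)"
proof -
  define f where "f ps = (of_bool (\<eta> / 2 * d < real (card (bd \<eta>3 (hd ps) (fst (ps ! 1))))) :: real)" for ps
  have "T (1 + Suc j) f = T (1 + Suc j) (\<lambda>ps. f (take (Suc 1) ps))"
    by (auto intro!: T_cong simp: f_def hd_conv_nth Lad_ne dest: Lad_length)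
  also have "\<dots> \<le> D ^ Suc j * T 1 f"
    by (rule T_take_le) (simp add: f_def)
  finally have 1: "T (Suc (Suc j)) f \<le> D ^ Suc j * T 1 f" by simp
  have "\<eta> / 2 * d * T 1 f = T 1 (\<lambda>ps. \<eta> / 2 * d * f ps)"
    by (rule T_cmult[symmetric])
  also have "\<dots> \<le> T (Suc 0) (\<lambda>ps. real (card (bd \<eta>3 (hd ps) (fst (ps ! 1)))))"
    unfolding One_nat_def by (rule T_mono) (auto simp: f_def)
  also have "\<dots> \<le> T 0 (\<lambda>ps. \<Sum>a\<in>N (fst (hd ps)). real (card (bd \<eta>3 (hd ps) a)))"
  proof (rule T_Suc_le)
    fix xs assume xs: "xs \<in> Lad 0"
    obtain p where p: "xs = [p]" "p \<in> EE"
      using xs by (auto simp: Lad_0)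
    show "(\<Sum>e\<in>sc (last xs). wt (last xs) e * real (card (bd \<eta>3 (hd (xs @ [e])) (fst ((xs @ [e]) ! 1)))))
      \<le> (\<Sum>a\<in>N (fst (hd xs)). real (card (bd \<eta>3 (hd xs) a)))"
      using sum_sc_fst[OF p(2), of "\<lambda>a. real (card (bd \<eta>3 p a))"] by (simp add: p(1))
  qed
  also have "\<dots> = (\<Sum>v\<in>V. \<Sum>u\<in>N v. \<Sum>a\<in>N v. real (card (bd \<eta>3 (v, u) a)))"
    by (simp add: T_0 sum_EE)
  also have "\<dots> = (\<Sum>v\<in>V. \<Sum>a\<in>N v. \<Sum>u\<in>N v. real (card (bd \<eta>3 (v, u) a)))"
    by (rule sum.cong[OF refl], rule sum.swap)
  also have "\<dots> \<le> (\<Sum>v\<in>V. \<Sum>a\<in>N v. \<eta>3 * (D * D))"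
  proof (intro sum_mono)
    fix v a
    have "(\<Sum>u\<in>N v. real (card (bd \<eta>3 (v, u) a)))
      = (\<Sum>b\<in>V. real (card {u\<in>N v \<inter> N b. real (card {a'\<in>N v \<inter> N b. cd a' a \<le> cd u a}) < \<eta>3 * real (cd v b)}))"
      unfolding bd_def by (simp add: sum_card_triples)
    also have "\<dots> \<le> (\<Sum>b\<in>V. \<eta>3 * real (cd v b))"
      unfolding cd_def[of v] by (intro sum_mono card_high_rank_le) (use eta in auto)
    also have "\<dots> = \<eta>3 * (\<Sum>b\<in>V. real (cd b v))"
      by (simp add: sum_distrib_left cd_commute)
    also have "\<dots> \<le> \<eta>3 * (D * real (card (N v)))"
      using eta by (intro mult_left_mono sum_V_cd_le) auto
    also have "\<dots> \<le> \<eta>3 * (D * D)"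
      using eta D_pos by (intro mult_left_mono N_le_D) auto
    finally show "(\<Sum>u\<in>N v. real (card (bd \<eta>3 (v, u) a))) \<le> \<eta>3 * (D * D)" .
  qed
  also have "\<dots> = \<eta>3 * (D * D) * real (card EE)"
    by (simp add: card_EE_sum sum_distrib_left sum_distrib_right algebra_simps)
  finally have "T 1 f \<le> 2 * \<eta>3 / (\<eta> * d) * (D * D) * real (card EE)"
    using eta d_pos by (simp add: field_simps)
  then have "D ^ Suc j * T 1 f \<le> D ^ Suc j * (2 * \<eta>3 / (\<eta> * d) * (D * D) * real (card EE))"
    using D_pos by (intro mult_left_mono) auto
  with 1 show ?thesis
    unfolding f_def by (simp add: power_add numeral_3_eq_3 algebra_simps)
qed

text \<open>At least \<eta> d vertices b_0 reach the quantile and at most half that number lies in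
  \<open>bd\<close>; for each remaining b_0 a proportion \<eta>3 of the vertices a_0 will
  do.\<close>

lemma extend_ge:
  assumes ps: "ps \<in> Lad m" and b: "\<not> \<eta> / 2 * d < real (card (bd \<eta>3 (hd ps) (fst (ps ! 1))))"
    and eta: "0 \<le> \<eta>" "\<eta> \<le> 1" "0 \<le> \<eta>3"
  shows "\<eta> * \<eta>3 / 2 * d \<le> (\<Sum>e\<in>pr (hd ps). wt e (hd ps) * of_bool (extend \<eta> e ps))"
proof -
  obtain y x where yx: "hd ps = (y, x)" by fastforce
  have E: "(y, x) \<in> EE" using Lad_hd[OF ps] yx by simp
  let ?u = "fst (ps ! 1)"
  let ?A = "{b\<in>N x. Tq \<eta> y x \<le> cd y b}"
  let ?R = "\<lambda>a b. Tq \<eta> y x \<le> cd y b \<and> cd a ?u \<le> cd x ?u"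
  have "(\<eta> * d - \<eta> / 2 * d) * \<eta>3 \<le> (\<Sum>e\<in>pr (y, x). wt e (y, x) * of_bool (?R (fst e) (snd e)))"
  proof (rule sum_pr_ge[OF E, where A = ?A and B = "bd \<eta>3 (y, x) ?u"])
    have "\<eta> * d \<le> \<eta> * real (card (N x))"
      using eta EE_V[OF E] by (intro mult_left_mono deg_ge) auto
    also have "\<dots> \<le> real (card ?A)"
      using Tq_ge[of \<eta> x y] eta by simp
    finally show "\<eta> * d \<le> real (card ?A)" .
  qed (use b yx eta in \<open>auto simp: bd_def not_less\<close>)
  also have "\<dots> = (\<Sum>e\<in>pr (hd ps). wt e (hd ps) * of_bool (extend \<eta> e ps))"
    by (simp add: yx extend_def)
  finally show ?thesis by (simp add: algebra_simps)
qed

text \<open>Failure and a large \<open>bd\<close>, at either end, are four events that each remove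
  at most an eighth of the weight found in \<open>T_sel\<close>. Half remains, and each end then
  contributes a factor \<eta> \<eta>3 d / 2.\<close>

lemma T_good:
  fixes \<eta> \<eta>1 \<eta>2 \<eta>3 :: real and j :: nat
  defines "c1 \<equiv> \<eta>1\<^sup>2 * \<eta>2\<^sup>2 / 8"
  assumes pos: "\<eta>1 > 0" "\<eta>2 > 0" "\<eta> > 0" "\<eta> \<le> 1" "\<eta>3 > 0"
    and small: "4 * (\<eta>1 + 2 * \<eta>2 * D / (\<eta>1 * d)) * D ^ j \<le> d ^ j"
      "8 * \<eta> * D ^ (j + 2) \<le> c1 * d ^ (j + 2)"
      "16 * \<eta>3 * D ^ (j + 3) \<le> c1 * \<eta> * d ^ (j + 3)"
  shows "c1 * \<eta>\<^sup>2 * \<eta>3\<^sup>2 / 8 * d ^ (j + 4) * real (card EE) \<le> T (j + 4) (\<lambda>xs. of_bool (good xs))"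
proof -
  let ?sel = "\<lambda>ps. sel \<eta> (hd ps) (mid ps)"
  let ?bd = "\<lambda>ps. \<eta> / 2 * d < real (card (bd \<eta>3 (hd ps) (fst (ps ! 1))))"
  let ?ok = "\<lambda>ps. (?sel ps \<and> ?sel (rv ps)) \<and> \<not> fail \<eta> ps \<and> \<not> fail \<eta> (rv ps) \<and> \<not> ?bd ps \<and> \<not> ?bd (rv ps)"
  let ?s = "\<eta> * \<eta>3 / 2 * d"
  define N0 where "N0 = real (card EE)"
  have N0: "N0 \<ge> 0" by (simp add: N0_def)
  have f1: "T (Suc (Suc j)) (\<lambda>ps. of_bool (fail \<eta> ps)) \<le> c1 / 8 * d ^ (j + 2) * N0"
  proof -
    have "\<eta> * D ^ (j + 2) * N0 \<le> c1 / 8 * d ^ (j + 2) * N0"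
      using small(2) N0 by (intro mult_right_mono) auto
    then show ?thesis using T_fail[of \<eta> j] pos unfolding N0_def by linarith
  qed
  have f2: "T (Suc (Suc j)) (\<lambda>ps. of_bool (fail \<eta> (rv ps))) \<le> c1 / 8 * d ^ (j + 2) * N0"
    using f1 by (subst (asm) T_rv)
  have b1: "T (Suc (Suc j)) (\<lambda>ps. of_bool (?bd ps)) \<le> c1 / 8 * d ^ (j + 2) * N0"
  proof -
    have "2 * \<eta>3 / (\<eta> * d) * D ^ (j + 3) = (16 * \<eta>3 * D ^ (j + 3)) / (8 * \<eta> * d)"
      using pos d_pos by (simp add: field_simps)
    also have "\<dots> \<le> (c1 * \<eta> * d ^ (j + 3)) / (8 * \<eta> * d)"
      using small(3) pos d_pos by (intro divide_right_mono) auto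
    also have "\<dots> = c1 / 8 * d ^ (j + 2)"
      using pos d_pos by (simp add: power_add power2_eq_square power3_eq_cube field_simps)
    finally have "2 * \<eta>3 / (\<eta> * d) * D ^ (j + 3) * N0 \<le> c1 / 8 * d ^ (j + 2) * N0"
      using N0 by (rule mult_right_mono)
    then show ?thesis using T_bd[of \<eta> \<eta>3 j] pos unfolding N0_def by linarith
  qed
  have b2: "T (Suc (Suc j)) (\<lambda>ps. of_bool (?bd (rv ps))) \<le> c1 / 8 * d ^ (j + 2) * N0"
    using b1 by (subst (asm) T_rv)
  have s: "c1 * d ^ (j + 2) * N0 \<le> T (Suc (Suc j)) (\<lambda>ps. of_bool (?sel ps \<and> ?sel (rv ps)))"
    using T_sel[of \<eta>1 \<eta>2 j \<eta>] pos small(1) unfolding N0_def c1_def by simp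
  have "T (Suc (Suc j)) (\<lambda>ps. of_bool (?sel ps \<and> ?sel (rv ps))) \<le>
    T (Suc (Suc j)) (\<lambda>ps. of_bool (?ok ps) + ((of_bool (fail \<eta> ps) + of_bool (fail \<eta> (rv ps)))
      + (of_bool (?bd ps) + of_bool (?bd (rv ps)))))"
    by (rule T_mono) auto
  then have ok: "c1 * d ^ (j + 2) * N0 / 2 \<le> T (Suc (Suc j)) (\<lambda>ps. of_bool (?ok ps))"
    unfolding T_add using f1 f2 b1 b2 s by linarith
  have "c1 * \<eta>\<^sup>2 * \<eta>3\<^sup>2 / 8 * d ^ (j + 4) * N0 = ?s\<^sup>2 * (c1 * d ^ (j + 2) * N0 / 2)"
    by (simp add: power_mult_distrib power_divide power_add power2_eq_square power4_eq_xxxx field_simps)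
  also have "\<dots> \<le> ?s\<^sup>2 * T (Suc (Suc j)) (\<lambda>ps. of_bool (?ok ps))"
    by (intro mult_left_mono ok) auto
  also have "\<dots> = T (Suc (Suc j)) (\<lambda>ps. ?s\<^sup>2 * of_bool (?ok ps))"
    by (simp add: T_cmult)
  \<comment> \<open>Placing the condition on \<open>ps\<close> in one factor makes the whole product
    vanish where it fails.\<close>
  also have "\<dots> \<le> T (Suc (Suc j)) (\<lambda>ps. (\<Sum>e\<in>pr (hd ps). wt e (hd ps) * of_bool (?ok ps \<and> extend \<eta> e ps)) *
      (\<Sum>e\<in>sc (last ps). wt (last ps) e * of_bool (extend \<eta> (prod.swap e) (rv ps))))"
  proof (rule T_mono)
    fix ps assume ps: "ps \<in> Lad (Suc (Suc j))"
    show "?s\<^sup>2 * of_bool (?ok ps) \<le> (\<Sum>e\<in>pr (hd ps). wt e (hd ps) * of_bool (?ok ps \<and> extend \<eta> e ps)) *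
      (\<Sum>e\<in>sc (last ps). wt (last ps) e * of_bool (extend \<eta> (prod.swap e) (rv ps)))"
    proof (cases "?ok ps")
      case True
      have 1: "?s \<le> (\<Sum>e\<in>pr (hd ps). wt e (hd ps) * of_bool (?ok ps \<and> extend \<eta> e ps))"
        using extend_ge[OF ps, of \<eta> \<eta>3] True pos by simp
      have "?s \<le> (\<Sum>e\<in>pr (hd (rv ps)). wt e (hd (rv ps)) * of_bool (extend \<eta> e (rv ps)))"
        using extend_ge[of "rv ps" "Suc (Suc j)" \<eta> \<eta>3] ps True pos by (simp add: rv_Lad)
      then have 2: "?s \<le> (\<Sum>e\<in>sc (last ps). wt (last ps) e * of_bool (extend \<eta> (prod.swap e) (rv ps)))"
        using sum_pr_swap[of "last ps" "\<lambda>e. of_bool (extend \<eta> e (rv ps))"]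
        by (simp only: hd_rv[OF Lad_ne[OF ps]])
      have "?s * ?s \<le> (\<Sum>e\<in>pr (hd ps). wt e (hd ps) * of_bool (?ok ps \<and> extend \<eta> e ps)) *
          (\<Sum>e\<in>sc (last ps). wt (last ps) e * of_bool (extend \<eta> (prod.swap e) (rv ps)))"
        using pos d_pos by (intro mult_mono 1 2 sum_nonneg) auto
      then show ?thesis using True by (simp add: power2_eq_square)
    qed (auto intro!: mult_nonneg_nonneg sum_nonneg)
  qed
  also have "\<dots> = T (Suc (Suc (Suc (Suc j)))) (\<lambda>xs. of_bool (?ok (mid xs) \<and> extend \<eta> (hd xs) (mid xs))
      * of_bool (extend \<eta> (prod.swap (last xs)) (rv (mid xs))))"
    using T_Suc2_prod[of "Suc (Suc j)" "\<lambda>e ps. of_bool (?ok ps \<and> extend \<eta> e ps)"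
        "\<lambda>ps e. of_bool (extend \<eta> (prod.swap e) (rv ps))"]
    by (simp add: mid_def)
  also have "\<dots> \<le> T (Suc (Suc (Suc (Suc j)))) (\<lambda>xs. of_bool (good xs))"
  proof (rule T_mono)
    fix xs assume xs: "xs \<in> Lad (Suc (Suc (Suc (Suc j))))"
    then have l: "length xs = Suc (Suc (Suc (Suc (Suc j))))" by (rule Lad_length)
    obtain e ps e' where eq: "xs = e # ps @ [e']" and lp: "length ps = Suc (Suc (Suc j))"
      using list_ends[OF l] by metis
    have "good xs" if "?ok ps" "extend \<eta> e ps" "extend \<eta> (prod.swap e') (rv ps)"
    proof -
      have g: "G1 xs" using G1_I[of ps \<eta> e "[e']"] that lp eq by simp
      have g': "G1 (rv xs)" using G1_I[of "rv ps" \<eta> "prod.swap e'" "[prod.swap e]"] that lp eq by simp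
      \<comment> \<open>Each \<open>G4\<close> takes the \<open>G1\<close> of the opposite end as
        input, so both instances of \<open>G1\<close> are established before.\<close>
      have "G4 xs"
        using G4_I[of ps j \<eta> e e'] that lp g' eq by simp
      moreover have "G4 (rv xs)"
        using G4_I[of "rv ps" j \<eta> "prod.swap e'" "prod.swap e"] that lp g eq by simp
      ultimately show ?thesis using g g' by (simp add: good_def)
    qed
    then show "of_bool (?ok (mid xs) \<and> extend \<eta> (hd xs) (mid xs))
      * of_bool (extend \<eta> (prod.swap (last xs)) (rv (mid xs))) \<le> (of_bool (good xs) :: real)"
      unfolding eq by auto
  qed
  finally show ?thesis unfolding N0_def by (simp add: numeral_eq_Suc)
qed

end

section \<open>The weight of ladders with repeated vertices\<close>

lemma sum_of_bool_eq_point: "finite A \<Longrightarrow> (\<Sum>x\<in>A. of_bool (x = y)) = (of_bool (y \<in> A) :: real)"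
  unfolding of_bool_def by simp

context fgraph
begin

definition dst :: "('a \<times> 'a) list \<Rightarrow> bool" where
  "dst xs \<longleftrightarrow> distinct (map fst xs @ map snd xs)"

definition verts :: "('a \<times> 'a) list \<Rightarrow> 'a set" where
  "verts xs = fst ` set xs \<union> snd ` set xs"

lemma finite_verts [simp]: "finite (verts xs)"
  by (simp add: verts_def)

lemma card_verts_le: "card (verts xs) \<le> 2 * length xs"
proof -
  have "card (fst ` set xs) \<le> length xs" "card (snd ` set xs) \<le> length xs"
    by (metis card_image_le card_length le_trans List.finite_set)+
  then show ?thesis
    using card_Un_le[of "fst ` set xs" "snd ` set xs"] by (simp add: verts_def)
qed

lemma dst_snoc: "e \<in> EE \<Longrightarrow> dst (xs @ [e]) \<longleftrightarrow> dst xs \<and> fst e \<notin> verts xs \<and> snd e \<notin> verts xs"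
  using N_irrefl by (auto simp: dst_def verts_def EE_def)

end

context dgraph
begin

text \<open>If the codegree is at least M, a random common neighbour lies in A with weight at most
  |A| / M. The remaining a are estimated trivially and recorded in the last summand.\<close>

lemma sum_sc_snd_mem_le:
  fixes M :: real
  assumes M: "M > 0" and O: "finite A"
  shows "(\<Sum>e'\<in>sc e. wt e e' * of_bool (snd e' \<in> A))
     \<le> real (card A) * (D / M + real (card {a\<in>N (fst e). real (cd (snd e) a) < M}))"
proof -
  have "(\<Sum>e'\<in>sc e. wt e e' * of_bool (snd e' \<in> A)) =
    (\<Sum>a\<in>N (fst e). \<Sum>b\<in>N (snd e) \<inter> N a. of_bool (b \<in> A) / real (cd (snd e) a))"
    by (subst sum_sc) simp
  also have "\<dots> \<le> (\<Sum>a\<in>N (fst e). real (card A) * (1 / M + of_bool (real (cd (snd e) a) < M)))"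
  proof (rule sum_mono)
    fix a
    let ?c = "1 / M + of_bool (real (cd (snd e) a) < M)"
    have c: "1 / real (cd (snd e) a) \<le> ?c"
    proof (cases "real (cd (snd e) a) < M")
      case True
      have "1 / real (cd (snd e) a) \<le> 1"
        by (cases "cd (snd e) a") auto
      moreover have "0 < 1 / M" using M by simp
      ultimately have "1 / real (cd (snd e) a) \<le> 1 / M + 1" by linarith
      then show ?thesis using True by simp
    next
      case False
      then show ?thesis using M by (simp add: frac_le)
    qed
    have "(\<Sum>b\<in>N (snd e) \<inter> N a. of_bool (b \<in> A) / real (cd (snd e) a))
      = real (card (N (snd e) \<inter> N a \<inter> A)) * (1 / real (cd (snd e) a))"
      by (simp add: sum_divide_distrib[symmetric])
    also have "\<dots> \<le> real (card A) * ?c"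
      using c O M by (intro mult_mono) (auto intro!: card_mono)
    finally show "(\<Sum>b\<in>N (snd e) \<inter> N a. of_bool (b \<in> A) / real (cd (snd e) a)) \<le> real (card A) * ?c" .
  qed
  also have "\<dots> = real (card A) * (real (card (N (fst e))) / M + real (card {a\<in>N (fst e). real (cd (snd e) a) < M}))"
    by (simp only: card_filter_sum[OF finite_N] sum_distrib_left[symmetric] sum.distrib) simp
  also have "\<dots> \<le> real (card A) * (D / M + real (card {a\<in>N (fst e). real (cd (snd e) a) < M}))"
    using M N_le_D by (intro mult_left_mono add_right_mono divide_right_mono) auto
  finally show ?thesis .
qed

text \<open>A pair u, a of codegree below M has fewer than M middle vertices v, and there are |V|^2
  pairs.\<close>

lemma sum_low_codegree_le:
  fixes M :: real
  assumes M: "M \<ge> 0"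
  shows "(\<Sum>e\<in>EE. real (card {a\<in>N (fst e). real (cd (snd e) a) < M})) \<le> (real (card V))\<^sup>2 * M"
proof -
  have "(\<Sum>e\<in>EE. real (card {a\<in>N (fst e). real (cd (snd e) a) < M}))
    = (\<Sum>u\<in>V. \<Sum>v\<in>N u. real (card {a\<in>N v. real (cd u a) < M}))"
    by (subst sum_EE) (simp add: sum_N_comm[of "\<lambda>u v. real (card {a\<in>N v. real (cd u a) < M})"])
  also have "\<dots> = (\<Sum>u\<in>V. \<Sum>a\<in>V. real (card {v\<in>N u \<inter> N a. real (cd u a) < M}))"
    by (rule sum.cong[OF refl]) (rule sum_card_triples)
  also have "\<dots> \<le> (\<Sum>u\<in>V. \<Sum>a\<in>V. M)"
  proof (intro sum_mono)
    fix u a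
    show "real (card {v\<in>N u \<inter> N a. real (cd u a) < M}) \<le> M"
    proof (cases "real (cd u a) < M")
      case True
      then have "{v\<in>N u \<inter> N a. real (cd u a) < M} = N u \<inter> N a" by auto
      then show ?thesis using True by (simp add: cd_def)
    qed (use M in auto)
  qed
  finally show ?thesis by (simp add: power2_eq_square algebra_simps)
qed

text \<open>A new edge must avoid the at most 2 (j + 1) vertices before it. Compared with the full
  weight D^j |EE|, a repetition saves a factor of order D; the factor D on the left expresses this
  without the exponent j - 1.\<close>

lemma T_not_dst:
  fixes M :: real
  assumes M: "M > 0"
  shows "D * T j (\<lambda>xs. of_bool (\<not> dst xs))
    \<le> 2 * (real j)\<^sup>2 * D ^ j * ((1 + D / M) * real (card EE) + (real (card V))\<^sup>2 * M)"
proof (induction j)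
  case 0
  have "T 0 (\<lambda>xs. of_bool (\<not> dst xs)) = (\<Sum>e\<in>EE. 0)"
    unfolding T_0 by (rule sum.cong) (use N_irrefl in \<open>auto simp: dst_def EE_def\<close>)
  then show ?case by simp
next
  case (Suc j)
  define Y where "Y = (1 + D / M) * real (card EE) + (real (card V))\<^sup>2 * M"
  have Y: "Y \<ge> 0" using M D_pos by (auto simp: Y_def)
  define h where "h e = real (card {a\<in>N (fst e). real (cd (snd e) a) < M})" for e
  have "T (Suc j) (\<lambda>xs. of_bool (\<not> dst xs)) \<le>
    T j (\<lambda>xs. D * of_bool (\<not> dst xs) + 2 * real (Suc j) * ((1 + D / M) * 1 + h (last xs)))"
  proof (rule T_Suc_le)
    fix xs assume xs: "xs \<in> Lad j"
    let ?A = "verts xs"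
    have cA: "real (card ?A) \<le> 2 * real (Suc j)"
      using card_verts_le[of xs] Lad_length[OF xs] by simp
    have e: "last xs \<in> EE" by (rule Lad_last[OF xs])
    have "(\<Sum>e\<in>sc (last xs). wt (last xs) e * of_bool (\<not> dst (xs @ [e]))) \<le>
      (\<Sum>e\<in>sc (last xs). wt (last xs) e * of_bool (\<not> dst xs) + (wt (last xs) e * of_bool (fst e \<in> ?A) + wt (last xs) e * of_bool (snd e \<in> ?A)))"
    proof (rule sum_mono)
      fix e assume "e \<in> sc (last xs)"
      then show "wt (last xs) e * of_bool (\<not> dst (xs @ [e])) \<le> wt (last xs) e * of_bool (\<not> dst xs) + (wt (last xs) e * of_bool (fst e \<in> ?A) + wt (last xs) e * of_bool (snd e \<in> ?A))"
        using dst_snoc[OF sc_EE, of e "last xs" xs] by auto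
    qed
    also have "\<dots> = (\<Sum>e\<in>sc (last xs). wt (last xs) e * of_bool (\<not> dst xs)) + ((\<Sum>e\<in>sc (last xs). wt (last xs) e * of_bool (fst e \<in> ?A)) + (\<Sum>e\<in>sc (last xs). wt (last xs) e * of_bool (snd e \<in> ?A)))"
      by (simp only: sum.distrib)
    also have "\<dots> \<le> D * of_bool (\<not> dst xs) + (real (card ?A) + real (card ?A) * (D / M + h (last xs)))"
    proof (intro add_mono)
      show "(\<Sum>e\<in>sc (last xs). wt (last xs) e * of_bool (\<not> dst xs)) \<le> D * of_bool (\<not> dst xs)"
        by (rule sum_sc_le[OF e]) auto
      have "(\<Sum>e\<in>sc (last xs). wt (last xs) e * of_bool (fst e \<in> ?A)) = real (card (N (fst (last xs)) \<inter> ?A))"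
        using sum_sc_fst[OF e, of "\<lambda>a. of_bool (a \<in> ?A)"] by simp
      also have "\<dots> \<le> real (card ?A)" by (auto intro!: card_mono)
      finally show "(\<Sum>e\<in>sc (last xs). wt (last xs) e * of_bool (fst e \<in> ?A)) \<le> real (card ?A)" .
      show "(\<Sum>e\<in>sc (last xs). wt (last xs) e * of_bool (snd e \<in> ?A)) \<le> real (card ?A) * (D / M + h (last xs))"
        unfolding h_def by (rule sum_sc_snd_mem_le[OF M]) simp
    qed
    also have "real (card ?A) + real (card ?A) * (D / M + h (last xs)) = real (card ?A) * (1 + D / M + h (last xs))"
      by (simp add: algebra_simps)
    also have "\<dots> \<le> 2 * real (Suc j) * (1 + D / M + h (last xs))"
      using cA D_pos M by (intro mult_right_mono) (auto simp: h_def)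
    finally show "(\<Sum>e\<in>sc (last xs). wt (last xs) e * of_bool (\<not> dst (xs @ [e]))) \<le>
      D * of_bool (\<not> dst xs) + 2 * real (Suc j) * ((1 + D / M) * 1 + h (last xs))" by simp
  qed
  also have "\<dots> = D * T j (\<lambda>xs. of_bool (\<not> dst xs)) + 2 * real (Suc j) * ((1 + D / M) * T j (\<lambda>_. 1) + T j (\<lambda>xs. h (last xs)))"
    by (simp only: T_add T_cmult)
  also have "\<dots> \<le> 2 * (real j)\<^sup>2 * D ^ j * Y + 2 * real (Suc j) * ((1 + D / M) * (D ^ j * real (card EE)) + D ^ j * ((real (card V))\<^sup>2 * M))"
  proof (intro add_mono mult_left_mono T_one_le)
    show "D * T j (\<lambda>xs. of_bool (\<not> dst xs)) \<le> 2 * (real j)\<^sup>2 * D ^ j * Y"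
      using Suc unfolding Y_def .
    have "T j (\<lambda>xs. h (last xs)) \<le> D ^ j * (\<Sum>e\<in>EE. h e)"
      by (rule T_last_le) (simp add: h_def)
    also have "\<dots> \<le> D ^ j * ((real (card V))\<^sup>2 * M)"
      using D_pos M unfolding h_def by (intro mult_left_mono sum_low_codegree_le) auto
    finally show "T j (\<lambda>xs. h (last xs)) \<le> D ^ j * ((real (card V))\<^sup>2 * M)" .
  qed (use D_pos M in auto)
  also have "(1 + D / M) * (D ^ j * real (card EE)) + D ^ j * ((real (card V))\<^sup>2 * M) = D ^ j * Y"
    unfolding Y_def by (simp only: distrib_left mult.left_commute)
  also have "2 * (real j)\<^sup>2 * D ^ j * Y + 2 * real (Suc j) * (D ^ j * Y) = (2 * (real j)\<^sup>2 + 2 * real (Suc j)) * (D ^ j * Y)"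
    by (simp only: distrib_right mult.assoc)
  also have "\<dots> \<le> (2 * (real (Suc j))\<^sup>2) * (D ^ j * Y)"
    using D_pos Y by (intro mult_right_mono) (auto simp: power2_eq_square algebra_simps)
  finally have "D * T (Suc j) (\<lambda>xs. of_bool (\<not> dst xs)) \<le> D * (2 * (real (Suc j))\<^sup>2 * (D ^ j * Y))"
    using D_pos by (intro mult_left_mono) auto
  then show ?case unfolding Y_def by (simp only: power_Suc mult.assoc mult.left_commute)
qed

section \<open>Good ladders with fixed end edges through a given vertex\<close>

text \<open>With u = (a, b), p = (a', b') and f = (a'', b'') the weight is 1/cd(b, a') times
  1/cd(b', a''). The condition replaces the first factor by 1/cd(b, b''). Now sum over the common
  neighbours a' of b' and a'', then over the common neighbours b' of b and b'': each sum is at most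
  1.\<close>

lemma two_steps_le:
  assumes u: "u \<in> EE"
  shows "(\<Sum>p\<in>sc u. wt u p * (\<Sum>q\<in>sc p. wt p q * of_bool (q = f \<and> cd (snd q) (snd u) \<le> cd (fst p) (snd u)))) \<le> 1"
proof -
  let ?S = "{p\<in>sc u. f \<in> sc p \<and> cd (snd f) (snd u) \<le> cd (fst p) (snd u)}"
  let ?B = "N (snd u) \<inter> N (snd f)"
  let ?S' = "SIGMA b:?B. N b \<inter> N (fst f)"
  have "(\<Sum>p\<in>sc u. wt u p * (\<Sum>q\<in>sc p. wt p q * of_bool (q = f \<and> cd (snd q) (snd u) \<le> cd (fst p) (snd u))))
    = (\<Sum>p\<in>sc u. if p \<in> ?S then wt u p * wt p f else 0)"
  proof (rule sum.cong[OF refl])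
    fix p assume p: "p \<in> sc u"
    have "(\<Sum>q\<in>sc p. wt p q * of_bool (q = f \<and> cd (snd q) (snd u) \<le> cd (fst p) (snd u)))
      = (\<Sum>q\<in>sc p. if q = f then wt p f * of_bool (cd (snd f) (snd u) \<le> cd (fst p) (snd u)) else 0)"
      by (rule sum.cong[OF refl]) auto
    then show "wt u p * (\<Sum>q\<in>sc p. wt p q * of_bool (q = f \<and> cd (snd q) (snd u) \<le> cd (fst p) (snd u)))
      = (if p \<in> ?S then wt u p * wt p f else 0)"
      using p by simp
  qed
  also have "\<dots> = (\<Sum>p\<in>?S. wt u p * wt p f)"
    by (simp add: sum.inter_filter[symmetric])
  also have "\<dots> \<le> (\<Sum>p\<in>?S. 1 / real (cd (snd u) (snd f)) * (1 / real (cd (snd p) (fst f))))"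
  proof (rule sum_mono)
    fix p assume p: "p \<in> ?S"
    then have "snd p \<in> N (snd u)" "snd p \<in> N (snd f)"
      by (auto simp: sc_def N_comm)
    then have "cd (snd u) (snd f) > 0" by (rule cd_pos2)
    then show "wt u p * wt p f \<le> 1 / real (cd (snd u) (snd f)) * (1 / real (cd (snd p) (fst f)))"
      unfolding wt_def using p by (intro mult_right_mono) (auto simp: cd_commute intro!: frac_le)
  qed
  also have "\<dots> \<le> (\<Sum>p\<in>prod.swap ` ?S'. 1 / real (cd (snd u) (snd f)) * (1 / real (cd (snd p) (fst f))))"
  proof (rule sum_mono2)
    show "?S \<subseteq> prod.swap ` ?S'"
    proof
      fix p assume "p \<in> ?S"
      then have "prod.swap p \<in> ?S'"
        by (auto simp: sc_def N_comm)
      then show "p \<in> prod.swap ` ?S'" by (metis image_eqI swap_swap)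
    qed
  qed auto
  also have "\<dots> = (\<Sum>(b, a)\<in>?S'. 1 / real (cd (snd u) (snd f)) * (1 / real (cd b (fst f))))"
    by (subst sum.reindex) (auto simp: case_prod_unfold)
  also have "\<dots> = (\<Sum>b\<in>?B. \<Sum>a\<in>N b \<inter> N (fst f). 1 / real (cd (snd u) (snd f)) * (1 / real (cd b (fst f))))"
    by (rule sum.Sigma[symmetric]) auto
  also have "\<dots> = (\<Sum>b\<in>?B. 1 / real (cd (snd u) (snd f)) * (\<Sum>a\<in>N b \<inter> N (fst f). 1 / real (cd b (fst f))))"
    by (simp only: sum_distrib_left)
  also have "\<dots> \<le> (\<Sum>b\<in>?B. 1 / real (cd (snd u) (snd f)) * 1)"
    by (intro sum_mono mult_left_mono sum_cd_le1) auto
  also have "\<dots> \<le> 1" using sum_cd_le1[of "snd u" "snd f"] by simp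
  finally show ?thesis .
qed

text \<open>These are walks from \<open>fst u\<close> via c and a to v. For each neighbour a of v,
  the weights 1/cd over the common neighbours c of \<open>fst u\<close> and a add up to at most
  1.\<close>

lemma sum_walks_le:
  assumes u: "u \<in> EE"
  shows "(\<Sum>p1\<in>sc u. wt u p1 * (\<Sum>p2\<in>sc p1. wt p1 p2 * (of_bool (v \<in> N (fst p2)) / real (cd (fst u) (fst p2))))) \<le> D"
proof -
  have "(\<Sum>p1\<in>sc u. wt u p1 * (\<Sum>p2\<in>sc p1. wt p1 p2 * (of_bool (v \<in> N (fst p2)) / real (cd (fst u) (fst p2)))))
    = (\<Sum>p1\<in>sc u. wt u p1 * (\<Sum>a\<in>N (fst p1). of_bool (v \<in> N a) / real (cd (fst u) a)))"
    by (intro sum.cong refl arg_cong2[where f = "(*)"] sum_sc_fst) (rule sc_EE)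
  also have "\<dots> = (\<Sum>c\<in>N (fst u). \<Sum>a\<in>N c. of_bool (v \<in> N a) / real (cd (fst u) a))"
    by (rule sum_sc_fst[OF u])
  also have "\<dots> = (\<Sum>c\<in>N (fst u). \<Sum>a | a \<in> N v \<and> a \<in> N c. 1 / real (cd (fst u) a))"
    by (intro sum.cong refl sum.mono_neutral_cong_right) (auto simp: N_comm)
  also have "\<dots> = (\<Sum>a\<in>N v. \<Sum>c | c \<in> N (fst u) \<and> a \<in> N c. 1 / real (cd (fst u) a))"
    by (rule sum.swap_restrict) auto
  also have "\<dots> = (\<Sum>a\<in>N v. \<Sum>c\<in>N (fst u) \<inter> N a. 1 / real (cd (fst u) a))"
    by (intro sum.cong refl) (auto simp: N_comm)
  also have "\<dots> \<le> (\<Sum>a\<in>N v. 1)"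
    by (intro sum_mono sum_cd_le1)
  also have "\<dots> \<le> D" using N_le_D[of v] by simp
  finally show ?thesis .
qed

text \<open>The condition bounds the weight of the last step by 1/cd(\<open>fst u\<close>,
  \<open>fst p2\<close>). The third step then has total weight at most 1, since
  \<open>fst p3\<close> = v is prescribed, and \<open>sum_walks_le\<close> bounds the first
  two.\<close>

lemma four_steps_le:
  assumes u: "u \<in> EE"
  shows "(\<Sum>p1\<in>sc u. wt u p1 * (\<Sum>p2\<in>sc p1. wt p1 p2 * (\<Sum>p3\<in>sc p2. wt p2 p3 *
      (\<Sum>p4\<in>sc p3. wt p3 p4 * of_bool (p4 = f \<and> fst p3 = v \<and> cd (fst u) (fst p2) \<le> cd (snd p3) (fst p4)))))) \<le> D"
proof -
  have "(\<Sum>p3\<in>sc p2. wt p2 p3 * (\<Sum>p4\<in>sc p3. wt p3 p4 * of_bool (p4 = f \<and> fst p3 = v \<and> cd (fst u) (fst p2) \<le> cd (snd p3) (fst p4))))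
    \<le> of_bool (v \<in> N (fst p2)) / real (cd (fst u) (fst p2))" if p: "p1 \<in> sc u" "p2 \<in> sc p1" for p1 p2
  proof -
    have c: "cd (fst u) (fst p2) > 0"
      by (rule cd_pos2[of "fst p1"]) (use p in \<open>auto simp: sc_def N_comm\<close>)
    have "(\<Sum>p3\<in>sc p2. wt p2 p3 * (\<Sum>p4\<in>sc p3. wt p3 p4 * of_bool (p4 = f \<and> fst p3 = v \<and> cd (fst u) (fst p2) \<le> cd (snd p3) (fst p4))))
      \<le> (\<Sum>p3\<in>sc p2. wt p2 p3 * (of_bool (fst p3 = v) / real (cd (fst u) (fst p2))))"
    proof (intro sum_mono mult_left_mono)
      fix p3
      have "(\<Sum>p4\<in>sc p3. wt p3 p4 * of_bool (p4 = f \<and> fst p3 = v \<and> cd (fst u) (fst p2) \<le> cd (snd p3) (fst p4)))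
        = (\<Sum>p4\<in>sc p3. if p4 = f then wt p3 f * of_bool (fst p3 = v \<and> cd (fst u) (fst p2) \<le> cd (snd p3) (fst f)) else 0)"
        by (rule sum.cong[OF refl]) auto
      also have "\<dots> \<le> wt p3 f * of_bool (fst p3 = v \<and> cd (fst u) (fst p2) \<le> cd (snd p3) (fst f))"
        by simp
      also have "\<dots> \<le> of_bool (fst p3 = v) / real (cd (fst u) (fst p2))"
        using c by (auto simp: wt_def intro!: frac_le)
      finally show "(\<Sum>p4\<in>sc p3. wt p3 p4 * of_bool (p4 = f \<and> fst p3 = v \<and> cd (fst u) (fst p2) \<le> cd (snd p3) (fst p4)))
        \<le> of_bool (fst p3 = v) / real (cd (fst u) (fst p2))" .
    qed auto
    also have "\<dots> = (\<Sum>a\<in>N (fst p2). of_bool (a = v) / real (cd (fst u) (fst p2)))"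
      by (rule sum_sc_fst) (use p sc_EE in auto)
    also have "\<dots> = of_bool (v \<in> N (fst p2)) / real (cd (fst u) (fst p2))"
      by (simp only: sum_divide_distrib[symmetric] sum_of_bool_eq_point[OF finite_N])
    finally show ?thesis .
  qed
  then have "(\<Sum>p1\<in>sc u. wt u p1 * (\<Sum>p2\<in>sc p1. wt p1 p2 * (\<Sum>p3\<in>sc p2. wt p2 p3 *
      (\<Sum>p4\<in>sc p3. wt p3 p4 * of_bool (p4 = f \<and> fst p3 = v \<and> cd (fst u) (fst p2) \<le> cd (snd p3) (fst p4))))))
    \<le> (\<Sum>p1\<in>sc u. wt u p1 * (\<Sum>p2\<in>sc p1. wt p1 p2 * (of_bool (v \<in> N (fst p2)) / real (cd (fst u) (fst p2)))))"
    by (intro sum_mono mult_left_mono) auto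
  with sum_walks_le[OF u, of v] show ?thesis by linarith
qed

lemma T_hd_eq_le: "T j (\<lambda>xs. of_bool (hd xs = e)) \<le> D ^ j"
proof -
  have "T j (\<lambda>xs. of_bool (hd xs = e)) \<le> D ^ j * (\<Sum>e'\<in>EE. of_bool (e' = e))"
    by (rule T_hd_le) simp
  also have "(\<Sum>e'\<in>EE. of_bool (e' = e)) = (of_bool (e \<in> EE) :: real)"
    by (rule sum_of_bool_eq_point) simp
  also have "D ^ j * of_bool (e \<in> EE) \<le> D ^ j"
    using D_pos by simp
  finally show ?thesis .
qed

text \<open>The step that chooses the prescribed vertex has total weight at most 1 instead of
  D.\<close>

lemma T_pin_le:
  assumes "1 \<le> i" "i \<le> j"
  shows "T j (\<lambda>xs. of_bool (hd xs = e \<and> fst (xs ! i) = v)) \<le> D ^ (j - 1)"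
  using assms(2)
proof (induction j)
  case 0
  then show ?case using assms by simp
next
  case (Suc j)
  show ?case
  proof (cases "i = Suc j")
    case True
    have "T (Suc j) (\<lambda>xs. of_bool (hd xs = e \<and> fst (xs ! i) = v)) \<le> T j (\<lambda>xs. of_bool (hd xs = e))"
    proof (rule T_Suc_le)
      fix xs assume xs: "xs \<in> Lad j"
      have "(\<Sum>e'\<in>sc (last xs). wt (last xs) e' * of_bool (hd (xs @ [e']) = e \<and> fst ((xs @ [e']) ! i) = v))
        = of_bool (hd xs = e) * (\<Sum>e'\<in>sc (last xs). wt (last xs) e' * of_bool (fst e' = v))"
        using True Lad_ne[OF xs] Lad_length[OF xs] by (simp add: sum_distrib_left nth_append)
      also have "\<dots> \<le> of_bool (hd xs = e) * 1"
        using sum_sc_fst[OF Lad_last[OF xs], of "\<lambda>a. of_bool (a = v)"]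
        by (intro mult_left_mono) (simp_all only: sum_of_bool_eq_point[OF finite_N], auto)
      finally show "(\<Sum>e'\<in>sc (last xs). wt (last xs) e' * of_bool (hd (xs @ [e']) = e \<and> fst ((xs @ [e']) ! i) = v)) \<le> of_bool (hd xs = e)"
        by simp
    qed
    with T_hd_eq_le[of j e] show ?thesis by simp
  next
    case False
    then have i: "i \<le> j" using Suc by simp
    have "T (Suc j) (\<lambda>xs. of_bool (hd xs = e \<and> fst (xs ! i) = v)) \<le> D * T j (\<lambda>xs. of_bool (hd xs = e \<and> fst (xs ! i) = v))"
    proof (rule T_butlast_le)
      fix xs e' assume xs: "xs \<in> Lad j"
      show "of_bool (hd (xs @ [e']) = e \<and> fst ((xs @ [e']) ! i) = v) \<le> (of_bool (hd xs = e \<and> fst (xs ! i) = v) :: real)"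
        using i Lad_ne[OF xs] Lad_length[OF xs] by (simp add: nth_append)
    qed simp
    also have "\<dots> \<le> D * D ^ (j - 1)"
      using D_pos i by (intro mult_left_mono Suc.IH) auto
    also have "\<dots> = D ^ (Suc j - 1)"
      using i assms by (cases j) auto
    finally show ?thesis .
  qed
qed

end

lemma distinct_glue:
  assumes "distinct ((a # p @ [b]) @ (c # q @ [d]))" "distinct ((a # p' @ [b]) @ (c # q' @ [d]))"
    and "(set p \<union> set q) \<inter> (set p' \<union> set q') = {}"
  shows "distinct ((a # p @ b # rev p') @ (c # q @ d # rev q'))"
  using assms by auto

lemma successively_glue: "successively P (xs @ [f]) \<Longrightarrow> successively P (f # ys) \<Longrightarrow> successively P (xs @ f # ys)"
  by (simp add: successively_append_iff)

context fgraph
begin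

lemma rv_append: "rv (xs @ ys) = rv ys @ rv xs"
  by (simp add: rv_def)

lemma rv_Nil [simp]: "rv [] = []"
  by (simp add: rv_def)

lemma good_rv [simp]: "good (rv xs) \<longleftrightarrow> good xs"
  by (auto simp: good_def)

lemma T_Suc_Suc_le:
  assumes "\<And>xs. xs \<in> Lad m \<Longrightarrow> (\<Sum>p\<in>sc (last xs). wt (last xs) p * (\<Sum>q\<in>sc p. wt p q * F (xs @ [p, q]))) \<le> G xs"
  shows "T (Suc (Suc m)) F \<le> T m G"
proof -
  have "T (Suc (Suc m)) F \<le> T (Suc m) (\<lambda>xs. \<Sum>q\<in>sc (last xs). wt (last xs) q * F (xs @ [q]))"
    by (rule T_Suc_le) simp
  also have "\<dots> \<le> T m G"
    by (rule T_Suc_le) (use assms in simp)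
  finally show ?thesis .
qed

end

context dgraph
begin

text \<open>With k = j + 4, the bound is D^(k-3). For i \<le> k - 2 the first k - 2 steps cost
  D^(k-3) by \<open>T_pin_le\<close> and the last two cost 1 by \<open>G1\<close> of the reversed
  ladder. For i = k - 1 the first k - 4 steps cost D^(k-4) and the last four cost D by
  \<open>G4\<close> of the reversed ladder.\<close>

lemma T_upper_fst:
  assumes i: "1 \<le> i" "i < j + 4"
  shows "T (j + 4) (\<lambda>xs. of_bool (good xs \<and> hd xs = e \<and> last xs = f \<and> fst (xs ! i) = v)) \<le> D ^ (j + 1)"
proof (cases "i \<le> j + 2")
  case True
  have "T (Suc (Suc (j + 2))) (\<lambda>xs. of_bool (good xs \<and> hd xs = e \<and> last xs = f \<and> fst (xs ! i) = v))
    \<le> T (j + 2) (\<lambda>xs. of_bool (hd xs = e \<and> fst (xs ! i) = v))"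
  proof (rule T_Suc_Suc_le)
    fix xs assume xs: "xs \<in> Lad (j + 2)"
    let ?R = "hd xs = e \<and> fst (xs ! i) = v"
    have r0: "rv xs ! 0 = prod.swap (last xs)"
      using hd_rv[OF Lad_ne[OF xs]] hd_conv_nth[of "rv xs"] Lad_ne[OF xs] by simp
    have b: "of_bool (good (xs @ [p, q]) \<and> hd (xs @ [p, q]) = e \<and> last (xs @ [p, q]) = f \<and> fst ((xs @ [p, q]) ! i) = v)
      \<le> (of_bool ?R * of_bool (q = f \<and> cd (snd q) (snd (last xs)) \<le> cd (fst p) (snd (last xs))) :: real)" for p q
    proof -
      have "hd (xs @ [p, q]) = hd xs" "(xs @ [p, q]) ! i = xs ! i"
        using True Lad_length[OF xs] Lad_ne[OF xs] by (auto simp: nth_append)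
      moreover have "cd (snd q) (snd (last xs)) \<le> cd (fst p) (snd (last xs))" if "good (xs @ [p, q])"
        using that r0 unfolding good_def G1_def by (simp add: rv_append numeral_2_eq_2)
      ultimately show ?thesis by auto
    qed
    have "(\<Sum>p\<in>sc (last xs). wt (last xs) p * (\<Sum>q\<in>sc p. wt p q *
        of_bool (good (xs @ [p, q]) \<and> hd (xs @ [p, q]) = e \<and> last (xs @ [p, q]) = f \<and> fst ((xs @ [p, q]) ! i) = v)))
      \<le> (\<Sum>p\<in>sc (last xs). wt (last xs) p * (\<Sum>q\<in>sc p. wt p q *
        (of_bool ?R * of_bool (q = f \<and> cd (snd q) (snd (last xs)) \<le> cd (fst p) (snd (last xs))))))"
      by (intro sum_mono mult_left_mono b) auto
    also have "\<dots> = of_bool ?R * (\<Sum>p\<in>sc (last xs). wt (last xs) p * (\<Sum>q\<in>sc p. wt p q *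
        of_bool (q = f \<and> cd (snd q) (snd (last xs)) \<le> cd (fst p) (snd (last xs)))))"
      by (simp only: sum_distrib_left mult.left_commute)
    also have "\<dots> \<le> of_bool ?R * 1"
      by (intro mult_left_mono two_steps_le Lad_last[OF xs]) auto
    finally show "(\<Sum>p\<in>sc (last xs). wt (last xs) p * (\<Sum>q\<in>sc p. wt p q *
        of_bool (good (xs @ [p, q]) \<and> hd (xs @ [p, q]) = e \<and> last (xs @ [p, q]) = f \<and> fst ((xs @ [p, q]) ! i) = v)))
      \<le> of_bool ?R" by simp
  qed
  also have "\<dots> \<le> D ^ (j + 2 - 1)"
    using True i by (intro T_pin_le) auto
  finally show ?thesis by (simp add: numeral_eq_Suc)
next
  case False
  then have i: "i = j + 3" using i by simp
  let ?F = "\<lambda>xs. of_bool (good xs \<and> hd xs = e \<and> last xs = f \<and> fst (xs ! i) = v)"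
  have "T (Suc (Suc (Suc (Suc j)))) ?F
    \<le> T (Suc (Suc j)) (\<lambda>xs. \<Sum>p3\<in>sc (last xs). wt (last xs) p3 * (\<Sum>p4\<in>sc p3. wt p3 p4 * ?F (xs @ [p3, p4])))"
    by (rule T_Suc_Suc_le) simp
  also have "\<dots> \<le> T j (\<lambda>xs. D * of_bool (hd xs = e))"
  proof (rule T_Suc_Suc_le)
    fix xs assume xs: "xs \<in> Lad j"
    let ?u = "last xs"
    have r0: "rv xs ! 0 = prod.swap (last xs)"
      using hd_rv[OF Lad_ne[OF xs]] hd_conv_nth[of "rv xs"] Lad_ne[OF xs] by simp
    let ?g = "\<lambda>p1 p2 p3 p4. p4 = f \<and> fst p3 = v \<and> cd (fst ?u) (fst p2) \<le> cd (snd p3) (fst p4)"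
    have b: "?F ((xs @ [p1, p2]) @ [p3, p4]) \<le> (of_bool (hd xs = e) * of_bool (?g p1 p2 p3 p4) :: real)" for p1 p2 p3 p4
    proof -
      have "hd ((xs @ [p1, p2]) @ [p3, p4]) = hd xs" "((xs @ [p1, p2]) @ [p3, p4]) ! i = p3"
        using i Lad_length[OF xs] Lad_ne[OF xs] by (auto simp: nth_append)
      moreover have "cd (fst ?u) (fst p2) \<le> cd (snd p3) (fst p4)" if "good ((xs @ [p1, p2]) @ [p3, p4])"
        using that r0 unfolding good_def G4_def by (simp add: rv_append numeral_eq_Suc)
      ultimately show ?thesis by auto
    qed
    have "(\<Sum>p1\<in>sc ?u. wt ?u p1 * (\<Sum>p2\<in>sc p1. wt p1 p2 *
        (\<Sum>p3\<in>sc (last (xs @ [p1, p2])). wt (last (xs @ [p1, p2])) p3 * (\<Sum>p4\<in>sc p3. wt p3 p4 * ?F ((xs @ [p1, p2]) @ [p3, p4])))))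
      = (\<Sum>p1\<in>sc ?u. wt ?u p1 * (\<Sum>p2\<in>sc p1. wt p1 p2 *
        (\<Sum>p3\<in>sc p2. wt p2 p3 * (\<Sum>p4\<in>sc p3. wt p3 p4 * ?F ((xs @ [p1, p2]) @ [p3, p4])))))"
      by (simp only: last_append last.simps list.distinct if_False if_True simp_thms)
    also have "\<dots> \<le> (\<Sum>p1\<in>sc ?u. wt ?u p1 * (\<Sum>p2\<in>sc p1. wt p1 p2 *
        (\<Sum>p3\<in>sc p2. wt p2 p3 * (\<Sum>p4\<in>sc p3. wt p3 p4 * (of_bool (hd xs = e) * of_bool (?g p1 p2 p3 p4))))))"
      by (intro sum_mono mult_left_mono b) auto
    also have "\<dots> = of_bool (hd xs = e) * (\<Sum>p1\<in>sc ?u. wt ?u p1 * (\<Sum>p2\<in>sc p1. wt p1 p2 *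
        (\<Sum>p3\<in>sc p2. wt p2 p3 * (\<Sum>p4\<in>sc p3. wt p3 p4 * of_bool (?g p1 p2 p3 p4)))))"
      by (simp only: sum_distrib_left mult.left_commute)
    also have "\<dots> \<le> of_bool (hd xs = e) * D"
      by (intro mult_left_mono four_steps_le Lad_last[OF xs]) auto
    finally show "(\<Sum>p1\<in>sc ?u. wt ?u p1 * (\<Sum>p2\<in>sc p1. wt p1 p2 *
        (\<Sum>p3\<in>sc (last (xs @ [p1, p2])). wt (last (xs @ [p1, p2])) p3 * (\<Sum>p4\<in>sc p3. wt p3 p4 * ?F ((xs @ [p1, p2]) @ [p3, p4])))))
      \<le> D * of_bool (hd xs = e)" by (simp add: mult.commute)
  qed
  also have "\<dots> \<le> D * D ^ j"
    unfolding T_cmult using D_pos by (intro mult_left_mono T_hd_eq_le) auto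
  finally show ?thesis by (simp add: numeral_eq_Suc)
qed

text \<open>Reversal exchanges the two sides and turns position i into k - i, so the bound for first
  components applies.\<close>

lemma T_upper_snd:
  assumes i: "1 \<le> i" "i < j + 4"
  shows "T (j + 4) (\<lambda>xs. of_bool (good xs \<and> hd xs = e \<and> last xs = f \<and> snd (xs ! i) = v)) \<le> D ^ (j + 1)"
proof -
  have "T (j + 4) (\<lambda>xs. of_bool (good xs \<and> hd xs = e \<and> last xs = f \<and> snd (xs ! i) = v))
    = T (j + 4) (\<lambda>xs. of_bool (good xs \<and> hd xs = prod.swap f \<and> last xs = prod.swap e \<and> fst (xs ! (j + 4 - i)) = v))"
  proof (subst T_rv, rule T_cong)
    fix xs assume xs: "xs \<in> Lad (j + 4)"
    have "rv xs ! i = prod.swap (xs ! (j + 4 - i))"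
      using rv_nth[of i xs] Lad_length[OF xs] i by (simp add: add.commute)
    then show "of_bool (good (rv xs) \<and> hd (rv xs) = e \<and> last (rv xs) = f \<and> snd (rv xs ! i) = v)
      = (of_bool (good xs \<and> hd xs = prod.swap f \<and> last xs = prod.swap e \<and> fst (xs ! (j + 4 - i)) = v) :: real)"
      using hd_rv[OF Lad_ne[OF xs]] last_rv[OF Lad_ne[OF xs]] by auto
  qed
  also have "\<dots> \<le> D ^ (j + 1)"
    using i by (intro T_upper_fst) auto
  finally show ?thesis .
qed

section \<open>Two internally disjoint ladders and the prism they form\<close>

lemma exists_heavy_pair:
  assumes "(real (card EE))\<^sup>2 * B < T k (\<lambda>xs. of_bool (P xs))"
  shows "\<exists>e f. B < T k (\<lambda>xs. of_bool (P xs \<and> hd xs = e \<and> last xs = f))"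
proof (rule ccontr)
  assume "\<not> ?thesis"
  then have le: "T k (\<lambda>xs. of_bool (P xs \<and> hd xs = e \<and> last xs = f)) \<le> B" for e f
    by (meson not_le)
  have "T k (\<lambda>xs. of_bool (P xs)) = T k (\<lambda>xs. \<Sum>e\<in>EE. \<Sum>f\<in>EE. of_bool (P xs \<and> hd xs = e \<and> last xs = f))"
  proof (rule T_cong)
    fix xs assume xs: "xs \<in> Lad k"
    have "(\<Sum>e\<in>EE. \<Sum>f\<in>EE. of_bool (P xs \<and> hd xs = e \<and> last xs = f))
      = of_bool (P xs) * ((\<Sum>e\<in>EE. of_bool (e = hd xs)) * (\<Sum>f\<in>EE. of_bool (f = last xs)) :: real)"
      unfolding sum_product unfolding sum_distrib_left by (intro sum.cong refl) auto
    then show "of_bool (P xs) = (\<Sum>e\<in>EE. \<Sum>f\<in>EE. of_bool (P xs \<and> hd xs = e \<and> last xs = f) :: real)"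
      unfolding sum_of_bool_eq_point[OF finite_EE] using Lad_hd[OF xs] Lad_last[OF xs] by simp
  qed
  also have "\<dots> = (\<Sum>e\<in>EE. \<Sum>f\<in>EE. T k (\<lambda>xs. of_bool (P xs \<and> hd xs = e \<and> last xs = f)))"
    by (simp only: T_sum)
  also have "\<dots> \<le> (\<Sum>e\<in>EE. \<Sum>f\<in>EE. B)"
    by (intro sum_mono le)
  also have "\<dots> = (real (card EE))\<^sup>2 * B"
    by (simp add: power2_eq_square)
  finally show False using assms by simp
qed

lemma T_pos_ex: "0 < T k (\<lambda>xs. of_bool (P xs)) \<Longrightarrow> \<exists>xs\<in>Lad k. P xs"
proof (rule ccontr)
  assume pos: "0 < T k (\<lambda>xs. of_bool (P xs))" and "\<not> ?thesis"
  then have "T k (\<lambda>xs. of_bool (P xs)) = T k (\<lambda>xs. 0)"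
    by (intro T_cong) auto
  then show False using pos by (simp add: T_def)
qed

definition adj :: "'a \<times> 'a \<Rightarrow> 'a \<times> 'a \<Rightarrow> bool" where
  "adj e e' \<longleftrightarrow> fst e' \<in> N (fst e) \<and> snd e' \<in> N (snd e)"

text \<open>Fix one ladder between a heavy pair of end edges. If all others met its interior, a
  union bound over fewer than k positions, at most 2 k vertices and two sides would give weight at
  most 4 k^2 D^(k-3), where k = j + 4.\<close>

lemma exists_two_ladders:
  assumes "(real (card EE))\<^sup>2 * (4 * (real (j + 4))\<^sup>2 * D ^ (j + 1)) < T (j + 4) (\<lambda>xs. of_bool (dst xs \<and> good xs))"
  shows "\<exists>xs\<in>Lad (j + 4). \<exists>ys\<in>Lad (j + 4). dst xs \<and> dst ys \<and> hd xs = hd ys \<and> last xs = last ys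
    \<and> verts (mid xs) \<inter> verts (mid ys) = {}"
proof -
  let ?k = "j + 4" and ?B = "4 * (real (j + 4))\<^sup>2 * D ^ (j + 1)"
  obtain e f where h: "?B < T ?k (\<lambda>xs. of_bool ((dst xs \<and> good xs) \<and> hd xs = e \<and> last xs = f))"
    using exists_heavy_pair[OF assms] by blast
  let ?P = "\<lambda>xs. (dst xs \<and> good xs) \<and> hd xs = e \<and> last xs = f"
  have "0 \<le> ?B" using D_pos by simp
  with h have "0 < T ?k (\<lambda>xs. of_bool (?P xs))" by linarith
  then obtain xs where xs: "xs \<in> Lad ?k" "?P xs" using T_pos_ex[of ?k ?P] by blast
  let ?A = "verts (mid xs)"
  have "\<exists>ys\<in>Lad ?k. ?P ys \<and> verts (mid xs) \<inter> verts (mid ys) = {}"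
  proof (rule ccontr)
    assume no: "\<not> ?thesis"
    let ?f = "\<lambda>i v xs. of_bool (good xs \<and> hd xs = e \<and> last xs = f \<and> fst (xs ! i) = v) :: real"
    let ?s = "\<lambda>i v xs. of_bool (good xs \<and> hd xs = e \<and> last xs = f \<and> snd (xs ! i) = v) :: real"
    have "T ?k (\<lambda>ys. of_bool (?P ys)) \<le> T ?k (\<lambda>ys. \<Sum>i\<in>{1..<?k}. \<Sum>v\<in>?A. ?f i v ys + ?s i v ys)"
    proof (rule T_mono)
      fix ys assume ys: "ys \<in> Lad ?k"
      have nn: "0 \<le> (\<Sum>i\<in>{1..<?k}. \<Sum>v\<in>?A. ?f i v ys + ?s i v ys)"
        by (intro sum_nonneg) auto
      show "of_bool (?P ys) \<le> (\<Sum>i\<in>{1..<?k}. \<Sum>v\<in>?A. ?f i v ys + ?s i v ys)"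
      proof (cases "?P ys")
        case True
        then obtain v where v: "v \<in> ?A" "v \<in> verts (mid ys)"
          using no ys by blast
        then obtain e' where e': "e' \<in> set (mid ys)" "v = fst e' \<or> v = snd e'"
          by (auto simp: verts_def)
        then obtain m where m: "m < length (mid ys)" "mid ys ! m = e'"
          by (auto simp: in_set_conv_nth)
        obtain p zs q where eq: "ys = p # zs @ [q]" and lz: "length zs = j + 3"
          by (rule list_ends[of ys "j + 3"]) (use Lad_length[OF ys] in simp)
        have m': "ys ! Suc m = e'" "Suc m \<in> {1..<?k}"
          using m lz unfolding eq by (auto simp: nth_append)
        have "1 \<le> ?f (Suc m) v ys + ?s (Suc m) v ys"
          using True e' m' by auto
        also have "\<dots> \<le> (\<Sum>v\<in>?A. ?f (Suc m) v ys + ?s (Suc m) v ys)"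
          using v by (intro member_le_sum) auto
        also have "\<dots> \<le> (\<Sum>i\<in>{1..<?k}. \<Sum>v\<in>?A. ?f i v ys + ?s i v ys)"
          by (rule member_le_sum[OF m'(2)]) (auto intro!: sum_nonneg)
        finally show ?thesis using True by simp
      next
      case False
      then have "of_bool (?P ys) = (0 :: real)" by simp
      then show ?thesis using nn by linarith
    qed
    qed
    also have "\<dots> = (\<Sum>i\<in>{1..<?k}. \<Sum>v\<in>?A. T ?k (?f i v) + T ?k (?s i v))"
      by (simp only: T_sum T_add)
    also have "\<dots> \<le> (\<Sum>i\<in>{1..<?k}. \<Sum>v\<in>?A. D ^ (j + 1) + D ^ (j + 1))"
      by (intro sum_mono add_mono T_upper_fst T_upper_snd) auto
    also have "\<dots> = real (j + 3) * (real (card ?A) * (2 * D ^ (j + 1)))"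
      by simp
    also have "\<dots> \<le> real (j + 4) * ((2 * real (j + 4)) * (2 * D ^ (j + 1)))"
    proof (intro mult_mono)
      have "length (mid xs) \<le> j + 4"
        using Lad_length[OF xs(1)] by (simp add: mid_def)
      then show "real (card ?A) \<le> 2 * real (j + 4)"
        using card_verts_le[of "mid xs"] by simp
    qed (use D_pos in auto)
    also have "\<dots> = ?B" by (simp add: power2_eq_square)
    finally show False using h by simp
  qed
  then obtain ys where "ys \<in> Lad ?k" "?P ys \<and> verts (mid xs) \<inter> verts (mid ys) = {}" by (rule bexE)
  then show ?thesis
    using xs by (intro bexI[of _ xs] bexI[of _ ys]) simp_all
qed

lemma exists_prism:
  assumes "(real (card EE))\<^sup>2 * (4 * (real (j + 4))\<^sup>2 * D ^ (j + 1)) < T (j + 4) (\<lambda>xs. of_bool (dst xs \<and> good xs))"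
  shows "\<exists>zs. length zs = 2 * (j + 4) \<and> distinct (map fst zs @ map snd zs) \<and> set zs \<subseteq> EE
    \<and> (\<forall>i < 2 * (j + 4). adj (zs ! i) (zs ! (Suc i mod (2 * (j + 4)))))"
proof -
  obtain xs ys where xs: "xs \<in> Lad (j + 4)" "dst xs" and ys: "ys \<in> Lad (j + 4)" "dst ys"
    and eq: "hd xs = hd ys" "last xs = last ys" and dis: "verts (mid xs) \<inter> verts (mid ys) = {}"
    using exists_two_ladders[OF assms] by blast
  obtain e us f where x: "xs = e # us @ [f]" and lu: "length us = j + 3"
    by (rule list_ends[of xs "j + 3"]) (use Lad_length[OF xs(1)] in simp)
  obtain e' ws f' where "ys = e' # ws @ [f']" and lw: "length ws = j + 3"
    by (rule list_ends[of ys "j + 3"]) (use Lad_length[OF ys(1)] in simp)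
  then have y: "ys = e # ws @ [f]" using eq x by simp
  have sub: "set xs \<subseteq> EE" "set ys \<subseteq> EE"
    using xs(1) ys(1) by (auto simp: Lad_def)
  have adj_sym: "adj p q \<Longrightarrow> adj q p" for p q
    by (simp add: adj_def N_comm)
  have sx: "successively adj xs"
    by (rule successively_mono[of "\<lambda>e e'. e' \<in> sc e"]) (use xs(1) in \<open>auto simp: Lad_def adj_def sc_def\<close>)
  have "successively (\<lambda>p q. adj q p) ys"
    by (rule successively_mono[of "\<lambda>e e'. e' \<in> sc e"]) (use ys(1) in \<open>auto simp: Lad_def adj_def sc_def N_comm\<close>)
  then have sy: "successively adj (rev ys)" by simp
  \<comment> \<open>Forwards along one ladder and back along the other; the common end edges occur
    once each, which gives 2 (j + 4) rungs.\<close>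
  define zs where "zs = e # us @ f # rev ws"
  have "successively adj ((e # us) @ (f # rev ws @ [e]))"
    using successively_glue[of adj "e # us" f "rev ws @ [e]"] sx sy unfolding x y by simp
  then have s: "successively adj (zs @ [e])" by (simp add: zs_def)
  have l: "length zs = 2 * (j + 4)" using lu lw by (simp add: zs_def)
  have "distinct (map fst zs @ map snd zs)"
  proof -
    have m: "mid xs = us" "mid ys = ws" by (simp_all add: x y)
    have "(set (map fst us) \<union> set (map snd us)) \<inter> (set (map fst ws) \<union> set (map snd ws)) = {}"
      using dis unfolding m verts_def by simp
    moreover have "distinct ((fst e # map fst us @ [fst f]) @ (snd e # map snd us @ [snd f]))"
      "distinct ((fst e # map fst ws @ [fst f]) @ (snd e # map snd ws @ [snd f]))"
      using xs(2) ys(2) unfolding x y dst_def by simp_all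
    ultimately have "distinct ((fst e # map fst us @ fst f # rev (map fst ws)) @ (snd e # map snd us @ snd f # rev (map snd ws)))"
      by (rule distinct_glue[rotated -1])
    then show ?thesis by (simp add: zs_def rev_map)
  qed
  moreover have "set zs \<subseteq> EE"
    using sub unfolding x y zs_def by auto
  moreover have "adj (zs ! i) (zs ! (Suc i mod (2 * (j + 4))))" if i: "i < 2 * (j + 4)" for i
  proof -
    have a: "adj ((zs @ [e]) ! i) ((zs @ [e]) ! Suc i)"
      by (rule successively_nth[OF s]) (use i l in simp)
    show ?thesis
    proof (cases "Suc i = 2 * (j + 4)")
      case True
      have "(zs @ [e]) ! Suc i = e" using True l by (metis nth_append_length)
      moreover have "zs ! 0 = e" by (simp add: zs_def)
      moreover have "Suc i mod (2 * (j + 4)) = 0" unfolding True by (rule mod_self)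
      ultimately show ?thesis using a i l by (simp add: nth_append)
    next
      case False
      then show ?thesis using a i l by (simp add: nth_append)
    qed
  qed
  ultimately show ?thesis using l by blast
qed

end

section \<open>Choice of the constants for almost regular graphs\<close>

context dgraph
begin

lemma d_le_card_V: "V \<noteq> {} \<Longrightarrow> d \<le> real (card V)"
proof -
  assume "V \<noteq> {}"
  then obtain v where v: "v \<in> V" by blast
  have "card (N v) \<le> card V" by (rule card_mono[OF finite_V N_sub])
  then show ?thesis using deg_ge[OF v] by simp
qed

text \<open>The assumptions on s and C make each of the three terms in \<open>T_not_dst\<close> at
  most s d |EE|, so that repetitions destroy at most half of the good weight. The other half exceeds
  |EE|^2 times the bound required per pair, because |EE| \<le> K d |V| and C |V| \<le> d^2.\<close>

lemma exists_prism_of_dense: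
  fixes K c0 s C :: real and j :: nat
  defines "A \<equiv> 2 * (real (j + 4))\<^sup>2 * K ^ (j + 4)"
  assumes D: "D = K * d" and K: "K \<ge> 1" and pos: "c0 > 0" "s > 0" "C > 0"
    and g: "c0 * d ^ (j + 4) * real (card EE) \<le> T (j + 4) (\<lambda>xs. of_bool (good xs))"
    and s: "3 * A * s \<le> K * c0 / 2"
    and C: "1 / s \<le> C" "K / s\<^sup>2 \<le> C" "8 * (real (j + 4))\<^sup>2 * K ^ (j + 2) < c0 * C"
    and V: "V \<noteq> {}" "C * real (card V) \<le> d\<^sup>2"
  shows "\<exists>zs. length zs = 2 * (j + 4) \<and> distinct (map fst zs @ map snd zs) \<and> set zs \<subseteq> EE
    \<and> (\<forall>i < 2 * (j + 4). adj (zs ! i) (zs ! (Suc i mod (2 * (j + 4)))))"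
proof (rule exists_prism)
  let ?k = "j + 4"
  define n where "n = real (card V)"
  define e where "e = real (card EE)"
  \<comment> \<open>This value makes the term (D / M) |EE| equal to s d |EE|; M is a constant, so
    |V|^2 M is small as soon as C is large.\<close>
  define M where "M = K / s"
  have n: "n \<ge> 1"
    using V finite_V unfolding n_def by (simp add: Suc_le_eq card_gt_0_iff)
  have M: "M > 0" using K pos by (simp add: M_def)
  have e1: "d * n \<le> e" using card_EE_ge by (simp add: e_def n_def)
  have e2: "e \<le> K * d * n" using card_EE_le D by (simp add: e_def n_def)
  have e: "e > 0" using e1 d_pos n by (smt (verit) mult_pos_pos)
  have Cn: "C * n \<le> d * d" using V by (simp add: n_def power2_eq_square)
  have "C * d \<le> C * n"
    using d_le_card_V[OF V(1)] pos by (intro mult_left_mono) (auto simp: n_def)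
  then have "C * d \<le> d * d" using Cn by linarith
  then have Cd: "C \<le> d" using d_pos by simp
  have "1 / d \<le> s"
  proof -
    have "1 / s \<le> d" using C Cd by linarith
    then show ?thesis using pos d_pos by (simp add: field_simps)
  qed
  then have t1: "e \<le> s * d * e"
    using d_pos e by (simp add: field_simps)
  have t2: "K * d / M * e = s * d * e"
    using K pos by (simp add: M_def)
  have t3: "n\<^sup>2 * M \<le> s * d * e"
  proof -
    have "M \<le> s * C"
      using C(2) pos by (simp add: M_def field_simps power2_eq_square)
    then have "n\<^sup>2 * M \<le> n\<^sup>2 * (s * C)"
      by (intro mult_left_mono) auto
    also have "\<dots> = s * n * (C * n)" by (simp add: power2_eq_square)
    also have "\<dots> \<le> s * n * (d * d)"
      using pos n Cn by (intro mult_left_mono) auto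
    also have "\<dots> = s * d * (d * n)" by simp
    also have "\<dots> \<le> s * d * e"
      using pos d_pos e1 by (intro mult_left_mono) auto
    finally show ?thesis .
  qed
  have "D * T ?k (\<lambda>xs. of_bool (\<not> dst xs)) \<le> 2 * (real ?k)\<^sup>2 * D ^ ?k * ((1 + D / M) * e + n\<^sup>2 * M)"
    using T_not_dst[OF M, of ?k] by (simp only: n_def e_def)
  also have "\<dots> = A * d ^ ?k * (e + K * d / M * e + n\<^sup>2 * M)"
    unfolding D A_def by (simp add: power_mult_distrib algebra_simps)
  also have "\<dots> \<le> A * d ^ ?k * (s * d * e + s * d * e + s * d * e)"
  proof (rule mult_left_mono)
    show "e + K * d / M * e + n\<^sup>2 * M \<le> s * d * e + s * d * e + s * d * e"
      using t1 t2 t3 by linarith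
  qed (use K d_pos in \<open>auto simp: A_def\<close>)
  also have "\<dots> = 3 * A * s * (d * d ^ ?k * e)"
    by (simp add: algebra_simps)
  also have "\<dots> \<le> K * c0 / 2 * (d * d ^ ?k * e)"
    using s d_pos e by (intro mult_right_mono) auto
  also have "\<dots> = D * (c0 / 2 * d ^ ?k * e)"
    by (simp add: D)
  finally have nd: "T ?k (\<lambda>xs. of_bool (\<not> dst xs)) \<le> c0 / 2 * d ^ ?k * e"
    using D_pos by simp
  have "T ?k (\<lambda>xs. of_bool (good xs)) \<le> T ?k (\<lambda>xs. of_bool (dst xs \<and> good xs) + of_bool (\<not> dst xs))"
    by (rule T_mono) auto
  then have g2: "c0 / 2 * d ^ ?k * e \<le> T ?k (\<lambda>xs. of_bool (dst xs \<and> good xs))"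
    unfolding T_add using g nd by (simp add: e_def field_simps)
  have "e * (4 * (real ?k)\<^sup>2 * D ^ (j + 1)) \<le> K * d * n * (4 * (real ?k)\<^sup>2 * D ^ (j + 1))"
    using e2 D_pos by (intro mult_right_mono) auto
  also have "\<dots> = (8 * (real ?k)\<^sup>2 * K ^ (j + 2)) * (d ^ (j + 2) / 2 * n)"
    unfolding D by (simp add: power_mult_distrib power_add power2_eq_square algebra_simps)
  also have "\<dots> < (c0 * C) * (d ^ (j + 2) / 2 * n)"
    using C(3) d_pos n by (intro mult_strict_right_mono) auto
  also have "\<dots> = c0 / 2 * d ^ (j + 2) * (C * n)" by simp
  also have "\<dots> \<le> c0 / 2 * d ^ (j + 2) * (d * d)"
    using Cn pos d_pos by (intro mult_left_mono) auto
  also have "\<dots> = c0 / 2 * d ^ ?k"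
    by (simp add: power_add power2_eq_square power4_eq_xxxx)
  finally have "e * (e * (4 * (real ?k)\<^sup>2 * D ^ (j + 1))) < e * (c0 / 2 * d ^ ?k)"
    using e by (rule mult_strict_left_mono)
  then have "e\<^sup>2 * (4 * (real ?k)\<^sup>2 * D ^ (j + 1)) < c0 / 2 * d ^ ?k * e"
    by (simp add: power2_eq_square algebra_simps)
  with g2 show "(real (card EE))\<^sup>2 * (4 * (real ?k)\<^sup>2 * D ^ (j + 1)) < T ?k (\<lambda>xs. of_bool (dst xs \<and> good xs))"
    unfolding e_def by linarith
qed

end

text \<open>The cyclic list of the m rungs of a prism. It is phrased outside the locale so that one
  constant can serve all graphs with the same ratio K.\<close>

definition prism_ring :: "('a \<Rightarrow> 'a set) \<Rightarrow> nat \<Rightarrow> ('a \<times> 'a) list \<Rightarrow> bool" where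
  "prism_ring N m zs \<longleftrightarrow> length zs = m \<and> distinct (map fst zs @ map snd zs)
    \<and> (\<forall>i<m. snd (zs ! i) \<in> N (fst (zs ! i))
        \<and> fst (zs ! (Suc i mod m)) \<in> N (fst (zs ! i)) \<and> snd (zs ! (Suc i mod m)) \<in> N (snd (zs ! i)))"

lemma almost_regular_prism:
  fixes K :: real and j :: nat
  assumes K: "K \<ge> 1"
  shows "\<exists>C>0. \<forall>(V :: 'a set) N d. dgraph V N d (K * d) \<longrightarrow> V \<noteq> {} \<longrightarrow> C * real (card V) \<le> d\<^sup>2 \<longrightarrow>
    (\<exists>zs. prism_ring N (2 * (j + 4)) zs)"
proof -
  \<comment> \<open>\<open>\<eta>2\<close> makes the two terms in \<open>T_badc\<close> equal. Each
    of \<open>\<eta>1\<close>, \<open>\<eta>\<close>, \<open>\<eta>3\<close> and s then turns one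
    smallness condition into an equality, and C adds up the three quantities it has to
    dominate.\<close>
  define \<eta>1 \<eta>2 where "\<eta>1 = 1 / (8 * K ^ j)" and "\<eta>2 = \<eta>1\<^sup>2 / (2 * K)"
  define c1 where "c1 = \<eta>1\<^sup>2 * \<eta>2\<^sup>2 / 8"
  define \<eta> where "\<eta> = c1 / (8 * K ^ (j + 2))"
  define \<eta>3 where "\<eta>3 = c1 * \<eta> / (16 * K ^ (j + 3))"
  define c0 where "c0 = c1 * \<eta>\<^sup>2 * \<eta>3\<^sup>2 / 8"
  define A where "A = 2 * (real (j + 4))\<^sup>2 * K ^ (j + 4)"
  define s where "s = K * c0 / (6 * A)"
  define C where "C = 1 / s + K / s\<^sup>2 + (8 * (real (j + 4))\<^sup>2 * K ^ (j + 2) + 1) / c0"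
  have Kp: "K ^ m \<ge> 1" for m using K by simp
  have p1: "\<eta>1 > 0" using K by (simp add: \<eta>1_def)
  have p2: "\<eta>2 > 0" using K p1 by (simp add: \<eta>2_def)
  have pc1: "c1 > 0" using p1 p2 by (simp add: c1_def)
  have p: "\<eta> > 0" using pc1 K by (simp add: \<eta>_def)
  have p3: "\<eta>3 > 0" using pc1 p K by (simp add: \<eta>3_def)
  have pc0: "c0 > 0" using pc1 p p3 by (simp add: c0_def)
  have pA: "A > 0" using K by (simp add: A_def)
  have ps: "s > 0" using pc0 pA K by (simp add: s_def)
  have pC: "C > 0"
    using ps pc0 K by (auto simp: C_def intro!: add_pos_pos add_nonneg_pos divide_pos_pos)
  have l1: "\<eta>1 \<le> 1" using Kp[of j] by (simp add: \<eta>1_def)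
  have l2: "\<eta>2 \<le> 1"
  proof -
    have "\<eta>1\<^sup>2 \<le> 1" using l1 p1 by (simp add: power_le_one)
    then show ?thesis using K by (simp add: \<eta>2_def)
  qed
  have "\<eta>1\<^sup>2 * \<eta>2\<^sup>2 \<le> 1"
    using l1 l2 p1 p2 by (simp add: mult_le_one power_le_one)
  then have "c1 \<le> 1" by (simp add: c1_def)
  then have l: "\<eta> \<le> 1" using Kp[of "j + 2"] by (simp add: \<eta>_def)
  have "\<exists>zs. prism_ring N (2 * (j + 4)) zs"
    if G: "dgraph V N d (K * d)" and V: "V \<noteq> {}" "C * real (card V) \<le> d\<^sup>2" for V :: "'a set" and N d
  proof -
    interpret dgraph V N d "K * d" by (rule G)
    have "\<eta>1 + 2 * \<eta>2 * (K * d) / (\<eta>1 * d) = 2 * \<eta>1"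
      using d_pos p1 K by (simp add: \<eta>2_def power2_eq_square field_simps)
    then have "4 * (\<eta>1 + 2 * \<eta>2 * (K * d) / (\<eta>1 * d)) * (K * d) ^ j \<le> d ^ j"
      using K by (simp add: \<eta>1_def power_mult_distrib)
    moreover have "8 * \<eta> * (K * d) ^ (j + 2) \<le> c1 * d ^ (j + 2)"
      using K by (simp add: \<eta>_def power_mult_distrib)
    moreover have "16 * \<eta>3 * (K * d) ^ (j + 3) \<le> c1 * \<eta> * d ^ (j + 3)"
      using K by (simp add: \<eta>3_def power_mult_distrib)
    ultimately have g: "c0 * d ^ (j + 4) * real (card EE) \<le> T (j + 4) (\<lambda>xs. of_bool (good xs))"
      unfolding c0_def c1_def using p1 p2 p p3 l by (intro T_good) auto
    obtain zs where zs: "length zs = 2 * (j + 4)" "distinct (map fst zs @ map snd zs)" "set zs \<subseteq> EE"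
      "\<forall>i < 2 * (j + 4). adj (zs ! i) (zs ! (Suc i mod (2 * (j + 4))))"
    proof -
      have "3 * (2 * (real (j + 4))\<^sup>2 * K ^ (j + 4)) * s \<le> K * c0 / 2"
        using pA unfolding A_def[symmetric] by (simp add: s_def)
      moreover have "1 / s \<le> C" "K / s\<^sup>2 \<le> C"
        using ps pc0 K by (auto simp: C_def)
      moreover have "8 * (real (j + 4))\<^sup>2 * K ^ (j + 2) < c0 * C"
      proof -
        have "(8 * (real (j + 4))\<^sup>2 * K ^ (j + 2) + 1) / c0 \<le> C"
          using ps K by (simp add: C_def)
        then show ?thesis using pc0 by (simp add: field_simps)
      qed
      ultimately show ?thesis
        using exists_prism_of_dense[OF refl K pc0 ps pC g _ _ _ _ V] that by blast
    qed
    have "snd (zs ! i) \<in> N (fst (zs ! i))" if "i < 2 * (j + 4)" for i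
      using subsetD[OF zs(3) nth_mem] that zs(1) by (simp add: EE_def)
    then show ?thesis using zs(1,2,4) unfolding adj_def prism_ring_def by blast
  qed
  then show ?thesis using pC by blast
qed

section \<open>Passing to an almost regular subgraph\<close>

definition esub :: "'a set set \<Rightarrow> 'a set \<Rightarrow> nat" where
  "esub G U = card {x\<in>G. x \<subseteq> U}"

definition nbrs :: "'a set set \<Rightarrow> 'a set \<Rightarrow> 'a \<Rightarrow> 'a set" where
  "nbrs G U v = {u. v \<in> U \<and> u \<in> U \<and> {u, v} \<in> G}"

definition degr :: "'a set set \<Rightarrow> 'a set \<Rightarrow> 'a \<Rightarrow> nat" where
  "degr G U v = card {x\<in>G. x \<subseteq> U \<and> v \<in> x}"

lemma exists_top_subset:
  fixes f :: "'a \<Rightarrow> nat"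
  assumes "finite U" "t \<le> card U"
  shows "\<exists>S\<subseteq>U. card S = t \<and> (\<forall>v\<in>S. \<forall>w\<in>U - S. f w \<le> f v)"
  using assms(2)
proof (induction t)
  case 0
  show ?case by (rule exI[of _ "{}"]) simp
next
  case (Suc t)
  then obtain S where S: "S \<subseteq> U" "card S = t" "\<forall>v\<in>S. \<forall>w\<in>U - S. f w \<le> f v" by auto
  have fin: "finite S" "finite (U - S)" using S assms(1) finite_subset by auto
  have "U - S \<noteq> {}"
    using S Suc.prems by (metis Diff_eq_empty_iff Suc_n_not_le_n subset_antisym)
  then have "Max (f ` (U - S)) \<in> f ` (U - S)" using fin by (intro Max_in) auto
  then obtain m where m: "m \<in> U - S" "f m = Max (f ` (U - S))" by auto
  have "f w \<le> f m" if "w \<in> U - S" for w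
    unfolding m(2) using that fin by (intro Max_ge) auto
  then show ?case
    using S m fin by (intro exI[of _ "insert m S"]) auto
qed

lemma exists_block_cover:
  assumes "finite U" "t > 0"
  shows "\<exists>b. U = (\<Union>i\<le>card U div t. b i) \<and> (\<forall>i. b i \<subseteq> U \<and> card (b i) \<le> t)"
proof -
  obtain h where h: "bij_betw h {..<card U} U"
    using ex_bij_betw_nat_finite[OF assms(1)] by (auto simp: atLeast0LessThan)
  define b where "b i = h ` {k. k < card U \<and> k div t = i}" for i
  have "card (b i) \<le> t" for i
  proof -
    have "k \<in> {i * t..<i * t + t}" if "k div t = i" for k
      using div_mult_mod_eq[of k t] mod_less_divisor[OF assms(2), of k] that by auto
    then have "{k. k < card U \<and> k div t = i} \<subseteq> {i * t..<i * t + t}" by blast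
    then have "card {k. k < card U \<and> k div t = i} \<le> card {i * t..<i * t + t}"
      by (intro card_mono) auto
    then show ?thesis unfolding b_def using card_image_le[of "{k. k < card U \<and> k div t = i}" h] by simp
  qed
  moreover have "b i \<subseteq> U" for i
    using bij_betw_imp_surj_on[OF h] by (auto simp: b_def)
  moreover have "U \<subseteq> (\<Union>i\<le>card U div t. b i)"
  proof
    fix x assume "x \<in> U"
    then obtain k where k: "k < card U" "x = h k"
      using bij_betw_imp_surj_on[OF h] by auto
    then have "k div t \<le> card U div t" by (intro div_le_mono) auto
    then show "x \<in> (\<Union>i\<le>card U div t. b i)"
      using k by (auto simp: b_def)
  qed
  ultimately show ?thesis by blast
qed

locale simple_graph =
  fixes G :: "'a set set"
  assumes finite_G: "finite G" and edge_card: "x \<in> G \<Longrightarrow> card x = 2"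
begin

lemma card_nbrs: "v \<in> U \<Longrightarrow> card (nbrs G U v) = degr G U v"
  unfolding degr_def
proof (rule bij_betw_same_card[of "\<lambda>u. {u, v}"], rule bij_betwI')
  fix x y assume "x \<in> nbrs G U v" "y \<in> nbrs G U v"
  then show "({x, v} = {y, v}) = (x = y)" by (metis doubleton_eq_iff)
next
  fix x assume "x \<in> nbrs G U v"
  then show "{x, v} \<in> {x\<in>G. x \<subseteq> U \<and> v \<in> x}" by (auto simp: nbrs_def)
next
  fix y assume v: "v \<in> U" and y: "y \<in> {x\<in>G. x \<subseteq> U \<and> v \<in> x}"
  then obtain a b where "y = {a, b}" using edge_card[of y] by (auto simp: card_2_iff)
  then have "y = {a, v} \<or> y = {b, v}" using y by auto
  then obtain u where "y = {u, v}" by blast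
  then show "\<exists>x\<in>nbrs G U v. y = {x, v}" using y by (auto simp: nbrs_def)
qed

lemma sum_degr: "finite U \<Longrightarrow> (\<Sum>v\<in>U. degr G U v) = 2 * esub G U"
proof -
  assume U: "finite U"
  let ?E = "{x\<in>G. x \<subseteq> U}"
  have fE: "finite ?E" using finite_G by simp
  have "(\<Sum>v\<in>U. degr G U v) = (\<Sum>v\<in>U. \<Sum>x | x \<in> ?E \<and> v \<in> x. 1)"
    unfolding degr_def by (simp add: conj_assoc)
  also have "\<dots> = (\<Sum>x\<in>?E. \<Sum>v | v \<in> U \<and> v \<in> x. 1)"
    by (rule sum.swap_restrict[OF U fE])
  also have "\<dots> = (\<Sum>x\<in>?E. 2)"
  proof (rule sum.cong[OF refl])
    fix x assume x: "x \<in> ?E"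
    then have "{v. v \<in> U \<and> v \<in> x} = x" by auto
    then show "(\<Sum>v | v \<in> U \<and> v \<in> x. 1) = (2::nat)" using x edge_card by simp
  qed
  finally show ?thesis by (simp add: esub_def)
qed

lemma esub_remove: "esub G (U - {v}) + degr G U v = esub G U"
proof -
  have "{x\<in>G. x \<subseteq> U} = {x\<in>G. x \<subseteq> U - {v}} \<union> {x\<in>G. x \<subseteq> U \<and> v \<in> x}" by auto
  moreover have "{x\<in>G. x \<subseteq> U - {v}} \<inter> {x\<in>G. x \<subseteq> U \<and> v \<in> x} = {}" by auto
  ultimately show ?thesis
    unfolding esub_def degr_def using finite_G by (simp add: card_Un_disjoint)
qed

lemma esub_le_square: "finite U \<Longrightarrow> esub G U \<le> (card U)\<^sup>2"
proof -
  assume U: "finite U"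
  have "{x\<in>G. x \<subseteq> U} \<subseteq> (\<lambda>(a, b). {a, b}) ` (U \<times> U)"
  proof
    fix x assume x: "x \<in> {x\<in>G. x \<subseteq> U}"
    then obtain a b where "x = {a, b}" using edge_card[of x] by (auto simp: card_2_iff)
    then show "x \<in> (\<lambda>(a, b). {a, b}) ` (U \<times> U)" using x by auto
  qed
  then have "esub G U \<le> card ((\<lambda>(a, b). {a, b}) ` (U \<times> U))"
    unfolding esub_def using U by (intro card_mono) auto
  also have "\<dots> \<le> card (U \<times> U)" using U by (intro card_image_le) auto
  finally show ?thesis by (simp add: card_cartesian_product power2_eq_square)
qed

lemma fgraph_nbrs: "finite U \<Longrightarrow> fgraph U (nbrs G U)"
proof
  fix v show "v \<notin> nbrs G U v" using edge_card[of "{v}"] by (auto simp: nbrs_def)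
qed (auto simp: nbrs_def insert_commute)

text \<open>U maximises e(U)^3 / |U|^4, that is, e(U) / |U|^(4/3). An exponent below 3/2 lets the
  density e \<ge> C n^(3/2) pass to U; one above 1 forces small subsets of U to span
  disproportionately few edges.\<close>

lemma exists_dense_subset:
  assumes V: "finite V" and C: "C \<ge> 0" and e: "C\<^sup>2 * (real (card V))^3 \<le> (real (esub G V))\<^sup>2" and V0: "V \<noteq> {}"
  shows "\<exists>U\<subseteq>V. C\<^sup>2 * (real (card U))^3 \<le> (real (esub G U))\<^sup>2 \<and> U \<noteq> {} \<and>
    (\<forall>W\<subseteq>U. (real (esub G W))^3 * (real (card U))^4 \<le> (real (esub G U))^3 * (real (card W))^4)"
proof -
  define \<phi> where "\<phi> U = (real (esub G U))^3 / (real (card U))^4" for U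
  have fin: "finite (\<phi> ` (Pow V - {{}}))" using V by simp
  have "Max (\<phi> ` (Pow V - {{}})) \<in> \<phi> ` (Pow V - {{}})"
    using fin V0 by (intro Max_in) auto
  then obtain U where "U \<in> Pow V - {{}}" and U3: "Max (\<phi> ` (Pow V - {{}})) = \<phi> U" by (rule imageE)
  then have U: "U \<subseteq> V" "U \<noteq> {}" "\<phi> U = Max (\<phi> ` (Pow V - {{}}))" by auto
  have mx: "\<phi> W \<le> \<phi> U" if "W \<subseteq> V" "W \<noteq> {}" for W
    unfolding U(3) using that fin by (intro Max_ge) auto
  have fU: "finite U" using U V finite_subset by auto
  have cU: "real (card U) > 0" using U fU by (simp add: card_gt_0_iff)
  have cV: "real (card V) > 0" using V V0 by (simp add: card_gt_0_iff)
  have "(C\<^sup>2)^3 * real (card U) \<le> (C\<^sup>2)^3 * real (card V)"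
    using U V by (intro mult_left_mono) (auto intro: card_mono)
  also have "\<dots> = (C\<^sup>2 * (real (card V))^3)^3 / (real (card V))^8"
    using cV by (simp add: field_simps power_mult_distrib eval_nat_numeral)
  also have "\<dots> \<le> ((real (esub G V))\<^sup>2)^3 / (real (card V))^8"
    using e by (intro divide_right_mono power_mono) auto
  also have "\<dots> = (\<phi> V)\<^sup>2"
    by (simp add: \<phi>_def power_divide power_mult[symmetric])
  also have "\<dots> \<le> (\<phi> U)\<^sup>2"
    using mx[of V] V0 by (intro power_mono) (auto simp: \<phi>_def)
  also have "\<dots> = ((real (esub G U))\<^sup>2)^3 / (real (card U))^8"
    by (simp add: \<phi>_def power_divide power_mult[symmetric])
  finally have "(C\<^sup>2 * (real (card U))^3)^3 \<le> ((real (esub G U))\<^sup>2)^3"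
    using cU by (simp add: field_simps power_mult_distrib eval_nat_numeral)
  then have 1: "C\<^sup>2 * (real (card U))^3 \<le> (real (esub G U))\<^sup>2"
    by (rule power_le_imp_le_base[of _ 2, simplified]) simp
  have 2: "(real (esub G W))^3 * (real (card U))^4 \<le> (real (esub G U))^3 * (real (card W))^4" if W: "W \<subseteq> U" for W
  proof (cases "W = {}")
    case True
    have "{x\<in>G. x \<subseteq> {}} = {}" using edge_card by fastforce
    then have "esub G {} = 0" unfolding esub_def by (simp only: card.empty)
    then show ?thesis using True by simp
  next
    case False
    have "real (card W) > 0" using False W fU finite_subset by (auto simp: card_gt_0_iff)
    then show ?thesis using mx[of W] W U False cU by (simp add: \<phi>_def field_simps)
  qed
  show ?thesis using 1 2 U by blast
qed

text \<open>Discard a small proportion of the vertices, those of highest degree. By the maximality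
  assumption few edges lie between them and any block of as many vertices, so few edges are lost.\<close>

lemma exists_bounded_degree_subset:
  assumes U: "finite U" "1024 \<le> card U"
    and ext: "\<And>W. W \<subseteq> U \<Longrightarrow> (real (esub G W))^3 * (real (card U))^4 \<le> (real (esub G U))^3 * (real (card W))^4"
  shows "\<exists>U'\<subseteq>U. real (esub G U) / 2 \<le> real (esub G U') \<and>
    (\<forall>v\<in>U'. real (degr G U v) \<le> 4096 * real (esub G U) / real (card U))"
proof -
  define u where "u = real (card U)"
  define e where "e = real (esub G U)"
  \<comment> \<open>1024 = 16 * 64: in the block estimate, 16 comes from (2 t)^4 and 64 = 4^3 leaves
    the factor 1/4, so that at most 2 u / t blocks together lose at most half of the edges.\<close>
  define t where "t = card U div 1024"
  have t: "t > 0" "t \<le> card U" using U by (auto simp: t_def div_greater_zero_iff)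
  have u: "u > 0" using U by (simp add: u_def)
  have tu: "1024 * real t \<le> u"
    unfolding u_def t_def by (metis div_times_less_eq_dividend mult.commute of_nat_le_iff of_nat_mult of_nat_numeral)
  have "card U < 2048 * t"
  proof -
    have "card U = t * 1024 + card U mod 1024" unfolding t_def by (rule div_mult_mod_eq[symmetric])
    moreover have "card U mod 1024 < 1024" by (rule mod_less_divisor) simp
    ultimately show ?thesis using t(1) by linarith
  qed
  then have ut: "u \<le> 2048 * real t" unfolding u_def by (metis less_imp_le of_nat_le_iff of_nat_mult of_nat_numeral)
  obtain S where S: "S \<subseteq> U" "card S = t" and top: "\<forall>v\<in>S. \<forall>w\<in>U - S. degr G U w \<le> degr G U v"
    using exists_top_subset[OF U(1) t(2), of "degr G U"] by blast
  obtain b where b: "U = (\<Union>i\<le>card U div t. b i)" "\<And>i. b i \<subseteq> U \<and> card (b i) \<le> t"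
    using exists_block_cover[OF U(1) t(1)] by blast
  have fS: "finite S" using S U finite_subset by auto
  have blk: "real (esub G (S \<union> b i)) \<le> real t / (4 * u) * e" for i
  proof -
    have c: "real (card (S \<union> b i)) \<le> 2 * real t"
      using card_Un_le[of S "b i"] b(2)[of i] S by linarith
    have "(real (esub G (S \<union> b i)))^3 * u^4 \<le> e^3 * (real (card (S \<union> b i)))^4"
      using ext[of "S \<union> b i"] S b(2)[of i] by (simp add: u_def e_def)
    also have "\<dots> \<le> e^3 * (2 * real t)^4"
      using c by (intro mult_left_mono power_mono) (auto simp: e_def)
    also have "\<dots> = e^3 * (real t)^3 * (16 * real t)"
      by (simp add: eval_nat_numeral)
    also have "\<dots> \<le> e^3 * (real t)^3 * (u / 64)"
      using tu by (intro mult_left_mono) (auto simp: e_def)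
    also have "\<dots> = (real t / (4 * u) * e)^3 * u^4"
      using u by (simp add: power_mult_distrib power_divide eval_nat_numeral)
    finally have "(real (esub G (S \<union> b i)))^3 \<le> (real t / (4 * u) * e)^3"
      using u by simp
    then show ?thesis
      by (rule power_le_imp_le_base[of _ 2, simplified]) (use u in \<open>auto simp: e_def\<close>)
  qed
  have "{x\<in>G. x \<subseteq> U} \<subseteq> {x\<in>G. x \<subseteq> U - S} \<union> (\<Union>i\<le>card U div t. {x\<in>G. x \<subseteq> S \<union> b i})"
  proof
    fix x assume x: "x \<in> {x\<in>G. x \<subseteq> U}"
    show "x \<in> {x\<in>G. x \<subseteq> U - S} \<union> (\<Union>i\<le>card U div t. {x\<in>G. x \<subseteq> S \<union> b i})"
    proof (cases "x \<subseteq> U - S")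
      case False
      obtain p q where pq: "x = {p, q}" using x edge_card[of x] by (auto simp: card_2_iff)
      then have "\<exists>p q. x = {p, q} \<and> p \<in> S" using False x by blast
      then obtain p q where pq: "x = {p, q}" "p \<in> S" by blast
      then have "q \<in> U" using x by auto
      then obtain i where "i \<le> card U div t" "q \<in> b i" using b(1) by blast
      then show ?thesis using pq x by auto
    qed (use x in auto)
  qed
  then have "esub G U \<le> card ({x\<in>G. x \<subseteq> U - S} \<union> (\<Union>i\<le>card U div t. {x\<in>G. x \<subseteq> S \<union> b i}))"
    unfolding esub_def using finite_G by (intro card_mono) auto
  also have "\<dots> \<le> esub G (U - S) + card (\<Union>i\<le>card U div t. {x\<in>G. x \<subseteq> S \<union> b i})"
    unfolding esub_def by (rule card_Un_le)
  also have "\<dots> \<le> esub G (U - S) + (\<Sum>i\<le>card U div t. esub G (S \<union> b i))"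
    unfolding esub_def by (intro add_left_mono card_UN_le) auto
  finally have "e \<le> real (esub G (U - S)) + (\<Sum>i\<le>card U div t. real (esub G (S \<union> b i)))"
    unfolding e_def by (metis of_nat_add of_nat_le_iff of_nat_sum)
  also have "(\<Sum>i\<le>card U div t. real (esub G (S \<union> b i))) \<le> (\<Sum>i\<le>card U div t. real t / (4 * u) * e)"
    by (intro sum_mono blk)
  also have "\<dots> = real (card U div t + 1) * (real t / (4 * u) * e)" by simp
  also have "\<dots> \<le> (2 * u / real t) * (real t / (4 * u) * e)"
  proof (intro mult_right_mono)
    have "real (card U div t) \<le> u / real t" unfolding u_def by (rule of_nat_div_le_of_nat)
    moreover have "1 \<le> u / real t" using t by (simp add: u_def)
    ultimately show "real (card U div t + 1) \<le> 2 * u / real t" by simp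
  qed (use u in \<open>auto simp: e_def\<close>)
  also have "\<dots> = e / 2" using u t by simp
  finally have half: "e / 2 \<le> real (esub G (U - S))" by simp
  \<comment> \<open>All t vertices of S have at least the degree of v, and the degrees add up to 2
    e; 4096 arises as 2 * 2048 from u \<le> 2048 t.\<close>
  have deg: "real (degr G U v) \<le> 4096 * e / u" if v: "v \<in> U - S" for v
  proof -
    have "t * degr G U v = (\<Sum>w\<in>S. degr G U v)" using S by simp
    also have "\<dots> \<le> (\<Sum>w\<in>S. degr G U w)" using top v by (intro sum_mono) auto
    also have "\<dots> \<le> (\<Sum>w\<in>U. degr G U w)" using S U by (intro sum_mono2) auto
    also have "\<dots> = 2 * esub G U" by (rule sum_degr[OF U(1)])
    finally have "real t * real (degr G U v) \<le> 2 * e"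
      unfolding e_def by (metis of_nat_le_iff of_nat_mult of_nat_numeral)
    moreover have "u * real (degr G U v) \<le> 2048 * real t * real (degr G U v)"
      using ut by (intro mult_right_mono) auto
    ultimately have "u * real (degr G U v) \<le> 4096 * e" by linarith
    then show ?thesis using u by (simp add: field_simps)
  qed
  show ?thesis using half deg unfolding e_def u_def by (intro exI[of _ "U - S"]) auto
qed

lemma degr_mono: "W \<subseteq> U \<Longrightarrow> degr G W v \<le> degr G U v"
  unfolding degr_def using finite_G by (intro card_mono) auto

text \<open>Inside the subset of bounded degree, W maximises e(W) - d |W|, so removing a vertex of
  degree below d would be a gain. The trivial bound e \<le> u^2 gives u \<ge> C^2, so C \<ge> 32
  guarantees the 1024 vertices needed for the degree reduction.\<close>

lemma exists_almost_regular:
  assumes V: "finite V" and C: "C \<ge> 32" and e: "C\<^sup>2 * (real (card V))^3 \<le> (real (esub G V))\<^sup>2" and V0: "V \<noteq> {}"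
  shows "\<exists>W d. W \<noteq> {} \<and> dgraph W (nbrs G W) d (16384 * d) \<and> C\<^sup>2 / 16 * real (card W) \<le> d\<^sup>2"
proof -
  obtain U where U: "U \<subseteq> V" "U \<noteq> {}" and eU: "C\<^sup>2 * (real (card U))^3 \<le> (real (esub G U))\<^sup>2"
    and ext: "\<And>W. W \<subseteq> U \<Longrightarrow> (real (esub G W))^3 * (real (card U))^4 \<le> (real (esub G U))^3 * (real (card W))^4"
    using exists_dense_subset[OF V _ e V0] C by auto
  define u where "u = real (card U)"
  define m where "m = real (esub G U)"
  have fU: "finite U" using U V finite_subset by auto
  have u: "u > 0" using U fU by (simp add: u_def card_gt_0_iff)
  have eU: "C\<^sup>2 * u^3 \<le> m\<^sup>2" using eU by (simp add: u_def m_def)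
  have "m \<le> u\<^sup>2"
    using esub_le_square[OF fU] unfolding u_def m_def by (metis of_nat_le_iff of_nat_power)
  then have "m\<^sup>2 \<le> (u\<^sup>2)\<^sup>2" by (intro power_mono) (auto simp: m_def)
  then have "u^3 * C\<^sup>2 \<le> u^3 * u" using eU by (simp add: eval_nat_numeral mult.commute)
  then have "C\<^sup>2 \<le> u" using u by (simp add: mult_le_cancel_left)
  moreover have "(32::real)\<^sup>2 \<le> C\<^sup>2" using C by (intro power_mono) auto
  ultimately have "1024 \<le> card U" unfolding u_def by simp
  then obtain U' where U': "U' \<subseteq> U" "m / 2 \<le> real (esub G U')" "\<forall>v\<in>U'. real (degr G U v) \<le> 4096 * m / u"
    using exists_bounded_degree_subset[OF fU _ ext] unfolding m_def u_def by blast
  have m: "m > 0"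
  proof -
    have "0 < C\<^sup>2 * u^3" using C u by simp
    then have "m \<noteq> 0" using eU by auto
    then show ?thesis by (simp add: m_def)
  qed
  \<comment> \<open>A quarter of m / u: U' keeps at least m / 2 edges and d |U'| \<le> m / 4, so the
    maximum is positive and W nonempty. Moreover 4096 m / u is 16384 d.\<close>
  define d where "d = m / (4 * u)"
  have d: "d > 0" using m u by (simp add: d_def)
  define \<psi> where "\<psi> W = real (esub G W) - d * real (card W)" for W
  have fU': "finite U'" using U' fU finite_subset by auto
  have fin: "finite (\<psi> ` Pow U')" using fU' by simp
  have "Max (\<psi> ` Pow U') \<in> \<psi> ` Pow U'" using fin by (intro Max_in) auto
  then obtain W where W: "W \<subseteq> U'" "\<psi> W = Max (\<psi> ` Pow U')" by auto
  have mx: "\<psi> Z \<le> \<psi> W" if "Z \<subseteq> U'" for Z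
    unfolding W(2) using that fin by (intro Max_ge) auto
  have fW: "finite W" using W fU' finite_subset by auto
  have "d * real (card U') \<le> d * u"
    using d U' fU by (intro mult_left_mono) (auto simp: u_def intro: card_mono)
  also have "\<dots> = m / 4" using u by (simp add: d_def)
  finally have "0 < \<psi> U'" using U'(2) m by (simp add: \<psi>_def)
  then have "0 < \<psi> W" using mx[of U'] by simp
  moreover have "\<psi> {} = 0"
  proof -
    have "{x\<in>G. x \<subseteq> {}} = {}" using edge_card by fastforce
    then have "esub G {} = 0" unfolding esub_def by (simp only: card.empty)
    then show ?thesis by (simp add: \<psi>_def)
  qed
  ultimately have W0: "W \<noteq> {}" by auto
  have lo: "d \<le> real (card (nbrs G W v))" if v: "v \<in> W" for v
  proof -
    have "\<psi> (W - {v}) \<le> \<psi> W" using W by (intro mx) auto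
    moreover have "real (card (W - {v})) = real (card W) - 1"
      using v fW W0 by (simp add: card_gt_0_iff of_nat_diff Suc_le_eq)
    moreover have "real (esub G (W - {v})) + real (degr G W v) = real (esub G W)"
      using esub_remove[of W v] by (metis of_nat_add)
    ultimately have "d \<le> real (degr G W v)"
      by (simp add: \<psi>_def algebra_simps)
    then show ?thesis by (simp add: card_nbrs[OF v])
  qed
  have hi: "real (card (nbrs G W v)) \<le> 16384 * d" if v: "v \<in> W" for v
  proof -
    have "real (degr G W v) \<le> real (degr G U v)"
      using W U' by (intro of_nat_mono degr_mono) auto
    also have "\<dots> \<le> 4096 * m / u" using U' W v by auto
    also have "\<dots> = 16384 * d" by (simp add: d_def)
    finally show ?thesis by (simp add: card_nbrs[OF v])
  qed
  have "dgraph W (nbrs G W) d (16384 * d)"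
    using fgraph_nbrs[OF fW] lo hi d by (simp add: dgraph_def dgraph_axioms_def)
  moreover have "C\<^sup>2 / 16 * real (card W) \<le> d\<^sup>2"
  proof -
    have "card W \<le> card U" using W U' fU by (intro card_mono) auto
    then have "C\<^sup>2 / 16 * real (card W) \<le> C\<^sup>2 / 16 * u"
      by (intro mult_left_mono) (auto simp: u_def)
    also have "\<dots> = C\<^sup>2 * u^3 / (16 * u\<^sup>2)"
      using u by (simp add: eval_nat_numeral)
    also have "\<dots> \<le> m\<^sup>2 / (16 * u\<^sup>2)"
      using eU by (intro divide_right_mono) auto
    also have "\<dots> = d\<^sup>2" by (simp add: d_def power_divide power_mult_distrib)
    finally show ?thesis .
  qed
  ultimately show ?thesis using W0 by blast
qed

end

section \<open>Finite fields with 2^m elements and point-line incidence graphs\<close>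

lemma CHAR_bit: "CHAR(bit) = 2"
  by (rule CHAR_eq_posI) (auto simp: less_2_cases_iff)

text \<open>For m > 0 take the roots of X^q - X, q = 2^m, in the algebraic closure of the field with
  two elements. Its derivative is the constant -1, so there are q distinct roots; they are closed
  under addition since x \<mapsto> x^q is additive in characteristic 2.\<close>

lemma finite_field_ex:
  "\<exists>F :: bit alg_closure set. finite F \<and> card F = 2 ^ m \<and> (\<forall>x\<in>F. \<forall>y\<in>F. x + y \<in> F \<and> x * y \<in> F)"
proof -
  define q :: nat where "q = 2 ^ m"
  define F where "F = {x :: bit alg_closure. x ^ q = x}"
  have C: "CHAR(bit alg_closure) = 2" by (simp add: CHAR_bit)
  have closed: "x + y \<in> F \<and> x * y \<in> F" if "x \<in> F" "y \<in> F" for x y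
    using that freshmans_dream'[where 'a = "bit alg_closure", of q m x y]
    by (simp add: F_def CHAR_bit q_def power_mult_distrib)
  show ?thesis
  \<comment> \<open>For m = 0 the equation x^1 = x holds everywhere; {0} has the single element and
    the closure properties required.\<close>
  proof (cases "m = 0")
    case True
    show ?thesis
      by (rule exI[of _ "{0}"]) (use True in simp)
  next
    case False
    then have q: "q > 1" using one_less_power[of "2::nat" m] by (simp add: q_def)
    define p :: "bit alg_closure poly" where "p = monom 1 q - [:0, 1:]"
    have deg: "degree p = q"
    proof -
      have "degree ([:0, 1:] :: bit alg_closure poly) < degree (monom (1 :: bit alg_closure) q)"
        using q by (simp add: degree_monom_eq)
      then have "degree p = degree (monom (1 :: bit alg_closure) q)"
        unfolding p_def diff_conv_add_uminus by (intro degree_add_eq_left) simp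
      then show ?thesis by (simp add: degree_monom_eq)
    qed
    have p0: "p \<noteq> 0" using deg q by auto
    have root: "poly p x = 0 \<longleftrightarrow> x \<in> F" for x
      by (simp add: p_def F_def poly_monom)
    obtain A where A: "size A = degree p" "p = smult (lead_coeff p) (\<Prod>x\<in>#A. [:-x, 1:])"
      using alg_closed_imp_factorization[OF p0] by blast
    have "of_nat q = (0 :: bit alg_closure)"
      unfolding of_nat_eq_0_iff_char_dvd C using False by (simp add: q_def)
    then have pd: "pderiv p = - 1"
      by (simp add: p_def pderiv_diff pderiv_monom pderiv_pCons monom_0 flip: one_pCons)
    have cnt: "count A x \<le> 1" for x
    proof (rule ccontr)
      assume "\<not> ?thesis"
      then have c: "2 \<le> count A x" by simp
      then have "x \<in># A" by (simp flip: count_greater_zero_iff)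
      then obtain B where B: "A = add_mset x B" by (metis multi_member_split)
      then have "x \<in># B" using c by (simp flip: count_greater_zero_iff)
      then obtain A' where A': "A = add_mset x (add_mset x A')" using B by (metis multi_member_split)
      have "p = [:-x, 1:] * ([:-x, 1:] * smult (lead_coeff p) (\<Prod>y\<in>#A'. [:-y, 1:]))" (is "p = _ * (_ * ?r)")
        by (subst A(2)) (simp add: A')
      then have "poly (pderiv p) x = poly (pderiv ([:-x, 1:] * ([:-x, 1:] * ?r))) x"
        by simp
      also have "\<dots> = 0" by (simp add: pderiv_mult pderiv_smult del: mult_pCons_left mult_pCons_right)
      finally show False by (simp add: pd)
    qed
    have "set_mset A = F"
    proof -
      have "poly p x = lead_coeff p * (\<Prod>y\<in>#A. x - y)" for x
        by (subst A(2)) (simp add: poly_prod_mset image_mset.compositionality o_def)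
      moreover have "lead_coeff p \<noteq> 0" using p0 by simp
      ultimately have "poly p x = 0 \<longleftrightarrow> x \<in># A" for x
        by (auto simp: prod_mset_zero_iff)
      then show ?thesis using root by auto
    qed
    moreover have "card (set_mset A) = size A"
    proof -
      have "size A = (\<Sum>x\<in>set_mset A. count A x)" by (rule size_multiset_overloaded_eq)
      also have "\<dots> = (\<Sum>x\<in>set_mset A. 1)"
      proof (rule sum.cong[OF refl])
        fix x assume "x \<in># A"
        then show "count A x = 1" using cnt[of x] by (metis count_greater_zero_iff le_antisym One_nat_def Suc_leI)
      qed
      finally show ?thesis by simp
    qed
    ultimately have "finite F" "card F = 2 ^ m"
      using A(1) deg by (auto simp: q_def)
    then show ?thesis using closed by blast
  qed
qed

text \<open>The tags \<open>False\<close> for points and \<open>True\<close> for lines tell the two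
  ends of an edge apart, and point and line together determine x, a and b.\<close>

lemma card_incidence_graph:
  fixes F :: "'f :: field set"
  assumes F: "finite F" "\<And>x y. x \<in> F \<Longrightarrow> y \<in> F \<Longrightarrow> x + y \<in> F \<and> x * y \<in> F"
    and h: "inj_on h (UNIV \<times> F \<times> F)"
  shows "card ((\<lambda>(x, a, b). {h (False, x, a * x + b), h (True, a, b)}) ` (F \<times> F \<times> F)) = card F ^ 3"
proof -
  have "inj_on (\<lambda>(x, a, b). {h (False, x, a * x + b), h (True, a, b)}) (F \<times> F \<times> F)"
  proof (rule inj_onI)
    fix s t assume st: "s \<in> F \<times> F \<times> F" "t \<in> F \<times> F \<times> F"
      "(\<lambda>(x, a, b). {h (False, x, a * x + b), h (True, a, b)}) s = (\<lambda>(x, a, b). {h (False, x, a * x + b), h (True, a, b)}) t"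
    obtain x a b x' a' b' where s: "s = (x, a, b)" and t: "t = (x', a', b')"
      by (metis prod_cases3)
    have m: "x \<in> F" "a \<in> F" "b \<in> F" "x' \<in> F" "a' \<in> F" "b' \<in> F"
      and eq: "{h (False, x, a * x + b), h (True, a, b)} = {h (False, x', a' * x' + b'), h (True, a', b')}"
      using st unfolding s t by simp_all
    have "h (False, x, a * x + b) \<noteq> h (True, a', b')"
      using inj_onD[OF h, of "(False, x, a * x + b)" "(True, a', b')"] m F by auto
    then have "h (False, x, a * x + b) = h (False, x', a' * x' + b')" "h (True, a, b) = h (True, a', b')"
      using eq by (auto simp: doubleton_eq_iff)
    then show "s = t" unfolding s t
      using inj_onD[OF h, of "(False, x, a * x + b)" "(False, x', a' * x' + b')"]
        inj_onD[OF h, of "(True, a, b)" "(True, a', b')"] m F by auto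
  qed
  then show ?thesis
    using F by (simp add: card_image card_cartesian_product power3_eq_cube)
qed

text \<open>Two lines with two common points satisfy (a - a') (x - y) = 0, so the lines have equal
  slope and coincide, or the points do. The two cases at the end say whether u is a point or a
  line.\<close>

lemma incidence_graph_no_4cycle:
  fixes F :: "'f :: field set"
  defines "G \<equiv> (\<lambda>h. (\<lambda>(x, a, b). {h (False, x, a * x + b), h (True, a, b)}) ` (F \<times> F \<times> F))"
  assumes F: "\<And>x y. x \<in> F \<Longrightarrow> y \<in> F \<Longrightarrow> x + y \<in> F \<and> x * y \<in> F"
    and h: "inj_on h (UNIV \<times> F \<times> F)"
    and e: "{u, v} \<in> G h" "{v, w} \<in> G h" "{w, z} \<in> G h" "{z, u} \<in> G h"
  shows "u = w \<or> v = z"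
proof -
  define R where "R u v \<longleftrightarrow> (\<exists>x\<in>F. \<exists>a\<in>F. \<exists>b\<in>F. u = h (False, x, a * x + b) \<and> v = h (True, a, b))" for u v
  have edge: "R u v \<or> R v u" if uv: "{u, v} \<in> G h" for u v
  proof -
    obtain x a b where m: "x \<in> F" "a \<in> F" "b \<in> F" and "{u, v} = {h (False, x, a * x + b), h (True, a, b)}"
      using uv unfolding G_def by auto
    then have "u = h (False, x, a * x + b) \<and> v = h (True, a, b) \<or> u = h (True, a, b) \<and> v = h (False, x, a * x + b)"
      by (simp add: doubleton_eq_iff)
    then show ?thesis using m unfolding R_def by blast
  qed
  have side: "\<not> (R u v \<and> R v w)" for u v w
  proof
    assume "R u v \<and> R v w"
    then obtain a b x y where m: "a \<in> F" "b \<in> F" "x \<in> F" "y \<in> F" and "h (True, a, b) = h (False, x, y)"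
      using F unfolding R_def by (metis (no_types, opaque_lifting))
    then show False using inj_onD[OF h, of "(True, a, b)" "(False, x, y)"] by auto
  qed
  have key: "u = w \<or> v = z" if uv: "R u v" "R u z" and wv: "R w v" "R w z" for u v w z
  proof -
    obtain x a b where 1: "x \<in> F" "a \<in> F" "b \<in> F" "u = h (False, x, a * x + b)" "v = h (True, a, b)"
      using uv unfolding R_def by blast
    obtain x' a' b' where 2: "x' \<in> F" "a' \<in> F" "b' \<in> F" "u = h (False, x', a' * x' + b')" "z = h (True, a', b')"
      using uv unfolding R_def by blast
    obtain y c d where 3: "y \<in> F" "c \<in> F" "d \<in> F" "w = h (False, y, c * y + d)" "v = h (True, c, d)"
      using wv unfolding R_def by blast
    obtain y' c' d' where 4: "y' \<in> F" "c' \<in> F" "d' \<in> F" "w = h (False, y', c' * y' + d')" "z = h (True, c', d')"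
      using wv unfolding R_def by blast
    have i: "h s = h t \<Longrightarrow> s \<in> UNIV \<times> F \<times> F \<Longrightarrow> t \<in> UNIV \<times> F \<times> F \<Longrightarrow> s = t" for s t
      using h by (meson inj_onD)
    have "(False, x, a * x + b) = (False, x', a' * x' + b')"
      by (rule i) (use 1 2 F in auto)
    moreover have "(True, a, b) = (True, c, d)"
      by (rule i) (use 1 3 in auto)
    moreover have "(False, y, c * y + d) = (False, y', c' * y' + d')"
      by (rule i) (use 3 4 F in auto)
    moreover have "(True, a', b') = (True, c', d')"
      by (rule i) (use 2 4 in auto)
    ultimately have eqs: "x' = x" "y' = y" "c = a" "d = b" "c' = a'" "d' = b'"
      and l: "a * x + b = a' * x + b'" "a * y + b = a' * y + b'" by auto
    have "(a - a') * (x - y) = 0"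
    proof -
      have "a * x - a' * x = b' - b" "a * y - a' * y = b' - b"
        using l by (simp_all add: algebra_simps)
      then have "(a * x - a' * x) - (a * y - a' * y) = 0" by simp
      then show ?thesis by (simp add: algebra_simps)
    qed
    then have "a = a' \<or> x = y" by auto
    then show ?thesis
    proof
      assume "a = a'"
      then have "b = b'" using l by simp
      then show ?thesis using 1 2 \<open>a = a'\<close> by simp
    next
      assume "x = y"
      then show ?thesis using 1 3 eqs by simp
    qed
  qed
  from edge[OF e(1)] show ?thesis
  proof
    assume "R u v"
    moreover then have "R w v" using edge[OF e(2)] side by blast
    moreover then have "R w z" using edge[OF e(3)] side by blast
    moreover then have "R u z" using edge[OF e(4)] side by blast
    ultimately show ?thesis using key by blast
  next
    assume "R v u"
    moreover then have "R v w" using edge[OF e(2)] side by blast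
    moreover then have "R z w" using edge[OF e(3)] side by blast
    moreover then have "R z u" using edge[OF e(4)] side by blast
    ultimately show ?thesis using key[of v u w z] by blast
  qed
qed

section \<open>The bounds for the extremal number\<close>

lemma powr_three_halves:
  assumes "x \<ge> 0"
  shows "x powr (3 / 2) = x * sqrt x"
proof (cases "x = 0")
  case False
  have "x powr (3 / 2) = x powr (1 + 1 / 2)" by simp
  also have "\<dots> = x * sqrt x"
    unfolding powr_add using assms False by (simp add: powr_half_sqrt)
  finally show ?thesis .
qed simp

lemma prism_edges:
  assumes "i < 2 * l"
  shows "{(i, b), (Suc i mod (2 * l), b)} \<in> prism l" "{(i, False), (i, True)} \<in> prism l"
  using assms by (auto simp: prism_def)

lemma Union_prism: "\<Union>(prism l) \<subseteq> {..<2 * l} \<times> UNIV"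
  by (auto simp: prism_def mod_less_divisor)

lemma finite_graphs_on: "finite (graphs_on n)"
  by (rule finite_subset[of _ "Pow (Pow {..<n})"]) (auto simp: graphs_on_def)

text \<open>\<open>Max\<close> is meaningful only for a nonempty finite set; the empty graph
  supplies an element.\<close>

lemma ex_le:
  assumes "\<And>G. G \<in> graphs_on n \<Longrightarrow> \<not> contains_subgraph G (prism l) \<Longrightarrow> real (card G) \<le> c" and l: "l > 0"
  shows "real (ex n (prism l)) \<le> c"
proof -
  let ?S = "{card G | G. G \<in> graphs_on n \<and> \<not> contains_subgraph G (prism l)}"
  have "prism l \<noteq> {}" using prism_edges[of 0 l] l by auto
  then have "{} \<in> graphs_on n" "\<not> contains_subgraph {} (prism l)"
    by (auto simp: graphs_on_def contains_subgraph_def)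
  then have "?S \<noteq> {}" by blast
  moreover have "finite ?S" using finite_graphs_on by simp
  ultimately have "ex n (prism l) \<in> ?S" unfolding ex_def by (rule Max_in[rotated])
  then show ?thesis using assms by auto
qed

lemma le_ex:
  assumes "G \<in> graphs_on n" "\<not> contains_subgraph G F"
  shows "card G \<le> ex n F"
  unfolding ex_def using assms finite_graphs_on by (intro Max_ge) auto

lemma contains_prismI:
  assumes l: "length zs = 2 * l" and d: "distinct (map fst zs @ map snd zs)"
    and e: "\<And>i. i < 2 * l \<Longrightarrow> {fst (zs ! i), snd (zs ! i)} \<in> G
      \<and> {fst (zs ! i), fst (zs ! (Suc i mod (2 * l)))} \<in> G \<and> {snd (zs ! i), snd (zs ! (Suc i mod (2 * l)))} \<in> G"
  shows "contains_subgraph G (prism l)"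
proof -
  define f where "f = (\<lambda>(i, b). if b then snd (zs ! i) else fst (zs ! i))"
  let ?vs = "map fst zs @ map snd zs"
  \<comment> \<open>The vertices are positions in one distinct list, with the second cycle shifted
    by 2 l, so f is injective.\<close>
  have f: "f (i, b) = ?vs ! (i + (if b then 2 * l else 0))" if "i < 2 * l" for i b
    using that l by (auto simp: f_def nth_append)
  have "inj_on f ({..<2 * l} \<times> UNIV)"
  proof (rule inj_onI)
    fix s t :: "nat \<times> bool" assume st: "s \<in> {..<2 * l} \<times> UNIV" "t \<in> {..<2 * l} \<times> UNIV" "f s = f t"
    obtain i b i' b' where s: "s = (i, b)" "t = (i', b')" by fastforce
    have "i + (if b then 2 * l else 0) = i' + (if b' then 2 * l else 0)"
      using st f l nth_eq_iff_index_eq[OF d] unfolding s by auto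
    then show "s = t" using st unfolding s by (auto split: if_splits)
  qed
  then have "inj_on f (\<Union>(prism l))" by (rule inj_on_subset[OF _ Union_prism])
  moreover have "f ` x \<in> G" if "x \<in> prism l" for x
    using that e by (auto simp: prism_def f_def split: if_splits)
  ultimately show ?thesis unfolding contains_subgraph_def by blast
qed

lemma upper_bound:
  "\<exists>C>0. \<forall>n>0. real (ex n (prism (j + 4))) \<le> C * real n powr (3 / 2)"
proof -
  have "\<exists>C>0. \<forall>(V :: nat set) N d. dgraph V N d (16384 * d) \<longrightarrow> V \<noteq> {} \<longrightarrow> C * real (card V) \<le> d\<^sup>2 \<longrightarrow>
    (\<exists>zs. prism_ring N (2 * (j + 4)) zs)"
    by (rule almost_regular_prism) simp
  then obtain C1 :: real where C1: "C1 > 0" and prism: "\<forall>(V :: nat set) N d. dgraph V N d (16384 * d) \<longrightarrow> V \<noteq> {} \<longrightarrow>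
      C1 * real (card V) \<le> d\<^sup>2 \<longrightarrow> (\<exists>zs. prism_ring N (2 * (j + 4)) zs)"
    by (elim exE conjE) (rule that)
  \<comment> \<open>Both demands on C hold: it is at least 32, and C^2 / 16 \<ge> C1 because (32 +
    C1)^2 \<ge> 64 C1.\<close>
  define C where "C = 32 + C1"
  have C: "C \<ge> 32" "C1 \<le> C\<^sup>2 / 16" using C1 by (auto simp: C_def power2_eq_square algebra_simps)
  have "real (ex n (prism (j + 4))) \<le> C * real n powr (3 / 2)" if n: "n > 0" for n
  proof (rule ex_le)
    fix G assume G: "G \<in> graphs_on n" and no: "\<not> contains_subgraph G (prism (j + 4))"
    show "real (card G) \<le> C * real n powr (3 / 2)"
    proof (rule ccontr)
      assume "\<not> ?thesis"
      then have big: "C * (real n * sqrt (real n)) \<le> real (card G)"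
        by (simp add: powr_three_halves)
      interpret simple_graph G
      proof
        have "G \<subseteq> Pow {..<n}" using G by (auto simp: graphs_on_def)
        then show "finite G" by (rule finite_subset) simp
      qed (use G in \<open>auto simp: graphs_on_def\<close>)
      have "{x\<in>G. x \<subseteq> {..<n}} = G" using G by (auto simp: graphs_on_def)
      then have eG: "esub G {..<n} = card G" by (simp add: esub_def)
      have "C\<^sup>2 * (real (card {..<n}))^3 = (C * (real n * sqrt (real n)))\<^sup>2"
        by (simp add: power_mult_distrib eval_nat_numeral)
      also have "\<dots> \<le> (real (esub G {..<n}))\<^sup>2"
        unfolding eG using big C by (intro power_mono) auto
      finally obtain W d where W: "W \<noteq> {}" "dgraph W (nbrs G W) d (16384 * d)" "C\<^sup>2 / 16 * real (card W) \<le> d\<^sup>2"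
        using exists_almost_regular[of "{..<n}" C] C n by (auto simp: lessThan_empty_iff)
      have "C1 * real (card W) \<le> C\<^sup>2 / 16 * real (card W)"
        using C by (intro mult_right_mono) auto
      then have "C1 * real (card W) \<le> d\<^sup>2" using W by linarith
      then obtain zs where "prism_ring (nbrs G W) (2 * (j + 4)) zs"
        using prism W by blast
      then have "contains_subgraph G (prism (j + 4))"
        unfolding prism_ring_def by (intro contains_prismI) (auto simp: nbrs_def insert_commute)
      with no show False by blast
    qed
  qed simp
  moreover have "C > 0" using C by simp
  ultimately show ?thesis by blast
qed

text \<open>The first two rungs and the two cycle edges joining them.\<close>

lemma contains_prism_4cycle:
  assumes "contains_subgraph G (prism l)" "l \<ge> 2"
  shows "\<exists>u v w z. {u, v} \<in> G \<and> {v, w} \<in> G \<and> {w, z} \<in> G \<and> {z, u} \<in> G \<and> u \<noteq> w \<and> v \<noteq> z"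
proof -
  obtain f where inj: "inj_on f (\<Union>(prism l))" and f: "\<forall>x\<in>prism l. f ` x \<in> G"
    using assms by (auto simp: contains_subgraph_def)
  have e: "{(0, b), (1, b)} \<in> prism l" "{(0, False), (0, True)} \<in> prism l" "{(1, False), (1, True)} \<in> prism l" for b
    using prism_edges[of 0 l] prism_edges[of 1 l] assms(2) by auto
  have G: "{f (0, b), f (1, b)} \<in> G" "{f (0, False), f (0, True)} \<in> G" "{f (1, False), f (1, True)} \<in> G" for b
    using f e(1)[of b] e(2,3) by (metis image_empty image_insert)+
  have mem: "(0, b) \<in> \<Union>(prism l)" "(1, b) \<in> \<Union>(prism l)" for b
    using e(1)[of b] by auto
  have "f (0, False) \<noteq> f (1, True)" "f (1, False) \<noteq> f (0, True)"
    using inj_onD[OF inj _ mem(1) mem(2)] inj_onD[OF inj _ mem(2) mem(1)] by fastforce+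
  then show ?thesis
    using G by (intro exI[of _ "f (0, False)"] exI[of _ "f (1, False)"] exI[of _ "f (1, True)"] exI[of _ "f (0, True)"])
      (auto simp: insert_commute)
qed

lemma ex_prism_ge_cube:
  assumes n: "2 * (2 ^ m)\<^sup>2 \<le> n" and l: "l \<ge> 2"
  shows "(2 ^ m) ^ 3 \<le> ex n (prism l)"
proof -
  obtain F :: "bit alg_closure set" where F: "finite F" "card F = 2 ^ m"
    "\<And>x y. x \<in> F \<Longrightarrow> y \<in> F \<Longrightarrow> x + y \<in> F \<and> x * y \<in> F"
    using finite_field_ex[of m] by blast
  let ?S = "(UNIV :: bool set) \<times> F \<times> F"
  have "card ?S \<le> card {..<n}" "finite ?S"
    using n F by (simp_all add: card_cartesian_product power2_eq_square)
  then obtain h where h: "h ` ?S \<subseteq> {..<n}" "inj_on h ?S"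
    using inj_on_iff_card_le[of ?S "{..<n}"] by auto
  define G where "G = (\<lambda>(x, a, b). {h (False, x, a * x + b), h (True, a, b)}) ` (F \<times> F \<times> F)"
  have "G \<in> graphs_on n"
    unfolding graphs_on_def
  proof (intro CollectI ballI)
    fix e assume "e \<in> G"
    then obtain x a b where m: "x \<in> F" "a \<in> F" "b \<in> F" and e: "e = {h (False, x, a * x + b), h (True, a, b)}"
      by (auto simp: G_def)
    have mem: "(False, x, a * x + b) \<in> ?S" "(True, a, b) \<in> ?S" using m F by auto
    then have "h (False, x, a * x + b) \<noteq> h (True, a, b)"
      using inj_onD[OF h(2)] by fastforce
    then show "e \<subseteq> {..<n} \<and> card e = 2"
      using h(1) mem unfolding e by (auto simp del: lessThan_iff)
  qed
  moreover have "\<not> contains_subgraph G (prism l)"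
  proof
    assume "contains_subgraph G (prism l)"
    then obtain u v w z where "{u, v} \<in> G" "{v, w} \<in> G" "{w, z} \<in> G" "{z, u} \<in> G" "u \<noteq> w" "v \<noteq> z"
      using contains_prism_4cycle[OF _ l] by blast
    then show False
      using incidence_graph_no_4cycle[OF F(3) h(2), of u v w z] unfolding G_def by blast
  qed
  ultimately have "card G \<le> ex n (prism l)" by (rule le_ex)
  then show ?thesis
    using card_incidence_graph[OF F(1) F(3) h(2)] F(2) unfolding G_def by simp
qed

text \<open>With q the largest power of 2 such that 2 q^2 \<le> n, doubling q violates the bound, so
  n < 8 q^2 and sqrt n \<le> 3 q. Hence n^(3/2) \<le> 24 q^3.\<close>

lemma lower_bound:
  assumes l: "l \<ge> 2" and n: "n \<ge> 2"
  shows "1 / 24 * real n powr (3 / 2) \<le> real (ex n (prism l))"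
proof -
  let ?P = "\<lambda>m. 2 * (2 ^ m)\<^sup>2 \<le> n"
  have b: "m \<le> n" if "?P m" for m
  proof -
    have "m \<le> 2 ^ m" by (rule less_imp_le) (rule less_exp)
    also have "\<dots> \<le> 2 * (2 ^ m)\<^sup>2" by (simp add: power2_eq_square)
    finally show ?thesis using that by simp
  qed
  define m where "m = (GREATEST m. ?P m)"
  define q :: nat where "q = 2 ^ m"
  have P0: "?P 0" using n by simp
  have 1: "2 * q\<^sup>2 \<le> n" unfolding q_def m_def by (rule GreatestI_nat[of ?P, OF P0 b])
  have "\<not> ?P (Suc m)"
    using Greatest_le_nat[of ?P "Suc m" n] b unfolding m_def by fastforce
  then have "n < 8 * q\<^sup>2" by (simp add: q_def power_mult_distrib)
  then have nq: "real n \<le> 8 * (real q)\<^sup>2" 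
    by (metis less_imp_le of_nat_le_iff of_nat_mult of_nat_numeral of_nat_power)
  have "sqrt (real n) \<le> 3 * real q"
    using nq by (intro real_le_lsqrt) (auto simp: power_mult_distrib)
  then have "real n * sqrt (real n) \<le> 8 * (real q)\<^sup>2 * (3 * real q)"
    using nq by (intro mult_mono) auto
  then have "1 / 24 * real n powr (3 / 2) \<le> (real q) ^ 3"
    by (simp add: powr_three_halves eval_nat_numeral)
  also have "\<dots> = real ((2 ^ m) ^ 3)" by (simp add: q_def)
  also have "\<dots> \<le> real (ex n (prism l))"
    using ex_prism_ge_cube[OF _ l, of m n] 1 unfolding q_def by (intro of_nat_mono) auto
  finally show ?thesis .
qed

theorem theorem1p1:
  fixes l :: nat
  assumes "l \<ge> 4"
  shows "\<exists>c C :: real. c > 0 \<and> C > 0 \<and>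
    (\<forall>\<^sub>F n in sequentially.
        c * real n powr (3/2) \<le> real (ex n (prism l)) \<and>
        real (ex n (prism l)) \<le> C * real n powr (3/2))"
proof -
  obtain j where l: "l = j + 4" using assms by (metis le_add_diff_inverse2)
  obtain C :: real where C: "C > 0" "\<forall>n>0. real (ex n (prism (j + 4))) \<le> C * real n powr (3 / 2)"
    using upper_bound by blast
  have "\<forall>\<^sub>F n in sequentially. 1 / 24 * real n powr (3/2) \<le> real (ex n (prism l)) \<and>
        real (ex n (prism l)) \<le> C * real n powr (3/2)"
    using eventually_ge_at_top[of 2]
    by eventually_elim (use C lower_bound[of l] assms l in auto)
  then show ?thesis using C(1) by (intro exI[of _ "1 / 24"] exI[of _ C]) auto
qed

end
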